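(* There is a distributive law of $\mathbb{K}$-algebras $\omega\colon \mathrm{Simp}\otimes_{\mathbb{K}}\mathrm{Sym}\to \mathrm{Sym}\otimes_{\mathbb{K}}\mathrm{Simp}$ determined on generators, for all $n\ge 1$, $0\le i\le n$, $0\le j\le n-1$, by \[ \omega(\partial_i^n\otimes\chi_j^n)=\begin{cases} \chi_{j+1}^{n+1}\otimes\partial_i^n & \text{if } j>i,\\ \chi_{i+1}^{n+1}\chi_i^{n+1}\otimes\partial_{i+1}^n-\chi_{i+1}^{n+1}\chi_i^{n+1}\chi_{i+1}^{n+1}\otimes\partial_i^n+\chi_i^{n+1}\chi_{i+1}^{n+1}\otimes\partial_{i-1}^n & \text{if } j=i,\\ \chi_j^{n+1}\otimes\partial_i^n & \text{if } j<i, \end{cases} \] (with the convention $\partial_{-1}^n:=0$), i.e. by the relations $\rho^n_i\chi^n_j=\dots$ of Lemma 3.8 with $\rho$ replaced by $\partial$. Consequently the left Leibniz $\mathbb{K}$-algebra $\mathrm{Leib}$ is isomorphic, as a $\mathbb{K}$-algebra, to the twisted product $\mathrm{Sym}\otimes_\omega\mathrm{Simp}$, via the isomorphism $\mathrm{Sym}\otimes_\omega\mathrm{Simp}\to\mathrm{Leib}$ sending $\chi_j^n\mapsto\chi_j^n$ and $\partial^n_j\mapsto\rho^n_j$.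
   Context: Let $\Bbbk$ be a field. Let $\mathbb{K}=\bigoplus_{n\in\mathbb{N}}\Bbbk 1_n$ be the locally unital algebra with $1_n1_m=\delta_{nm}1_n$. A faithful $\mathbb{K}$-bimodule is a doubly graded vector space $V=\bigoplus_{n,m\in\mathbb{N}}V_{n,m}$ with $1_n x1_m=x$ for $x\in V_{n,m}$ and all other actions of the $1_k$ zero; $(V\otimes_{\mathbb K}W)_{n,\ell}=\bigoplus_m V_{n,m}\otimes W_{m,\ell}$. A $\mathbb{K}$-algebra is a faithful $\mathbb{K}$-bimodule $V$ with an associative multiplication $\mu\colon V\otimes_{\mathbb K}V\to V$ and unit $\mathbb{K}\to V$ (equivalently the categorical algebra of a small $\Bbbk$-linear category with object set $\mathbb N$). The free $\mathbb K$-algebra is $T(V)=\mathbb{K}\oplus\bigoplus_{k\ge1}V^{\otimes_{\mathbb K}k}$ with concatenation. Let $\partial$ be the faithful $\mathbb K$-bimodule with basis $\partial^n_j$ ($n\ge0$, $0\le j\le n$) with $\partial^n_j\in\partial_{n+1,n}$, and $\chi$ the one with basis $\chi^n_i$ ($n\ge1$, $0\le i\le n-1$) with $\chi^n_i\in\chi_{n,n}$; products of generators whose degrees do not match are $0$. $\mathrm{Mag}=T(\partial)/\langle \partial^{n+1}_i\partial^n_j-\partial^{n+1}_{j+1}\partial^n_i : 0\le i<j\le n,\ n\ge0\rangle$; $\mathrm{Simp}=T(\partial)/\langle \partial^{n+1}_i\partial^n_j-\partial^{n+1}_{j+1}\partial^n_i : 0\le i\le j\le n,\ n\ge0\rangle$.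 $\mathrm{Braid}=T(\chi)/\langle \chi^n_i\chi^n_j-\chi^n_j\chi^n_i\ (|i-j|\ge2),\ \chi^n_i\chi^n_{i+1}\chi^n_i-\chi^n_{i+1}\chi^n_i\chi^n_{i+1}\ (0\le i\le n-2),\ n\ge2\rangle$, and $\mathrm{Sym}=\mathrm{Braid}/\langle\chi^n_i\chi^n_i-1_n\rangle$; so $1_n\mathrm{Sym}1_n\cong\Bbbk[S_{n+1}]$ with $\chi^n_i$ the transposition of $i,i+1$ in $\{0,\dots,n\}$. A $\mathbb K$-bimodule map $\omega\colon\mathcal B\otimes_{\mathbb K}\mathcal A\to\mathcal A\otimes_{\mathbb K}\mathcal B$ between $\mathbb K$-algebras is a distributive law if $\omega(\mu_{\mathcal B}\otimes\mathcal A)=(\mathcal A\otimes\mu_{\mathcal B})(\omega\otimes\mathcal B)(\mathcal B\otimes\omega)$, $\omega(\mathcal B\otimes\mu_{\mathcal A})=(\mu_{\mathcal A}\otimes\mathcal B)(\mathcal A\otimes\omega)(\omega\otimes\mathcal A)$, $\omega(b\otimes 1)=1\otimes b$ and $\omega(1\otimes a)=a\otimes1$ (units from $\mathbb K$). The twisted product $\mathcal A\otimes_\omega\mathcal B$ is $\mathcal A\otimes_{\mathbb K}\mathcal B$ with multiplication $(\mu_{\mathcal A}\otimes\mu_{\mathcal B})(\mathcal A\otimes\omega\otimes\mathcal B)$. The distributive law $\zeta\colon\mathrm{Mag}\otimes_{\mathbb K}\mathrm{Sym}\to\mathrm{Sym}\otimes_{\mathbb K}\mathrm{Mag}$ is given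 on generators by $\zeta(\partial_i^n\otimes\chi_j^n)=\chi^{n+1}_{j+1}\otimes\partial^n_i$ if $i<j$; $\chi^{n+1}_{i+1}\chi^{n+1}_i\otimes\partial^n_{i+1}$ if $i=j$; $\chi^{n+1}_{i-1}\chi^{n+1}_i\otimes\partial^n_{i-1}$ if $i=j+1$; $\chi^{n+1}_j\otimes\partial^n_i$ if $i>j+1$. In $\mathrm{Sym}\otimes_\zeta\mathrm{Mag}$ write $\partial^n_j$ for $1_{n+1}\otimes\partial^n_j$ and $\chi^n_j$ for $\chi^n_j\otimes1_n$. $\mathrm{Leib}=(\mathrm{Sym}\otimes_\zeta\mathrm{Mag})/I_{\mathrm{Leib}}$ where $I_{\mathrm{Leib}}$ is the two-sided ideal generated by $\partial^{n+1}_{j+1}\partial^n_j-(1_{n+2}-\chi^{n+2}_{j+1})\partial^{n+1}_j\partial^n_j$ for $0\le j\le n$, $n\ge0$. In $\mathrm{Leib}$ define $\rho^n_{-1}=0$ and $\rho^n_{j+1}=\partial^n_{j+1}+\chi^{n+1}_{j+1}\rho^n_j$ for $-1\le j\le n-1$; equivalently $\rho^n_j=\partial^n_j+\sum_{a=1}^j\chi^{n+1}_j\cdots\chi^{n+1}_a\partial^n_{a-1}$. *)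

theory Defs
  imports Main "HOL-Library.Poly_Mapping"
begin

text \<open>Generators of the algebras: Dg n j is the face generator partial^n_j (in degree (n+1,n)),
  Xg n i is the transposition generator chi^n_i (in degree (n,n)).\<close>

datatype gen = Dg nat nat | Xg nat nat

fun gsrc :: "gen \<Rightarrow> nat" where
  "gsrc (Dg n j) = n"
| "gsrc (Xg n i) = n"

fun gtgt :: "gen \<Rightarrow> nat" where
  "gtgt (Dg n j) = Suc n"
| "gtgt (Xg n i) = n"

definition Dgens :: "gen set" where
  "Dgens = {Dg n j | n j. j \<le> n}"

definition Xgens :: "gen set" where
  "Xgens = {Xg n i | n i. i < n}"

text \<open>A word (m, [g1,...,gk]) stands for the product g1 g2 ... gk in the free K-algebra,
  an element of V_{tgt,m}; the empty word (m, []) is the local unit 1_m.\<close>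

type_synonym word = "nat \<times> gen list"

fun chain :: "gen set \<Rightarrow> nat \<Rightarrow> gen list \<Rightarrow> bool" where
  "chain G m [] = True"
| "chain G m [g] = (g \<in> G \<and> gsrc g = m)"
| "chain G m (g # h # gs) = (g \<in> G \<and> gsrc g = gtgt h \<and> chain G m (h # gs))"

definition wvalid :: "gen set \<Rightarrow> word \<Rightarrow> bool" where
  "wvalid G w = chain G (fst w) (snd w)"

definition wsrc :: "word \<Rightarrow> nat" where
  "wsrc w = fst w"

definition wtgt :: "word \<Rightarrow> nat" where
  "wtgt w = (if snd w = [] then fst w else gtgt (hd (snd w)))"

text \<open>Concatenation (used only for composable words: wsrc v = wtgt w).\<close>
definition wcat :: "word \<Rightarrow> word \<Rightarrow> word" where
  "wcat v w = (fst w, snd v @ snd w)"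

definition unitw :: "nat \<Rightarrow> word" where
  "unitw n = (n, [])"

definition smult :: "'k::field \<Rightarrow> ('b \<Rightarrow>\<^sub>0 'k) \<Rightarrow> ('b \<Rightarrow>\<^sub>0 'k)" where
  "smult c p = Poly_Mapping.map (\<lambda>x. c * x) p"

definition lin :: "('a \<Rightarrow> ('b \<Rightarrow>\<^sub>0 'k::field)) \<Rightarrow> ('a \<Rightarrow>\<^sub>0 'k) \<Rightarrow> ('b \<Rightarrow>\<^sub>0 'k)" where
  "lin f p = (\<Sum>a\<in>Poly_Mapping.keys p. smult (Poly_Mapping.lookup p a) (f a))"

definition bil :: "('a \<Rightarrow> 'b \<Rightarrow> ('c \<Rightarrow>\<^sub>0 'k::field)) \<Rightarrow> ('a \<Rightarrow>\<^sub>0 'k) \<Rightarrow> ('b \<Rightarrow>\<^sub>0 'k) \<Rightarrow> ('c \<Rightarrow>\<^sub>0 'k)" where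
  "bil f p q = lin (\<lambda>a. lin (\<lambda>b. f a b) q) p"

abbreviation bs :: "'b \<Rightarrow> ('b \<Rightarrow>\<^sub>0 'k::field)" where
  "bs b \<equiv> Poly_Mapping.single b 1"

inductive_set lspan :: "('b \<Rightarrow>\<^sub>0 'k::field) set \<Rightarrow> ('b \<Rightarrow>\<^sub>0 'k) set" for S where
  lspan_zero: "0 \<in> lspan S"
| lspan_step: "s \<in> S \<Longrightarrow> x \<in> lspan S \<Longrightarrow> smult c s + x \<in> lspan S"

definition wmul :: "word \<Rightarrow> word \<Rightarrow> (word \<Rightarrow>\<^sub>0 'k::field)" where
  "wmul v w = (if wsrc v = wtgt w then bs (wcat v w) else 0)"

definition fmul :: "(word \<Rightarrow>\<^sub>0 'k::field) \<Rightarrow> (word \<Rightarrow>\<^sub>0 'k) \<Rightarrow> (word \<Rightarrow>\<^sub>0 'k)" where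
  "fmul = bil wmul"

definition ideal_of :: "gen set \<Rightarrow> (word \<Rightarrow>\<^sub>0 'k::field) set \<Rightarrow> (word \<Rightarrow>\<^sub>0 'k) set" where
  "ideal_of G R = lspan {fmul (fmul (bs u) r) (bs v) | u r v. wvalid G u \<and> r \<in> R \<and> wvalid G v}"

text \<open>Elements of the tensor product over K (before quotienting): combinations of pairs
  (a, b) of valid words with wsrc a = wtgt b.\<close>
definition tvalid :: "gen set \<Rightarrow> gen set \<Rightarrow> word \<times> word \<Rightarrow> bool" where
  "tvalid GA GB p = (wvalid GA (fst p) \<and> wvalid GB (snd p) \<and> wsrc (fst p) = wtgt (snd p))"

definition tspace :: "gen set \<Rightarrow> gen set \<Rightarrow> (word \<times> word \<Rightarrow>\<^sub>0 'k::field) set" where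
  "tspace GA GB = {x. \<forall>p\<in>Poly_Mapping.keys x. tvalid GA GB p}"

definition tens_lw :: "(word \<Rightarrow>\<^sub>0 'k::field) \<Rightarrow> word \<Rightarrow> (word \<times> word \<Rightarrow>\<^sub>0 'k)" where
  "tens_lw x b = lin (\<lambda>a. if wsrc a = wtgt b then bs (a, b) else 0) x"

definition tens_wl :: "word \<Rightarrow> (word \<Rightarrow>\<^sub>0 'k::field) \<Rightarrow> (word \<times> word \<Rightarrow>\<^sub>0 'k)" where
  "tens_wl a y = lin (\<lambda>b. if wsrc a = wtgt b then bs (a, b) else 0) y"

text \<open>Kernel of the projection onto (T(GA)/I_A) \<otimes>_K (T(GB)/I_B): I_A \<otimes> B + A \<otimes> I_B.\<close>
definition tensK :: "gen set \<Rightarrow> (word \<Rightarrow>\<^sub>0 'k::field) set \<Rightarrow> gen set \<Rightarrow> (word \<Rightarrow>\<^sub>0 'k) set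
    \<Rightarrow> (word \<times> word \<Rightarrow>\<^sub>0 'k) set" where
  "tensK GA RA GB RB = lspan ({tens_lw x b | x b. x \<in> ideal_of GA RA \<and> wvalid GB b}
                            \<union> {tens_wl a y | a y. wvalid GA a \<and> y \<in> ideal_of GB RB})"

text \<open>A K-bimodule map omega : B \<otimes>_K A \<rightarrow> A \<otimes>_K B, with B = T(GB)/I(RB), A = T(GA)/I(RA),
  given on basis pairs (b, a) by representatives, which is a distributive law.\<close>
definition distlaw :: "gen set \<Rightarrow> (word \<Rightarrow>\<^sub>0 'k::field) set \<Rightarrow> gen set \<Rightarrow> (word \<Rightarrow>\<^sub>0 'k) set
   \<Rightarrow> (word \<times> word \<Rightarrow> (word \<times> word \<Rightarrow>\<^sub>0 'k)) \<Rightarrow> bool" where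
  "distlaw GB RB GA RA \<omega> \<longleftrightarrow>
    \<comment> \<open>K-bimodule map (degree preserving)\<close>
    (\<forall>b a. tvalid GB GA (b, a) \<longrightarrow> \<omega> (b, a) \<in> tspace GA GB \<and>
        (\<forall>p\<in>Poly_Mapping.keys (\<omega> (b, a)). wtgt (fst p) = wtgt b \<and> wsrc (snd p) = wsrc a)) \<and>
    \<comment> \<open>well defined on the quotient\<close>
    (\<forall>x\<in>tensK GB RB GA RA. lin \<omega> x \<in> tensK GA RA GB RB) \<and>
    \<comment> \<open>omega (mu_B \<otimes> A) = (A \<otimes> mu_B)(omega \<otimes> B)(B \<otimes> omega)\<close>
    (\<forall>b1 b2 a. wvalid GB b1 \<and> wvalid GB b2 \<and> wvalid GA a \<and> wsrc b1 = wtgt b2 \<and> wsrc b2 = wtgt a \<longrightarrow>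
       \<omega> (wcat b1 b2, a)
       - lin (\<lambda>(a', b2'). lin (\<lambda>(a'', b1'). bs (a'', wcat b1' b2')) (\<omega> (b1, a'))) (\<omega> (b2, a))
       \<in> tensK GA RA GB RB) \<and>
    \<comment> \<open>omega (B \<otimes> mu_A) = (mu_A \<otimes> B)(A \<otimes> omega)(omega \<otimes> A)\<close>
    (\<forall>b a1 a2. wvalid GB b \<and> wvalid GA a1 \<and> wvalid GA a2 \<and> wsrc b = wtgt a1 \<and> wsrc a1 = wtgt a2 \<longrightarrow>
       \<omega> (b, wcat a1 a2)
       - lin (\<lambda>(a1', b'). lin (\<lambda>(a2', b''). bs (wcat a1' a2', b'')) (\<omega> (b', a2))) (\<omega> (b, a1))
       \<in> tensK GA RA GB RB) \<and>
    \<comment> \<open>unit conditions\<close>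
    (\<forall>b. wvalid GB b \<longrightarrow> \<omega> (b, unitw (wsrc b)) - bs (unitw (wtgt b), b) \<in> tensK GA RA GB RB) \<and>
    (\<forall>a. wvalid GA a \<longrightarrow> \<omega> (unitw (wtgt a), a) - bs (a, unitw (wsrc a)) \<in> tensK GA RA GB RB)"

definition tw_basis :: "(word \<times> word \<Rightarrow> (word \<times> word \<Rightarrow>\<^sub>0 'k::field))
    \<Rightarrow> word \<times> word \<Rightarrow> word \<times> word \<Rightarrow> (word \<times> word \<Rightarrow>\<^sub>0 'k)" where
  "tw_basis \<omega> p q = (if wsrc (snd p) = wtgt (fst q) then
      lin (\<lambda>(a', b'). bs (wcat (fst p) a', wcat b' (snd q))) (\<omega> (snd p, fst q)) else 0)"

definition tw :: "(word \<times> word \<Rightarrow> (word \<times> word \<Rightarrow>\<^sub>0 'k::field))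
    \<Rightarrow> (word \<times> word \<Rightarrow>\<^sub>0 'k) \<Rightarrow> (word \<times> word \<Rightarrow>\<^sub>0 'k) \<Rightarrow> (word \<times> word \<Rightarrow>\<^sub>0 'k)" where
  "tw \<omega> = bil (tw_basis \<omega>)"

definition dd :: "nat \<Rightarrow> nat \<Rightarrow> nat \<Rightarrow> (word \<Rightarrow>\<^sub>0 'k::field)" where
  "dd n i j = bs (n, [Dg (Suc n) i, Dg n j])"

definition mag_rels :: "(word \<Rightarrow>\<^sub>0 'k::field) set" where
  "mag_rels = {dd n i j - dd n (Suc j) i | n i j. i < j \<and> j \<le> n}"

definition simp_rels :: "(word \<Rightarrow>\<^sub>0 'k::field) set" where
  "simp_rels = {dd n i j - dd n (Suc j) i | n i j. i \<le> j \<and> j \<le> n}"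

definition xw :: "nat \<Rightarrow> nat list \<Rightarrow> word" where
  "xw n is = (n, map (Xg n) is)"

definition braid_rels :: "(word \<Rightarrow>\<^sub>0 'k::field) set" where
  "braid_rels =
     {bs (xw n [i, j]) - bs (xw n [j, i]) | n i j. 2 \<le> n \<and> i < n \<and> j < n \<and> (i + 2 \<le> j \<or> j + 2 \<le> i)}
   \<union> {bs (xw n [i, Suc i, i]) - bs (xw n [Suc i, i, Suc i]) | n i. 2 \<le> n \<and> i + 2 \<le> n}"

definition sym_rels :: "(word \<Rightarrow>\<^sub>0 'k::field) set" where
  "sym_rels = braid_rels \<union> {bs (xw n [i, i]) - bs (unitw n) | n i. i < n}"

definition dw :: "nat \<Rightarrow> nat \<Rightarrow> word" where
  "dw n j = (n, [Dg n j])"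

definition zeta_gen :: "nat \<Rightarrow> nat \<Rightarrow> nat \<Rightarrow> (word \<times> word \<Rightarrow>\<^sub>0 'k::field)" where
  "zeta_gen n i j =
     (if i < j then bs (xw (Suc n) [Suc j], dw n i)
      else if i = j then bs (xw (Suc n) [Suc i, i], dw n (Suc i))
      else if i = Suc j then bs (xw (Suc n) [i - 1, i], dw n (i - 1))
      else bs (xw (Suc n) [j], dw n i))"

text \<open>omega : Simp \<otimes> Sym \<rightarrow> Sym \<otimes> Simp on generators (with partial^n_{-1} = 0).\<close>
definition omega_gen :: "nat \<Rightarrow> nat \<Rightarrow> nat \<Rightarrow> (word \<times> word \<Rightarrow>\<^sub>0 'k::field)" where
  "omega_gen n i j =
     (if i < j then bs (xw (Suc n) [Suc j], dw n i)
      else if i = j then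
        bs (xw (Suc n) [Suc i, i], dw n (Suc i))
        - bs (xw (Suc n) [Suc i, i, Suc i], dw n i)
        + (if i = 0 then 0 else bs (xw (Suc n) [i, Suc i], dw n (i - 1)))
      else bs (xw (Suc n) [j], dw n i))"

definition has_gen_values :: "(nat \<Rightarrow> nat \<Rightarrow> nat \<Rightarrow> (word \<times> word \<Rightarrow>\<^sub>0 'k::field))
    \<Rightarrow> (word \<times> word \<Rightarrow>\<^sub>0 'k) set \<Rightarrow> (word \<times> word \<Rightarrow> (word \<times> word \<Rightarrow>\<^sub>0 'k)) \<Rightarrow> bool" where
  "has_gen_values g K \<omega> \<longleftrightarrow>
     (\<forall>n i j. 1 \<le> n \<and> i \<le> n \<and> j < n \<longrightarrow> \<omega> (dw n i, xw n [j]) - g n i j \<in> K)"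

text \<open>The distributive law zeta of the context (its existence is a prior result; here it is
  chosen as some distributive law with the prescribed values on generators).\<close>
definition zeta :: "word \<times> word \<Rightarrow> (word \<times> word \<Rightarrow>\<^sub>0 'k::field)" where
  "zeta = (SOME \<zeta>. distlaw Dgens mag_rels Xgens sym_rels \<zeta> \<and>
                    has_gen_values zeta_gen (tensK Xgens sym_rels Dgens mag_rels) \<zeta>)"

section \<open>The left Leibniz K-algebra Leib = (Sym \<otimes>_zeta Mag) / I_Leib\<close>

definition leib_rels :: "(word \<times> word \<Rightarrow>\<^sub>0 'k::field) set" where
  "leib_rels = {bs (unitw (n + 2), (n, [Dg (Suc n) (Suc j), Dg n j]))
                - bs (unitw (n + 2), (n, [Dg (Suc n) j, Dg n j]))
                + bs (xw (n + 2) [Suc j], (n, [Dg (Suc n) j, Dg n j])) | n j. j \<le> n}"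

text \<open>Kernel of the projection from (combinations of basis pairs of) Sym \<otimes> Mag onto Leib.\<close>
definition leibK :: "(word \<times> word \<Rightarrow>\<^sub>0 'k::field) set" where
  "leibK = lspan (tensK Xgens sym_rels Dgens mag_rels
           \<union> {tw zeta (tw zeta (bs u) r) (bs v) | u r v.
                 tvalid Xgens Dgens u \<and> r \<in> leib_rels \<and> tvalid Xgens Dgens v})"

definition rho :: "nat \<Rightarrow> nat \<Rightarrow> (word \<times> word \<Rightarrow>\<^sub>0 'k::field)" where
  "rho n j = bs (unitw (Suc n), dw n j)
     + (\<Sum>a\<in>{1..j}. bs (xw (Suc n) (rev [a..<Suc j]), dw n (a - 1)))"

definition leib_iso :: "(word \<times> word \<Rightarrow> (word \<times> word \<Rightarrow>\<^sub>0 'k::field))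
    \<Rightarrow> (word \<times> word \<Rightarrow> (word \<times> word \<Rightarrow>\<^sub>0 'k)) \<Rightarrow> bool" where
  "leib_iso \<omega> \<phi> \<longleftrightarrow>
    \<comment> \<open>K-bimodule map on basis pairs\<close>
    (\<forall>p. tvalid Xgens Dgens p \<longrightarrow> \<phi> p \<in> tspace Xgens Dgens \<and>
        (\<forall>q\<in>Poly_Mapping.keys (\<phi> p). wtgt (fst q) = wtgt (fst p) \<and> wsrc (snd q) = wsrc (snd p))) \<and>
    \<comment> \<open>well defined on Sym \<otimes> Simp\<close>
    (\<forall>x\<in>tensK Xgens sym_rels Dgens simp_rels. lin \<phi> x \<in> leibK) \<and>
    \<comment> \<open>multiplicative and unital\<close>
    (\<forall>p q. tvalid Xgens Dgens p \<and> tvalid Xgens Dgens q \<longrightarrow>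
        lin \<phi> (tw \<omega> (bs p) (bs q)) - tw zeta (\<phi> p) (\<phi> q) \<in> leibK) \<and>
    (\<forall>n. \<phi> (unitw n, unitw n) - bs (unitw n, unitw n) \<in> leibK) \<and>
    \<comment> \<open>injective\<close>
    (\<forall>x\<in>tspace Xgens Dgens. lin \<phi> x \<in> leibK \<longrightarrow> x \<in> tensK Xgens sym_rels Dgens simp_rels) \<and>
    \<comment> \<open>surjective\<close>
    (\<forall>y\<in>tspace Xgens Dgens. \<exists>x\<in>tspace Xgens Dgens. lin \<phi> x - y \<in> leibK) \<and>
    \<comment> \<open>values on generators: chi^n_j \<mapsto> chi^n_j, partial^n_j \<mapsto> rho^n_j\<close>
    (\<forall>n j. j < n \<longrightarrow> \<phi> (xw n [j], unitw n) - bs (xw n [j], unitw n) \<in> leibK) \<and>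
    (\<forall>n j. j \<le> n \<longrightarrow> \<phi> (unitw (Suc n), dw n j) - rho n j \<in> leibK)"

end

theory Submission
  imports Defs "HOL-Library.Function_Algebras" HOL.Vector_Spaces
begin

text \<open>The rule for \<open>\<partial>\<^sub>i \<chi>\<^sub>j\<close> lets every \<open>\<partial>\<^sub>i\<close> act on pairs of words by moving it to the right past the
  transpositions. This action descends to \<open>Sym \<otimes> Simp\<close> because the rule is compatible with the
  relations of \<open>Sym\<close>, and it satisfies the relations of \<open>Simp\<close> because these are compatible with
  the rule; \<open>\<omega>(b \<otimes> a)\<close> is then the action of \<open>b\<close> on \<open>a \<otimes> 1\<close>, and the axioms of a distributive law
  express that the action is associative. The law \<open>\<zeta>\<close> arises in the same way. In \<open>Leib\<close> the elements
  \<open>\<rho>\<^sub>j = \<partial>\<^sub>j + \<chi>\<^sub>j \<rho>\<^bsub>j-1\<^esub>\<close> satisfy the relations of the twisted product, while in the twisted product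
  the elements \<open>\<partial>\<^sub>j - \<chi>\<^sub>j \<partial>\<^bsub>j-1\<^esub>\<close> satisfy those of \<open>Leib\<close>; the two substitutions are mutually
  inverse, so no normal forms or dimension counts are needed.\<close>

text \<open>The three-term diagonal rule is forced by the change of generators. Moving
  \<open>\<chi>\<^sub>i\<close> to the left through
  \<open>\<partial>\<^sub>i + \<chi>\<^sub>i \<rho>\<close> (with \<open>\<rho>\<close> of index
  i-1) by the rule of \<open>zeta\<close> gives one term with the face of index i+1 and one with
  \<open>\<rho>\<close> of index i-1. Replacing that face by the difference of \<open>\<rho>\<close>
  of index i+1 and a transposition times \<open>\<rho>\<^sub>i\<close> yields exactly three terms,
  the sign coming from the difference. In the same way the Leibniz relation is a disguise of the
  diagonal relation of Simp, the one that Mag omits. Two obstacles shape the proof. The algebras are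
  given only by congruences between combinations of pairs of words, whereas the identities between
  generators are best checked as equations; so they are proved for arbitrary operators on an abelian
  group and then applied to normal forms modulo the kernels. And \<open>zeta\<close> is known only
  through its defining properties; as these determine it modulo the kernel, every product formed
  with it can be traded for an action by explicit operators.\<close>

subsection \<open>Exchange rules\<close>

text \<open>A triple \<open>(s, [k\<^sub>1, \<dots>, k\<^sub>r], l)\<close> in \<open>t i j\<close> stands for the summand \<open>\<plusminus> \<chi>\<^bsub>k\<^sub>1\<^esub> \<cdots> \<chi>\<^bsub>k\<^sub>r\<^esub> \<partial>\<^sub>l\<close> of \<open>\<partial>\<^sub>i \<chi>\<^sub>j\<close>,
  and \<open>tstep t X j v i\<close> is its value when the family \<open>v\<close> collects the vectors \<open>\<partial>\<^sub>l m\<close>.\<close>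

type_synonym exch = "nat \<Rightarrow> nat \<Rightarrow> (bool \<times> nat list \<times> nat) list"

definition tstep :: "exch \<Rightarrow> (nat \<Rightarrow> 'v \<Rightarrow> 'v) \<Rightarrow> nat \<Rightarrow> (nat \<Rightarrow> 'v) \<Rightarrow> nat \<Rightarrow> 'v::ab_group_add" where
  "tstep t X j v i = (\<Sum>(s, is, l)\<leftarrow>t i j. if s then foldr X is (v l) else - foldr X is (v l))"

definition zeta_terms :: exch where
  "zeta_terms i j =
     (if i < j then [(True, [Suc j], i)]
      else if i = j then [(True, [Suc i, i], Suc i)]
      else if i = Suc j then [(True, [j, Suc j], j)]
      else [(True, [j], i)])"

definition omega_terms :: exch where
  "omega_terms i j =
     (if i < j then [(True, [Suc j], i)]
      else if i = j then
        [(True, [Suc i, i], Suc i), (False, [Suc i, i, Suc i], i)]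
        @ (if i = 0 then [] else [(True, [i, Suc i], i - 1)])
      else [(True, [j], i)])"

text \<open>\<open>E\<close> stands where the identity would be expected: in the application the
  operators act on the sum of all degrees, where a local unit is only a projection. The commutation
  and braid relations are oriented as rewrite rules that move the smaller index outwards.\<close>

locale sym_action =
  fixes N :: nat and E :: "'v \<Rightarrow> 'v::ab_group_add" and X :: "nat \<Rightarrow> 'v \<Rightarrow> 'v"
  assumes X_add: "X i (u + v) = X i u + X i v"
    and X_E: "X i (E v) = X i v"
    and E_X: "E (X i v) = X i v"
    and X_X: "i < N \<Longrightarrow> X i (X i v) = E v"
    and X_comm: "i + 2 \<le> j \<Longrightarrow> j < N \<Longrightarrow> X j (X i v) = X i (X j v)"
    and X_braid: "Suc i < N \<Longrightarrow> X (Suc i) (X i (X (Suc i) v)) = X i (X (Suc i) (X i v))"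
begin

lemma X_zero: "X i 0 = 0"
  using X_add[of i 0 0] by simp

lemma X_minus: "X i (- v) = - X i v"
  using X_add[of i v "- v"] X_zero by (simp add: eq_neg_iff_add_eq_0 add.commute)

lemma X_diff: "X i (u - v) = X i u - X i v"
  using X_add[of i u "- v"] X_minus by simp

text \<open>Completes the Coxeter relations of three consecutive transpositions to a confluent
  rewriting system, so that the consistency checks below can be left to the simplifier.\<close>

lemma X_braid3:
  assumes "Suc (Suc i) < N"
  shows "X (Suc (Suc i)) (X (Suc i) (X i (X (Suc (Suc i)) v)))
       = X (Suc i) (X (Suc (Suc i)) (X (Suc i) (X i v)))"
  using assms X_comm[of i "Suc (Suc i)"] X_braid[of "Suc i"] by (metis Suc_1 add_2_eq_Suc' order.refl)

lemmas X_simps = X_add X_E E_X X_X X_comm X_braid X_zero X_minus X_diff X_braid3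

lemma omega_sq:
  assumes "\<And>i. E (v i) = v i" "j < n" "i \<le> n" "N = Suc n"
  shows "tstep omega_terms X j (tstep omega_terms X j v) i = v i"
proof -
  \<comment> \<open>The diagonal case is split at zero because the third summand of the rule is
    absent there; otherwise successors make neighbouring indices visible to the rewrite
    rules.\<close>
  consider "i < j" | "i = j" "j = 0" | j' where "i = j" "j = Suc j'" | "i > j"
    by (metis nat_neq_iff not0_implies_Suc)
  then show ?thesis
    using assms by cases (simp_all add: tstep_def omega_terms_def X_simps)
qed

lemma omega_comm:
  assumes "\<And>i. E (v i) = v i" "k < n" "i \<le> n" "N = Suc n" "j + 2 \<le> k"
  shows "tstep omega_terms X j (tstep omega_terms X k v) i
       = tstep omega_terms X k (tstep omega_terms X j v) i"
proof -
  \<comment> \<open>For \<open>i = k\<close> the rule also produces the face of index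
    \<open>k'\<close>; it still lies above \<open>j\<close>, so \<open>\<chi>\<^sub>j\<close> passes
    all three faces unchanged.\<close>
  obtain k' where k': "k = Suc k'" "k' > j"
    using assms(5) by (cases k) auto
  consider "i < j" | "i = j" "j = 0" | j' where "i = j" "j = Suc j'"
    | "i = Suc j" | "i > Suc j" "i < k" | "i = k" | "i > k"
    by (metis not_less_eq not0_implies_Suc nat_neq_iff)
  then show ?thesis
    using assms k' by cases (simp_all add: tstep_def omega_terms_def X_simps)
qed

lemma omega_braid:
  assumes "\<And>i. E (v i) = v i" "Suc j < n" "i \<le> n" "N = Suc n"
  shows "tstep omega_terms X (Suc j) (tstep omega_terms X j (tstep omega_terms X (Suc j) v)) i
       = tstep omega_terms X j (tstep omega_terms X (Suc j) (tstep omega_terms X j v)) i"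
proof -
  consider "i < j" | "i = j" "j = 0" | j' where "i = j" "j = Suc j'"
    | "i = Suc j" "j = 0" | j' where "i = Suc j" "j = Suc j'"  | "i > Suc j"
    by (metis not_less_eq not0_implies_Suc nat_neq_iff)
  then show ?thesis
    using assms by cases (simp_all add: tstep_def omega_terms_def X_simps)
qed

lemma zeta_sq:
  assumes "\<And>i. E (v i) = v i" "j < n" "i \<le> n" "N = Suc n"
  shows "tstep zeta_terms X j (tstep zeta_terms X j v) i = v i"
proof -
  consider "i < j" | "i = j" | "i = Suc j" | "i > Suc j" by linarith
  then show ?thesis
    using assms by cases (simp_all add: tstep_def zeta_terms_def X_simps)
qed

lemma zeta_comm:
  assumes "\<And>i. E (v i) = v i" "k < n" "i \<le> n" "N = Suc n" "j + 2 \<le> k"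
  shows "tstep zeta_terms X j (tstep zeta_terms X k v) i
       = tstep zeta_terms X k (tstep zeta_terms X j v) i"
proof -
  consider "i < j" | "i = j" | "i = Suc j" | "i > Suc j" "i < k" | "i = k" | "i = Suc k" | "i > Suc k"
    by linarith
  then show ?thesis
    using assms by cases (simp_all add: tstep_def zeta_terms_def X_simps)
qed

lemma zeta_braid:
  assumes "\<And>i. E (v i) = v i" "Suc j < n" "i \<le> n" "N = Suc n"
  shows "tstep zeta_terms X (Suc j) (tstep zeta_terms X j (tstep zeta_terms X (Suc j) v)) i
       = tstep zeta_terms X j (tstep zeta_terms X (Suc j) (tstep zeta_terms X j v)) i"
proof -
  consider "i < j" | "i = j" | "i = Suc j" | "i = Suc (Suc j)" | "i > Suc (Suc j)" by linarith
  then show ?thesis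
    using assms by cases (simp_all add: tstep_def zeta_terms_def X_simps)
qed

text \<open>The family \<open>w i j\<close> stands for \<open>\<partial>\<^sub>i \<partial>\<^sub>j m\<close>. The inner \<open>tstep\<close> acts on families, as \<open>\<partial>\<^sub>i\<close> has to
  pass the transpositions left behind by \<open>\<partial>\<^sub>j\<close>.\<close>

lemma omega_simp:
  assumes "\<And>i j. E (w i j) = w i j" "\<And>i j. i \<le> j \<Longrightarrow> j \<le> n \<Longrightarrow> w (Suc j) i = w i j"
    and "k < n" "N = Suc (Suc n)" "i \<le> j" "j \<le> n"
  shows "tstep omega_terms (tstep omega_terms X) k (\<lambda>j i. w i j) j i
       = tstep omega_terms (tstep omega_terms X) k (\<lambda>j i. w i j) i (Suc j)"
proof -
  consider "j < k" | "j = k" "i = k" | "j = k" "Suc i = k" | "j = k" "Suc i < k"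
    | "j > k" "i = k" | "j > k" "i > k" | "j > k" "i < k"
    using assms(5) by linarith
  note cases = this
  show ?thesis
  proof (cases k)
    case 0
    show ?thesis
      using cases assms 0 by cases (simp_all add: tstep_def omega_terms_def X_simps)
  next
    case (Suc k')
    show ?thesis
      using cases assms Suc by cases (simp_all add: tstep_def omega_terms_def X_simps)
  qed
qed

lemma zeta_mag:
  assumes "\<And>i j. E (w i j) = w i j" "\<And>i j. i < j \<Longrightarrow> j \<le> n \<Longrightarrow> w (Suc j) i = w i j"
    and "k < n" "N = Suc (Suc n)" "i < j" "j \<le> n"
  shows "tstep zeta_terms (tstep zeta_terms X) k (\<lambda>j i. w i j) j i
       = tstep zeta_terms (tstep zeta_terms X) k (\<lambda>j i. w i j) i (Suc j)"
proof -
  consider "j < k" | "j = k" | "j = Suc k" "i = k" | "j = Suc k" "i < k"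
    | "j > Suc k" "i = k"  | "j > Suc k" "i = Suc k" | "j > Suc k" "i < k" | "j > Suc k" "i > Suc k"
    using assms(5) by linarith
  then show ?thesis
    using assms by cases (simp_all add: tstep_def zeta_terms_def X_simps)
qed

end

section \<open>Modules with transpositions and faces, and the change of face generators\<close>

locale face_action =
  fixes t :: exch
    and E :: "nat \<Rightarrow> 'v \<Rightarrow> 'v::ab_group_add" and X D :: "nat \<Rightarrow> nat \<Rightarrow> 'v \<Rightarrow> 'v"
  assumes sym: "sym_action n (E n) (X n)"
    and E_D: "E (Suc n) (D n i v) = D n i v"
    and D_E: "D n i (E n v) = D n i v"
    and D_add: "D n i (u + v) = D n i u + D n i v"
    and D_X: "j < n \<Longrightarrow> i \<le> n \<Longrightarrow> D n i (X n j v) = tstep t (X (Suc n)) j (\<lambda>i. D n i v) i"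
begin

lemma D_zero: "D n i 0 = 0"
  using D_add[of n i 0 0] by simp

lemma D_minus: "D n i (- v) = - D n i v"
  using D_add[of n i v "- v"] D_zero by (simp add: eq_neg_iff_add_eq_0 add.commute)

lemma D_diff: "D n i (u - v) = D n i u - D n i v"
  using D_add[of n i u "- v"] D_minus by simp

lemmas face_simps = D_add D_zero D_minus D_diff E_D D_E sym_action.X_add[OF sym] sym_action.X_zero[OF sym]
  sym_action.X_minus[OF sym] sym_action.X_diff[OF sym] sym_action.X_X[OF sym] sym_action.X_comm[OF sym]
  sym_action.X_braid[OF sym] sym_action.X_braid3[OF sym] sym_action.E_X[OF sym] sym_action.X_E[OF sym]
end

text \<open>\<open>rho_face\<close> sends \<open>\<partial>\<^sub>j\<close> to \<open>\<rho>\<^sub>j = \<partial>\<^sub>j + \<chi>\<^sub>j \<rho>\<^bsub>j-1\<^esub>\<close>; \<open>delta_face\<close> is the inverse substitution.\<close>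

primrec rho_face :: "(nat \<Rightarrow> nat \<Rightarrow> 'v \<Rightarrow> 'v::ab_group_add) \<Rightarrow> (nat \<Rightarrow> nat \<Rightarrow> 'v \<Rightarrow> 'v) \<Rightarrow> nat \<Rightarrow> nat \<Rightarrow> 'v \<Rightarrow> 'v" where
  "rho_face X D n 0 v = D n 0 v"
| "rho_face X D n (Suc j) v = D n (Suc j) v + X (Suc n) (Suc j) (rho_face X D n j v)"

definition delta_face :: "(nat \<Rightarrow> nat \<Rightarrow> 'v \<Rightarrow> 'v::ab_group_add) \<Rightarrow> (nat \<Rightarrow> nat \<Rightarrow> 'v \<Rightarrow> 'v) \<Rightarrow> nat \<Rightarrow> nat \<Rightarrow> 'v \<Rightarrow> 'v" where
  "delta_face X D n j v = D n j v - (if j = 0 then 0 else X (Suc n) j (D n (j - 1) v))"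

locale omega_action = face_action omega_terms E X D for E :: "nat \<Rightarrow> 'v \<Rightarrow> 'v::ab_group_add" and X D +
  assumes D_simp: "i \<le> j \<Longrightarrow> j \<le> n \<Longrightarrow> D (Suc n) (Suc j) (D n i v) = D (Suc n) i (D n j v)"
begin

abbreviation "F \<equiv> delta_face X D"

lemma D_lt: "i < j \<Longrightarrow> j < n \<Longrightarrow> D n i (X n j v) = X (Suc n) (Suc j) (D n i v)"
  and D_0: "0 < n \<Longrightarrow> D n 0 (X n 0 v) = X (Suc n) (Suc 0) (X (Suc n) 0 (D n (Suc 0) v))
       - X (Suc n) (Suc 0) (X (Suc n) 0 (X (Suc n) (Suc 0) (D n 0 v)))"
  and D_Suc: "Suc j < n \<Longrightarrow> D n (Suc j) (X n (Suc j) v) = X (Suc n) (Suc (Suc j)) (X (Suc n) (Suc j) (D n (Suc (Suc j)) v))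
       - X (Suc n) (Suc (Suc j)) (X (Suc n) (Suc j) (X (Suc n) (Suc (Suc j)) (D n (Suc j) v)))
       + X (Suc n) (Suc j) (X (Suc n) (Suc (Suc j)) (D n j v))"
  and D_gt: "j < i \<Longrightarrow> i \<le> n \<Longrightarrow> D n i (X n j v) = X (Suc n) j (D n i v)"
  by (simp_all add: D_X tstep_def omega_terms_def)

lemmas omega_simps = face_simps D_lt D_0 D_Suc D_gt delta_face_def D_simp

text \<open>For \<open>i = j\<close> the correction term of the difference cancels the third summand
  of the three-term rule, and the first two combine into a single shifted difference. Thus the rule
  becomes monomial.\<close>

lemma delta_X:
  assumes "j < n" "i \<le> n"
  shows "F n i (X n j v) = tstep zeta_terms (X (Suc n)) j (\<lambda>i. F n i v) i"
proof -
  consider "i < j" "i = 0" | i' where "i < j" "i = Suc i'"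
    | "i = j" "j = 0" | j' where "i = j" "j = Suc j'" | "i = Suc j" "j = 0" | j' where "i = Suc j" "j = Suc j'"
    | i' where "i > Suc j" "i = Suc i'" "i' > j"
    by (metis nat_neq_iff not0_implies_Suc not_less_eq Suc_less_eq2)
  then show ?thesis
    using assms by cases (simp_all add: tstep_def zeta_terms_def omega_simps)
qed

lemma delta_mag:
  assumes "i < j" "j \<le> n"
  shows "F (Suc n) (Suc j) (F n i v) = F (Suc n) i (F n j v)"
proof -
  obtain j' where "j = Suc j'" "i \<le> j'" using assms by (cases j) auto
  then show ?thesis
    using assms by (cases i) (simp_all add: omega_simps)
qed

text \<open>This is the diagonal relation of Simp in disguise. For \<open>j = 0\<close> it only says
  that \<open>\<partial>\<^sub>1 \<partial>\<^sub>0 - \<chi>\<^sub>1 \<partial>\<^sub>0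
  \<partial>\<^sub>0\<close> equals
  \<open>(1 - \<chi>\<^sub>1) \<partial>\<^sub>0 \<partial>\<^sub>0\<close>.\<close>

lemma delta_leib:
  assumes "j \<le> n"
  shows "F (Suc n) (Suc j) (F n j v) = F (Suc n) j (F n j v) - X (Suc (Suc n)) (Suc j) (F (Suc n) j (F n j v))"
  using assms by (cases j) (simp_all add: omega_simps)

end

locale leib_action = face_action zeta_terms E X D for E :: "nat \<Rightarrow> 'v \<Rightarrow> 'v::ab_group_add" and X D +
  assumes D_mag: "i < j \<Longrightarrow> j \<le> n \<Longrightarrow> D (Suc n) (Suc j) (D n i v) = D (Suc n) i (D n j v)"
    and D_leib: "j \<le> n \<Longrightarrow> D (Suc n) (Suc j) (D n j v)
       = D (Suc n) j (D n j v) - X (Suc (Suc n)) (Suc j) (D (Suc n) j (D n j v))"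
begin

abbreviation "R \<equiv> rho_face X D"

lemma D_lt: "i < j \<Longrightarrow> j < n \<Longrightarrow> D n i (X n j v) = X (Suc n) (Suc j) (D n i v)"
  and D_eq: "j < n \<Longrightarrow> D n j (X n j v) = X (Suc n) (Suc j) (X (Suc n) j (D n (Suc j) v))"
  and D_Suc: "j < n \<Longrightarrow> D n (Suc j) (X n j v) = X (Suc n) j (X (Suc n) (Suc j) (D n j v))"
  and D_gt: "Suc j < i \<Longrightarrow> i \<le> n \<Longrightarrow> D n i (X n j v) = X (Suc n) j (D n i v)"
  by (simp_all add: D_X tstep_def zeta_terms_def)

lemmas leib_simps = face_simps D_lt D_eq D_Suc D_gt D_mag

lemma R_lt: "i < j \<Longrightarrow> j < n \<Longrightarrow> R n i (X n j v) = X (Suc n) (Suc j) (R n i v)"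
  by (induction i) (simp_all add: leib_simps)

lemma R_0: "0 < n \<Longrightarrow> R n 0 (X n 0 v) = X (Suc n) (Suc 0) (X (Suc n) 0 (R n (Suc 0) v))
       - X (Suc n) (Suc 0) (X (Suc n) 0 (X (Suc n) (Suc 0) (R n 0 v)))"
  by (simp add: leib_simps)

text \<open>After one unfolding the face contributes a term with \<open>D n (Suc (Suc j))\<close>.
  Expressed as a difference of \<open>R\<close>-operators it gives the first two summands; the third
  is the image of the recursive part under \<open>R_lt\<close>.\<close>

lemma R_Suc: "Suc j < n \<Longrightarrow> R n (Suc j) (X n (Suc j) v) = X (Suc n) (Suc (Suc j)) (X (Suc n) (Suc j) (R n (Suc (Suc j)) v))
       - X (Suc n) (Suc (Suc j)) (X (Suc n) (Suc j) (X (Suc n) (Suc (Suc j)) (R n (Suc j) v)))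
       + X (Suc n) (Suc j) (X (Suc n) (Suc (Suc j)) (R n j v))"
  by (simp add: leib_simps R_lt)

text \<open>The outer \<open>\<chi>\<close> of the recursion cancels a factor in each of the first
  two terms of the diagonal rule. By the braid relation the surplus is a product of two
  transpositions applied to the face of index \<open>j\<close> minus \<open>R n j\<close> plus its
  recursive part, which is zero.\<close>

lemma R_Suc': "j < n \<Longrightarrow> R n (Suc j) (X n j v) = X (Suc n) j (R n (Suc j) v)"
  by (cases j) (simp_all add: leib_simps R_lt R_Suc)

lemma R_gt: "j < i \<Longrightarrow> i \<le> n \<Longrightarrow> R n i (X n j v) = X (Suc n) j (R n i v)"
proof (induction i)
  case (Suc i)
  show ?case
  proof (cases "j = i")
    case True
    then show ?thesis using R_Suc'[of j n v] Suc by simp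
  next
    case False
    then show ?thesis using Suc by (simp add: leib_simps)
  qed
qed simp

lemma rho_X:
  assumes "j < n" "i \<le> n"
  shows "R n i (X n j v) = tstep omega_terms (X (Suc n)) j (\<lambda>i. R n i v) i"
proof -
  consider "i < j" | "i = j" "j = 0" | j' where "i = j" "j = Suc j'" | "i > j"
    by (metis nat_neq_iff not0_implies_Suc)
  then show ?thesis
    using assms by cases (simp_all add: tstep_def omega_terms_def R_lt R_0 R_Suc R_gt del: rho_face.simps)
qed

lemma R_add: "R n i (u + v) = R n i u + R n i v"
  by (induction i) (simp_all add: leib_simps)

text \<open>Summand by summand this is the magmatic relation: the transpositions in
  \<open>R n i\<close> have index at most \<open>i < j\<close> and slip past the face
  \<open>Suc j\<close> unchanged.\<close>

lemma R_D: "i < j \<Longrightarrow> j \<le> n \<Longrightarrow> R (Suc n) i (D n j v) = D (Suc n) (Suc j) (R n i v)"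
  by (induction i) (simp_all add: leib_simps)

text \<open>The diagonal relation of Simp with the outer \<open>R\<close> unfolded once. In this
  form the Leibniz relation is the start of the induction and also what is needed in its
  step.\<close>

lemma D_R: "j \<le> n \<Longrightarrow> D (Suc n) (Suc j) (R n j v) = R (Suc n) j (R n j v) - X (Suc (Suc n)) (Suc j) (R (Suc n) j (R n j v))"
proof (induction j arbitrary: v)
  case (Suc j)
  then show ?case
    by (simp add: leib_simps D_leib R_add R_gt R_lt R_D R_Suc')
qed (simp add: D_leib)

lemma rho_simp_diag: "j \<le> n \<Longrightarrow> R (Suc n) (Suc j) (R n j v) = R (Suc n) j (R n j v)"
  by (simp add: D_R)

text \<open>Away from the diagonal, \<open>R_D\<close> moves the face of the outer \<open>R\<close>
  inside and \<open>R_lt\<close> moves its transposition inside, so that the inner \<open>R\<close>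
  is assembled again one index higher.\<close>

lemma rho_simp: "i \<le> j \<Longrightarrow> j \<le> n \<Longrightarrow> R (Suc n) (Suc j) (R n i v) = R (Suc n) i (R n j v)"
proof (induction j)
  case (Suc j)
  show ?case
  proof (cases "i = Suc j")
    case False
    then show ?thesis using Suc
      by (simp add: R_add R_D R_lt)
  qed (use Suc rho_simp_diag[of "Suc j" n v] in simp)
qed (use rho_simp_diag[of 0 n v] in simp)

end

subsection \<open>Linear maps\<close>

lemma lookup_smult [simp]: "Poly_Mapping.lookup (smult c p) x = c * Poly_Mapping.lookup p x"
  by (simp add: smult_def Poly_Mapping.map.rep_eq when_def)

interpretation pm: vector_space "smult :: 'k::field \<Rightarrow> ('b \<Rightarrow>\<^sub>0 'k) \<Rightarrow> ('b \<Rightarrow>\<^sub>0 'k)"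
  by standard (auto intro!: poly_mapping_eqI simp: lookup_add algebra_simps)

lemma lspan_eq_span: "lspan S = pm.span S"
proof (intro set_eqI iffI)
  fix x assume "x \<in> lspan S"
  then show "x \<in> pm.span S"
    by induction (simp_all add: pm.span_zero pm.span_add pm.span_scale pm.span_base)
next
  fix x assume "x \<in> pm.span S"
  then show "x \<in> lspan S"
    by (induction rule: pm.span_induct_alt) (auto intro: lspan.intros)
qed

definition klin :: "(('a \<Rightarrow>\<^sub>0 'k::field) \<Rightarrow> ('b \<Rightarrow>\<^sub>0 'k)) \<Rightarrow> bool" where
  "klin f \<longleftrightarrow> (\<forall>x y. f (x + y) = f x + f y) \<and> (\<forall>c x. f (smult c x) = smult c (f x))"

lemma klin_add: "klin f \<Longrightarrow> f (x + y) = f x + f y"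
  and klin_smult: "klin f \<Longrightarrow> f (smult c x) = smult c (f x)"
  by (simp_all add: klin_def)

lemma klin_zero: "klin f \<Longrightarrow> f 0 = 0"
  using klin_add[of f 0 0] by simp

lemma klin_minus: "klin f \<Longrightarrow> f (- x) = - f x"
  using klin_add[of f x "- x"] klin_zero[of f] by (simp add: eq_neg_iff_add_eq_0 add.commute)

lemma klin_diff: "klin f \<Longrightarrow> f (x - y) = f x - f y"
  using klin_add[of f x "- y"] klin_minus[of f y] by simp

lemma klin_sum: "klin f \<Longrightarrow> f (sum g A) = (\<Sum>a\<in>A. f (g a))"
  by (induction A rule: infinite_finite_induct) (simp_all add: klin_zero klin_add)

lemma klin_compose: "klin f \<Longrightarrow> klin g \<Longrightarrow> klin (\<lambda>x. f (g x))"
  by (simp add: klin_def)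

lemma klin_id: "klin (\<lambda>x. x)"
  by (simp add: klin_def)

lemma klin_plus: "klin f \<Longrightarrow> klin g \<Longrightarrow> klin (\<lambda>x. f x + g x)"
  by (simp add: klin_def pm.scale_right_distrib)

lemma klin_neg: "klin f \<Longrightarrow> klin (\<lambda>x. - f x)"
  by (simp add: klin_def)

lemma klin_minus_fun: "klin f \<Longrightarrow> klin g \<Longrightarrow> klin (\<lambda>x. f x - g x)"
  by (simp add: klin_def pm.scale_right_diff_distrib)

lemma klin_const_zero: "klin (\<lambda>x. 0)"
  by (simp add: klin_def)

lemma lin_superset:
  assumes "finite A" "Poly_Mapping.keys p \<subseteq> A"
  shows "lin f p = (\<Sum>a\<in>A. smult (Poly_Mapping.lookup p a) (f a))"
  unfolding lin_def
  by (rule sum.mono_neutral_left) (use assms in \<open>auto simp: in_keys_iff\<close>)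

lemma klin_lin: "klin (lin f)"
  unfolding klin_def
proof (intro conjI allI)
  fix x y :: "'a \<Rightarrow>\<^sub>0 'b"
  let ?A = "Poly_Mapping.keys x \<union> Poly_Mapping.keys y"
  have "lin f (x + y) = (\<Sum>a\<in>?A. smult (Poly_Mapping.lookup (x + y) a) (f a))"
    by (rule lin_superset) (simp_all add: Poly_Mapping.keys_add)
  also have "\<dots> = lin f x + lin f y"
    by (simp add: lin_superset[of ?A x] lin_superset[of ?A y] lookup_add
        pm.scale_left_distrib sum.distrib)
  finally show "lin f (x + y) = lin f x + lin f y" .
next
  fix c and x :: "'a \<Rightarrow>\<^sub>0 'b"
  have "lin f (smult c x) = (\<Sum>a\<in>Poly_Mapping.keys x. smult (Poly_Mapping.lookup (smult c x) a) (f a))"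
    by (rule lin_superset) (auto simp: in_keys_iff)
  then show "lin f (smult c x) = smult c (lin f x)"
    by (simp add: lin_def pm.scale_sum_right)
qed

lemmas lin_add = klin_add[OF klin_lin]
  and lin_zero [simp] = klin_zero[OF klin_lin]
  and lin_smult = klin_smult[OF klin_lin]

lemma lin_bs [simp]: "lin f (bs b) = f b"
  by (simp add: lin_def)

lemma lin_bs_id: "lin bs x = x"
proof (rule poly_mapping_eqI)
  fix b
  have "Poly_Mapping.lookup (lin bs x) b
      = (\<Sum>a\<in>Poly_Mapping.keys x. if a = b then Poly_Mapping.lookup x a else 0)"
    unfolding lin_def lookup_sum by (rule sum.cong) (auto simp: lookup_single when_def)
  also have "\<dots> = Poly_Mapping.lookup x b"
    by (simp add: sum.delta in_keys_iff)
  finally show "Poly_Mapping.lookup (lin bs x) b = Poly_Mapping.lookup x b" .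
qed

lemma klin_eq_lin: "klin f \<Longrightarrow> f x = lin (\<lambda>b. f (bs b)) x"
proof -
  assume f: "klin f"
  have "f x = f (lin bs x)" by (simp only: lin_bs_id)
  then show ?thesis by (simp add: lin_def klin_sum[OF f] klin_smult[OF f])
qed

lemma lin_cong: "(\<And>a. a \<in> Poly_Mapping.keys x \<Longrightarrow> f a = g a) \<Longrightarrow> lin f x = lin g x"
  by (simp add: lin_def)

lemma klin_eq_on_keys:
  assumes "klin f" "klin g" "\<And>b. b \<in> Poly_Mapping.keys x \<Longrightarrow> f (bs b) = g (bs b)"
  shows "f x = g x"
  unfolding klin_eq_lin[OF assms(1), of x] klin_eq_lin[OF assms(2), of x] by (rule lin_cong) (rule assms(3))

lemma klin_eqI:
  assumes "klin f" "klin g" "\<And>b. f (bs b) = g (bs b)"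
  shows "f x = g x"
  using klin_eq_on_keys assms by blast

lemma klin_apply_lin: "klin f \<Longrightarrow> f (lin g x) = lin (\<lambda>a. f (g a)) x"
  by (simp add: lin_def klin_sum klin_smult)

lemma lin_in_subspace:
  assumes "pm.subspace K" "\<And>a. a \<in> Poly_Mapping.keys x \<Longrightarrow> f a \<in> K"
  shows "lin f x \<in> K"
  unfolding lin_def using assms by (intro pm.subspace_sum) (simp_all add: pm.subspace_scale)

lemma klin_in_subspace:
  assumes "klin f" "pm.subspace K" "\<And>a. a \<in> Poly_Mapping.keys x \<Longrightarrow> f (bs a) \<in> K"
  shows "f x \<in> K"
  unfolding klin_eq_lin[OF assms(1), of x] by (rule lin_in_subspace[OF assms(2,3)])

lemma klin_lspan:
  assumes "klin f" "pm.subspace K" "\<And>s. s \<in> S \<Longrightarrow> f s \<in> K" "x \<in> lspan S"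
  shows "f x \<in> K"
  using assms(4)
  by induction (simp_all add: assms klin_zero klin_add klin_smult pm.subspace_0 pm.subspace_add pm.subspace_scale)

lemma subspace_lspan: "pm.subspace (lspan S)"
  by (simp add: lspan_eq_span)

lemma lspan_base: "s \<in> S \<Longrightarrow> s \<in> lspan S"
  by (simp add: lspan_eq_span pm.span_base)

lemma klin_bil1: "klin (\<lambda>x. bil f x y)"
  unfolding bil_def by (rule klin_lin)

lemma klin_bil2: "klin (\<lambda>y. bil f x y)"
  unfolding bil_def klin_def
  by (simp add: lin_add lin_smult)
    (simp add: lin_def pm.scale_right_distrib sum.distrib pm.scale_sum_right mult.left_commute)

lemma bil_bs [simp]: "bil f (bs a) (bs b) = f a b"
  by (simp add: bil_def)

subsection \<open>Normal forms modulo a subspace\<close>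

text \<open>An idempotent linear map with kernel K turns congruences modulo K into equations between
  elements of the same type. This replaces the formation of quotient types.\<close>

lemma subspace_projector:
  fixes K :: "('b \<Rightarrow>\<^sub>0 'k::field) set"
  assumes K: "pm.subspace K"
  shows "\<exists>f. klin f \<and> (\<forall>x. f x = 0 \<longleftrightarrow> x \<in> K) \<and> (\<forall>x. f (f x) = f x)"
proof -
  interpret pp: vector_space_pair "smult :: 'k \<Rightarrow> ('b \<Rightarrow>\<^sub>0 'k) \<Rightarrow> _" "smult :: 'k \<Rightarrow> ('b \<Rightarrow>\<^sub>0 'k) \<Rightarrow> _" ..
  obtain B where B: "B \<subseteq> K" "pm.independent B" "pm.span B = K"
    using pm.basis_exists[of K] K by (metis pm.span_minimal subset_antisym)
  \<comment> \<open>A complement of \<open>K\<close> is spanned by the vectors added to its basis;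
    the map kills \<open>B\<close> and fixes those.\<close>
  define C where "C = pm.extend_basis B"
  have C: "B \<subseteq> C" "pm.independent C" "pm.span C = UNIV"
    using B(2) by (simp_all add: C_def pm.extend_basis_superset pm.independent_extend_basis pm.span_extend_basis)
  obtain f where f: "Vector_Spaces.linear smult smult f" "\<And>x. x \<in> C \<Longrightarrow> f x = (if x \<in> B then 0 else x)"
    using pp.linear_independent_extend[OF C(2), of "\<lambda>x. if x \<in> B then 0 else x"] by metis
  have kf: "klin f"
    using pp.linear_add[OF f(1)] pp.linear_scale[OF f(1)] by (simp add: klin_def)
  have f0: "f x = 0" if "x \<in> K" for x
    using that pp.linear_eq_0_on_span[OF f(1), of B] B(3) C(1) f(2) by (metis subsetD)
  have fid: "f x = x" if "x \<in> pm.span (C - B)" for x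
    using pp.linear_eq_on_span[OF f(1), of id "C - B" x] that f(2) pm.linear_id by fastforce
  have dec: "\<exists>k c. x = k + c \<and> k \<in> K \<and> c \<in> pm.span (C - B)" for x
  proof -
    have "x \<in> pm.span (B \<union> (C - B))" using C by (simp add: Un_absorb1)
    then show ?thesis unfolding pm.span_Un B(3) by blast
  qed
  have "f x = 0 \<longleftrightarrow> x \<in> K" "f (f x) = f x" for x
  proof -
    obtain k c where x: "x = k + c" "k \<in> K" "c \<in> pm.span (C - B)" using dec by blast
    then have fx: "f x = c" using f0 fid klin_add[OF kf] by simp
    then show "f (f x) = f x" using fid x by simp
    show "f x = 0 \<longleftrightarrow> x \<in> K" using fx x f0 by (metis add.right_neutral)
  qed
  then show ?thesis using kf by blast
qed

definition nf :: "('b \<Rightarrow>\<^sub>0 'k::field) set \<Rightarrow> ('b \<Rightarrow>\<^sub>0 'k) \<Rightarrow> ('b \<Rightarrow>\<^sub>0 'k)" where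
  "nf K = (SOME f. klin f \<and> (\<forall>x. f x = 0 \<longleftrightarrow> x \<in> K) \<and> (\<forall>x. f (f x) = f x))"

lemma
  assumes "pm.subspace K"
  shows klin_nf: "klin (nf K)" and nf_eq_0_iff: "nf K x = 0 \<longleftrightarrow> x \<in> K" and nf_nf: "nf K (nf K x) = nf K x"
  using someI_ex[OF subspace_projector[OF assms]] unfolding nf_def by blast+

lemma nf_eq_iff: "pm.subspace K \<Longrightarrow> nf K x = nf K y \<longleftrightarrow> x - y \<in> K"
  using nf_eq_0_iff[of K "x - y"] klin_diff[OF klin_nf, of K x y] by simp

text \<open>An operator that preserves \<open>K\<close> descends to the quotient; hence inner
  normalisations may be dropped under an outer one when operators are composed.\<close>

lemma nf_map:
  assumes "pm.subspace K" "klin f" "\<And>x. x \<in> K \<Longrightarrow> f x \<in> K"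
  shows "nf K (f (nf K x)) = nf K (f x)"
proof -
  have "nf K x - x \<in> K" using assms by (simp add: nf_nf flip: nf_eq_iff)
  then show ?thesis using assms by (simp add: nf_eq_iff flip: klin_diff)
qed

subsection \<open>Words\<close>

lemma wvalid_Nil [simp]: "wvalid G (m, [])"
  by (simp add: wvalid_def)

lemma wtgt_Nil [simp]: "wtgt (m, []) = m"
  by (simp add: wtgt_def)

lemma wtgt_Cons [simp]: "wtgt (m, g # gs) = gtgt g"
  by (simp add: wtgt_def)

lemma wvalid_Cons [simp]: "wvalid G (m, g # gs) \<longleftrightarrow> g \<in> G \<and> gsrc g = wtgt (m, gs) \<and> wvalid G (m, gs)"
  by (cases gs) (auto simp: wvalid_def)

lemma wsrc_pair [simp]: "wsrc (m, gs) = m"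
  by (simp add: wsrc_def)

lemma wcat_pair [simp]: "wcat (m, gs) (k, hs) = (k, gs @ hs)"
  by (simp add: wcat_def)

lemma unitw_pair: "unitw m = (m, [])"
  by (simp add: unitw_def)

lemma Xg_in_Xgens [simp]: "Xg n i \<in> Xgens \<longleftrightarrow> i < n"
  and Dg_notin_Xgens [simp]: "Dg n i \<notin> Xgens"
  and Dg_in_Dgens [simp]: "Dg n i \<in> Dgens \<longleftrightarrow> i \<le> n"
  and Xg_notin_Dgens [simp]: "Xg n i \<notin> Dgens"
  by (auto simp: Xgens_def Dgens_def)

lemma XgensE: "g \<in> Xgens \<Longrightarrow> (\<And>n i. g = Xg n i \<Longrightarrow> i < n \<Longrightarrow> thesis) \<Longrightarrow> thesis"
  by (auto simp: Xgens_def)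

lemma DgensE: "g \<in> Dgens \<Longrightarrow> (\<And>n i. g = Dg n i \<Longrightarrow> i \<le> n \<Longrightarrow> thesis) \<Longrightarrow> thesis"
  by (auto simp: Dgens_def)

lemma wtgt_Xgens: "wvalid Xgens w \<Longrightarrow> wtgt w = fst w"
proof (cases w)
  case (Pair m gs)
  assume "wvalid Xgens w"
  moreover have "wvalid Xgens (m, gs) \<Longrightarrow> wtgt (m, gs) = m"
    by (induction gs) (auto elim: XgensE)
  ultimately show ?thesis using Pair by simp
qed

lemma wvalid_wcat:
  assumes "wvalid G u" "wvalid G w" "wsrc u = wtgt w"
  shows "wvalid G (wcat u w)" "wtgt (wcat u w) = wtgt u"
proof -
  obtain m gs k hs where uw: "u = (m, gs)" "w = (k, hs)" by (cases u; cases w)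
  have "wvalid G (m, gs) \<Longrightarrow> wvalid G (k, gs @ hs) \<and> wtgt (k, gs @ hs) = wtgt (m, gs)"
    using assms by (induction gs) (auto simp: uw)
  then show "wvalid G (wcat u w)" "wtgt (wcat u w) = wtgt u" using assms by (auto simp: uw)
qed

abbreviation tv :: "word \<times> word \<Rightarrow> bool" where
  "tv \<equiv> tvalid Xgens Dgens"

lemma tv_pair: "tv ((m, gs), b) \<longleftrightarrow> wvalid Xgens (m, gs) \<and> wvalid Dgens b \<and> m = wtgt b"
  by (simp add: tvalid_def)

lemma tv_cases:
  assumes "tv p"
  obtains m gs b where "p = ((m, gs), b)" "wvalid Xgens (m, gs)" "wvalid Dgens b" "m = wtgt b"
  using assms by (cases p; cases "fst p") (auto simp: tvalid_def)

subsection \<open>Operators on the tensor product\<close>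

type_synonym 'k tens = "word \<times> word \<Rightarrow>\<^sub>0 'k"

text \<open>The operators vanish on pairs of words that are not composable or not of degree n, so that
  the relations between them hold without side conditions on their arguments.\<close>

definition Ep :: "nat \<Rightarrow> 'k::field tens \<Rightarrow> 'k tens" where
  "Ep n = lin (\<lambda>p. if tv p \<and> fst (fst p) = n then bs p else 0)"

definition Xp :: "nat \<Rightarrow> nat \<Rightarrow> 'k::field tens \<Rightarrow> 'k tens" where
  "Xp n i = lin (\<lambda>p. if tv p \<and> fst (fst p) = n \<and> i < n
     then bs ((n, Xg n i # snd (fst p)), snd p) else 0)"

fun gidx :: "gen \<Rightarrow> nat" where
  "gidx (Xg n i) = i"
| "gidx (Dg n i) = i"

text \<open>The value is the whole family over the face index, since the exchange rule for one index
  refers to its neighbours.\<close>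

primrec face_on :: "exch \<Rightarrow> nat \<Rightarrow> gen list \<Rightarrow> word \<Rightarrow> nat \<Rightarrow> 'k::field tens" where
  "face_on t n [] b = (\<lambda>i. bs ((Suc n, []), (fst b, Dg n i # snd b)))"
| "face_on t n (g # gs) b = tstep t (Xp (Suc n)) (gidx g) (face_on t n gs b)"

definition Dp :: "exch \<Rightarrow> nat \<Rightarrow> nat \<Rightarrow> 'k::field tens \<Rightarrow> 'k tens" where
  "Dp t n i = lin (\<lambda>p. if tv p \<and> fst (fst p) = n \<and> i \<le> n
     then face_on t n (snd (fst p)) (snd p) i else 0)"

lemma klin_Ep: "klin (Ep n)" and klin_Xp: "klin (Xp n i)" and klin_Dp: "klin (Dp t n i)"
  by (simp_all add: Ep_def Xp_def Dp_def klin_lin)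

lemma Ep_bs: "Ep n (bs p) = (if tv p \<and> fst (fst p) = n then bs p else 0)"
  by (simp add: Ep_def)

lemma Xp_bs: "Xp n i (bs p) = (if tv p \<and> fst (fst p) = n \<and> i < n
     then bs ((n, Xg n i # snd (fst p)), snd p) else 0)"
  by (simp add: Xp_def)

lemma Dp_bs: "Dp t n i (bs p) = (if tv p \<and> fst (fst p) = n \<and> i \<le> n
     then face_on t n (snd (fst p)) (snd p) i else 0)"
  by (simp add: Dp_def)

lemma klin_if: "klin f \<Longrightarrow> klin g \<Longrightarrow> klin (\<lambda>v. if c then f v else g v)"
  by (cases c) simp_all

lemmas klin_intros = klin_if klin_Ep klin_Xp klin_Dp klin_lin klin_id klin_plus klin_minus_fun klin_neg
  klin_const_zero klin_bil1 klin_bil2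

lemma Ep_Ep: "Ep m (Ep n v) = (if m = n then Ep n v else 0)"
  by (rule klin_eqI[where f = "\<lambda>v. Ep m (Ep n v)" and g = "\<lambda>v. if m = n then Ep n v else 0"])
    (auto simp: Ep_bs klin_zero[OF klin_Ep] klin_compose klin_Ep klin_const_zero klin_if)

lemma Xp_Ep: "Xp n i (Ep n v) = Xp n i v"
  by (rule klin_eqI[where f = "\<lambda>v. Xp n i (Ep n v)"])
    (auto simp: Ep_bs Xp_bs klin_zero[OF klin_Xp] klin_compose klin_Ep klin_Xp)

lemma tv_Xg: "tv p \<Longrightarrow> fst (fst p) = n \<Longrightarrow> i < n \<Longrightarrow> tv ((n, Xg n i # snd (fst p)), snd p)"
  by (erule tv_cases) (auto simp: tv_pair wtgt_Xgens)

lemma Ep_Xp: "Ep n (Xp n i v) = Xp n i v"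
  by (rule klin_eqI[where f = "\<lambda>v. Ep n (Xp n i v)"])
    (auto simp: Ep_bs Xp_bs klin_zero[OF klin_Ep] klin_compose klin_Ep klin_Xp tv_Xg)

lemma Dp_Ep: "Dp t n i (Ep n v) = Dp t n i v"
  by (rule klin_eqI[where f = "\<lambda>v. Dp t n i (Ep n v)"])
    (auto simp: Ep_bs Dp_bs klin_zero[OF klin_Dp] klin_compose klin_Ep klin_Dp)

lemma Dp_out: "n < i \<Longrightarrow> Dp t n i v = 0"
  by (rule klin_eqI[where f = "Dp t n i"]) (auto simp: Dp_bs klin_Dp klin_const_zero)

subsection \<open>The exchange steps\<close>

text \<open>Naturality of an exchange step. The target may be a group of families, which is how
  nested steps arise. The condition on \<open>X\<close> concerns occurring indices only, because
  faces can be exchanged only with transpositions within the degree bound.\<close>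

lemma tstep_hom:
  fixes f :: "'v::ab_group_add \<Rightarrow> 'w::ab_group_add"
  assumes add: "\<And>x y. f (x + y) = f x + f y"
    and X: "\<And>s is l k x. (s, is, l) \<in> set (t i j) \<Longrightarrow> k \<in> set is \<Longrightarrow> f (X k x) = X' k (f x)"
  shows "f (tstep t X j v i) = tstep t X' j (\<lambda>l. f (v l)) i"
proof -
  have z: "f 0 = 0" using add[of 0 0] by simp
  have m: "f (- x) = - f x" for x
    using add[of x "- x"] z by (simp add: eq_neg_iff_add_eq_0 add.commute)
  have fo: "f (foldr X is x) = foldr X' is (f x)" if "\<And>k x. k \<in> set is \<Longrightarrow> f (X k x) = X' k (f x)" for "is" x
    using that by (induction "is") simp_all
  have "f (\<Sum>(s, is, l)\<leftarrow>ts. if s then foldr X is (v l) else - foldr X is (v l))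
      = (\<Sum>(s, is, l)\<leftarrow>ts. if s then foldr X' is (f (v l)) else - foldr X' is (f (v l)))"
    if "set ts \<subseteq> set (t i j)" for ts
    using that
  proof (induction ts)
    case (Cons a ts)
    then show ?case using fo[OF X] by (cases a) (auto simp: add m)
  qed (simp add: z)
  then show ?thesis by (simp add: tstep_def)
qed

lemma tstep_cong:
  assumes "\<And>s is l. (s, is, l) \<in> set (t i j) \<Longrightarrow> v l = w l"
  shows "tstep t X j v i = tstep t X j w i"
  unfolding tstep_def using assms by (intro arg_cong[of _ _ sum_list] map_cong) auto

lemma tstep_in_subspace:
  assumes "pm.subspace K"
    and "\<And>s is l. (s, is, l) \<in> set (t i j) \<Longrightarrow> v l \<in> K"
    and "\<And>s is l k x. (s, is, l) \<in> set (t i j) \<Longrightarrow> k \<in> set is \<Longrightarrow> x \<in> K \<Longrightarrow> X k x \<in> K"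
  shows "tstep t X j v i \<in> K"
proof -
  have fo: "foldr X is x \<in> K" if "\<And>k x. k \<in> set is \<Longrightarrow> x \<in> K \<Longrightarrow> X k x \<in> K" "x \<in> K" for "is" x
    using that by (induction "is") simp_all
  have "(\<Sum>(s, is, l)\<leftarrow>ts. if s then foldr X is (v l) else - foldr X is (v l)) \<in> K"
    if "set ts \<subseteq> set (t i j)" for ts
    using that
  proof (induction ts)
    case (Cons a ts)
    obtain s "is" l where a: "a = (s, is, l)" by (cases a)
    have "foldr X is (v l) \<in> K" using Cons.prems assms(2,3)[of s "is" l] by (intro fo) (auto simp: a)
    then show ?case using Cons assms(1) by (auto simp: a pm.subspace_add pm.subspace_neg pm.subspace_diff)
  qed (simp add: pm.subspace_0[OF assms(1)])
  then show ?thesis by (simp add: tstep_def)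
qed

text \<open>What both laws have in common: a table \<open>t\<close> compatible with the relations of
  Sym and with the face relations selected by \<open>P\<close>. Compatibility is required for all
  symmetric actions on tensors, so that it can be used for the operators normalised modulo the
  kernel. The equivalence in \<open>t_D\<close> makes faces out of range, which vanish, exchange
  only into faces out of range.\<close>

locale twist =
  fixes t :: exch and P :: "nat \<Rightarrow> nat \<Rightarrow> bool" and RB :: "(word \<Rightarrow>\<^sub>0 'k::field) set"
  assumes RB_eq: "RB = {dd n i j - dd n (Suc j) i | n i j. P i j \<and> j \<le> n}"
    and t_X: "\<And>n i j s is l k. j < n \<Longrightarrow> (s, is, l) \<in> set (t i j) \<Longrightarrow> k \<in> set is \<Longrightarrow> k \<le> n"
    and t_D: "\<And>n i j s is l. j < n \<Longrightarrow> (s, is, l) \<in> set (t i j) \<Longrightarrow> l \<le> n \<longleftrightarrow> i \<le> n"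
    and P_le: "\<And>i j. P i j \<Longrightarrow> i \<le> j"
    and t_sq: "\<And>n E (X :: nat \<Rightarrow> 'k tens \<Rightarrow> 'k tens) v i j. sym_action (Suc n) E X \<Longrightarrow> (\<And>i. E (v i) = v i) \<Longrightarrow>
       j < n \<Longrightarrow> i \<le> n \<Longrightarrow> tstep t X j (tstep t X j v) i = v i"
    and t_comm: "\<And>n E (X :: nat \<Rightarrow> 'k tens \<Rightarrow> 'k tens) v i j k. sym_action (Suc n) E X \<Longrightarrow> (\<And>i. E (v i) = v i) \<Longrightarrow>
       k < n \<Longrightarrow> i \<le> n \<Longrightarrow> j + 2 \<le> k \<Longrightarrow>
       tstep t X j (tstep t X k v) i = tstep t X k (tstep t X j v) i"
    and t_braid: "\<And>n E (X :: nat \<Rightarrow> 'k tens \<Rightarrow> 'k tens) v i j. sym_action (Suc n) E X \<Longrightarrow> (\<And>i. E (v i) = v i) \<Longrightarrow>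
       Suc j < n \<Longrightarrow> i \<le> n \<Longrightarrow>
       tstep t X (Suc j) (tstep t X j (tstep t X (Suc j) v)) i = tstep t X j (tstep t X (Suc j) (tstep t X j v)) i"
    and t_face: "\<And>n E (X :: nat \<Rightarrow> 'k tens \<Rightarrow> 'k tens) w i j k. sym_action (Suc (Suc n)) E X \<Longrightarrow>
       (\<And>i j. E (w i j) = w i j) \<Longrightarrow> (\<And>i j. P i j \<Longrightarrow> j \<le> n \<Longrightarrow> w (Suc j) i = w i j) \<Longrightarrow>
       k < n \<Longrightarrow> P i j \<Longrightarrow> j \<le> n \<Longrightarrow>
       tstep t (tstep t X) k (\<lambda>j i. w i j) j i = tstep t (tstep t X) k (\<lambda>j i. w i j) i (Suc j)"

lemma twist_omega: "twist omega_terms (\<le>) simp_rels"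
proof
  fix n i j s "is" l k assume "j < n" "(s, is, l) \<in> set (omega_terms i j)" "k \<in> set is"
  then show "k \<le> n" by (auto simp: omega_terms_def split: if_splits)
next
  fix n i j s "is" l assume "j < n" "(s, is, l) \<in> set (omega_terms i j)"
  then show "l \<le> n \<longleftrightarrow> i \<le> n" by (auto simp: omega_terms_def split: if_splits)
qed (simp add: simp_rels_def; fail | erule sym_action.omega_sq sym_action.omega_comm sym_action.omega_braid sym_action.omega_simp; simp; fail | simp)+

lemma twist_zeta: "twist zeta_terms (<) mag_rels"
proof
  fix n i j s "is" l k assume "j < n" "(s, is, l) \<in> set (zeta_terms i j)" "k \<in> set is"
  then show "k \<le> n" by (auto simp: zeta_terms_def split: if_splits)
next
  fix n i j s "is" l assume "j < n" "(s, is, l) \<in> set (zeta_terms i j)"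
  then show "l \<le> n \<longleftrightarrow> i \<le> n" by (auto simp: zeta_terms_def split: if_splits)
qed (simp add: mag_rels_def; fail | erule sym_action.zeta_sq sym_action.zeta_comm sym_action.zeta_braid sym_action.zeta_mag; simp; fail | simp)+

subsection \<open>Homogeneous components\<close>

text \<open>The component of degree \<open>(n, m)\<close>: a valid transposition word has equal
  source and target, so the stored source gives the left degree.\<close>

definition tsp :: "nat \<Rightarrow> nat \<Rightarrow> 'k::field tens set" where
  "tsp n m = {x. \<forall>p\<in>Poly_Mapping.keys x. tv p \<and> fst (fst p) = n \<and> wsrc (snd p) = m}"

lemma subspace_keys: "pm.subspace {x :: 'b \<Rightarrow>\<^sub>0 'k::field. \<forall>p\<in>Poly_Mapping.keys x. Q p}"
proof (rule pm.subspaceI)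
  fix x y :: "'b \<Rightarrow>\<^sub>0 'k" and c
  assume x: "x \<in> {x. \<forall>p\<in>Poly_Mapping.keys x. Q p}"
  then show "smult c x \<in> {x. \<forall>p\<in>Poly_Mapping.keys x. Q p}" by (auto simp: in_keys_iff)
  assume "y \<in> {x. \<forall>p\<in>Poly_Mapping.keys x. Q p}"
  then show "x + y \<in> {x. \<forall>p\<in>Poly_Mapping.keys x. Q p}" using x Poly_Mapping.keys_add[of x y] by auto
qed simp

lemma subspace_tsp: "pm.subspace (tsp n m)"
  unfolding tsp_def by (rule subspace_keys)

lemma subspace_tspace: "pm.subspace (tspace G H)"
  unfolding tspace_def by (rule subspace_keys)

lemma bs_in_tsp: "tv p \<Longrightarrow> fst (fst p) = n \<Longrightarrow> wsrc (snd p) = m \<Longrightarrow> bs p \<in> tsp n m"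
  by (simp add: tsp_def)

lemma tsp_tspace: "x \<in> tsp n m \<Longrightarrow> x \<in> tspace Xgens Dgens"
  by (simp add: tsp_def tspace_def)

lemma tsp_map:
  assumes "klin f" "\<And>p. tv p \<Longrightarrow> fst (fst p) = n \<Longrightarrow> wsrc (snd p) = m \<Longrightarrow> f (bs p) \<in> tsp n' m'" "x \<in> tsp n m"
  shows "f x \<in> tsp n' m'"
proof (rule klin_in_subspace[OF assms(1) subspace_tsp])
  fix p assume "p \<in> Poly_Mapping.keys x"
  with assms(3) show "f (bs p) \<in> tsp n' m'" by (intro assms(2)) (auto simp: tsp_def)
qed

lemma Ep_tsp: "x \<in> tsp n m \<Longrightarrow> Ep n x = x"
  by (rule klin_eq_on_keys) (auto simp: klin_intros Ep_bs tsp_def)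

lemma Xp_tsp: "x \<in> tsp n m \<Longrightarrow> Xp n i x \<in> tsp n m"
  by (erule tsp_map[OF klin_Xp, rotated])
    (simp add: Xp_bs pm.subspace_0[OF subspace_tsp] tv_Xg bs_in_tsp)

lemma Ep_in_tsp: "x \<in> tsp n m \<Longrightarrow> Ep n x \<in> tsp n m"
  by (simp add: Ep_tsp)

lemma klin_tstep:
  assumes "\<And>k. klin (X k)" "\<And>l. klin (f l)"
  shows "klin (\<lambda>m. tstep t X j (\<lambda>l. f l m) i)"
proof -
  have fo: "klin (\<lambda>m. foldr X is (f l m))" for "is" l
    by (induction "is") (auto intro: klin_compose assms)
  have "klin (\<lambda>m. \<Sum>(s, is, l)\<leftarrow>ts. if s then foldr X is (f l m) else - foldr X is (f l m))" for ts
  proof (induction ts)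
    case (Cons a ts)
    obtain s "is" l where a: "a = (s, is, l)" by (cases a)
    show ?case
      using klin_plus[OF fo[of "is" l] Cons] klin_plus[OF klin_neg[OF fo[of "is" l]] Cons]
      by (cases s) (simp_all add: a)
  qed (simp add: klin_const_zero)
  then show ?thesis by (simp add: tstep_def)
qed

lemma tstep_zero:
  assumes "\<And>k. klin (X k)" "\<And>s is l. (s, is, l) \<in> set (t i j) \<Longrightarrow> v l = 0"
  shows "tstep t X j v i = 0"
  using tstep_in_subspace[OF pm.subspace_single_0, of t i j v X] assms by (simp add: klin_zero)

context twist begin

lemma face_on_tsp:
  assumes "wvalid Xgens (n, gs)" "wvalid Dgens b" "n = wtgt b" "i \<le> n"
  shows "face_on t n gs b i \<in> tsp (Suc n) (wsrc b)"
  using assms(1,4)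
proof (induction gs arbitrary: i)
  case Nil
  then show ?case using assms(2,3) by (cases b) (auto intro!: bs_in_tsp simp: tv_pair)
next
  case (Cons g gs)
  then obtain j where g: "g = Xg n j" "j < n" by (auto elim!: XgensE simp: wtgt_Xgens)
  show ?case
    unfolding face_on.simps
    by (rule tstep_in_subspace[OF subspace_tsp]) (use Cons t_D[of j n] g in \<open>auto intro: Xp_tsp\<close>)
qed

lemma Dp_tsp: "x \<in> tsp n m \<Longrightarrow> Dp t n i x \<in> tsp (Suc n) m"
  by (erule tsp_map[OF klin_Dp, rotated])
    (auto simp: Dp_bs pm.subspace_0[OF subspace_tsp] tvalid_def wtgt_Xgens intro!: face_on_tsp)

lemma Ep_Dp: "Ep (Suc n) (Dp t n i v) = Dp t n i (v :: 'k tens)"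
proof (rule klin_eqI[where f = "\<lambda>v. Ep (Suc n) (Dp t n i v)"])
  fix p
  show "Ep (Suc n) (Dp t n i (bs p) :: 'k tens) = Dp t n i (bs p)"
  proof (cases "tv p \<and> fst (fst p) = n")
    case True
    then have "Dp t n i (bs p :: 'k tens) \<in> tsp (Suc n) (wsrc (snd p))" by (intro Dp_tsp bs_in_tsp) auto
    then show ?thesis by (rule Ep_tsp)
  qed (auto simp: Dp_bs klin_zero[OF klin_Ep])
qed (simp_all add: klin_compose klin_intros)

text \<open>Beyond the range i \<le> n all the faces involved vanish, so the exchange rule needs no bound on i.\<close>

lemma Dp_Xp: "j < n \<Longrightarrow> Dp t n i (Xp n j m :: 'k tens) = tstep t (Xp (Suc n)) j (\<lambda>i. Dp t n i m) i"
proof -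
  assume j: "j < n"
  have k: "klin (\<lambda>m. tstep t (Xp (Suc n)) j (\<lambda>i. Dp t n i m) i)"
    by (intro klin_tstep klin_intros)
  show ?thesis
  proof (rule klin_eqI[where f = "\<lambda>m. Dp t n i (Xp n j m)" and g = "\<lambda>m. tstep t (Xp (Suc n)) j (\<lambda>i. Dp t n i m) i"])
    fix p
    show "Dp t n i (Xp n j (bs p) :: 'k tens) = tstep t (Xp (Suc n)) j (\<lambda>i. Dp t n i (bs p)) i"
    proof (cases "tv p \<and> fst (fst p) = n \<and> i \<le> n")
      case True
      then have "Dp t n i (Xp n j (bs p) :: 'k tens) = tstep t (Xp (Suc n)) j (face_on t n (snd (fst p)) (snd p)) i"
        using j tv_Xg[of p n j] by (simp add: Xp_bs Dp_bs)
      also have "\<dots> = tstep t (Xp (Suc n)) j (\<lambda>i. Dp t n i (bs p)) i"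
        by (rule tstep_cong) (use True t_D[OF j] in \<open>auto simp: Dp_bs\<close>)
      finally show ?thesis .
    next
      case False
      then consider "\<not> (tv p \<and> fst (fst p) = n)" | "n < i" by linarith
      then show ?thesis
      proof cases
        case 1
        then show ?thesis by (subst tstep_zero) (auto simp: Xp_bs Dp_bs klin_zero[OF klin_Dp] klin_Xp)
      next
        case 2
        then have "Dp t n l (bs p :: 'k tens) = 0" if "(s, is, l) \<in> set (t i j)" for s "is" l
          using t_D[OF j that] by (simp add: Dp_out)
        then show ?thesis using 2 by (simp add: tstep_zero klin_Xp Dp_out)
      qed
    qed
  qed (simp_all add: klin_compose klin_intros k)
qed

end

subsection \<open>Right multiplication by words of faces\<close>

definition Rp :: "word \<Rightarrow> 'k::field tens \<Rightarrow> 'k tens" where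
  "Rp c = lin (\<lambda>p. if tv p \<and> wsrc (snd p) = wtgt c \<and> wvalid Dgens c then bs (fst p, wcat (snd p) c) else 0)"

lemma klin_Rp: "klin (Rp c)"
  by (simp add: Rp_def klin_lin)

lemma Rp_bs: "Rp c (bs p) = (if tv p \<and> wsrc (snd p) = wtgt c \<and> wvalid Dgens c then bs (fst p, wcat (snd p) c) else 0)"
  by (simp add: Rp_def)

lemma tv_wcat: "tv p \<Longrightarrow> wsrc (snd p) = wtgt c \<Longrightarrow> wvalid Dgens c \<Longrightarrow> tv (fst p, wcat (snd p) c)"
  by (auto simp: tvalid_def wvalid_wcat)

lemma wsrc_wcat: "wsrc (wcat u w) = wsrc w"
  by (simp add: wcat_def wsrc_def)

lemma Rp_tsp: "x \<in> tsp n m \<Longrightarrow> Rp c x \<in> tsp n (wsrc c)"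
  by (erule tsp_map[OF klin_Rp, rotated])
    (simp add: Rp_bs pm.subspace_0[OF subspace_tsp] tv_wcat bs_in_tsp wsrc_wcat)

lemma Rp_Xp: "Rp c (Xp n i x) = Xp n i (Rp c x)"
  by (rule klin_eqI[where f = "\<lambda>x. Rp c (Xp n i x)" and g = "\<lambda>x. Xp n i (Rp c x)"])
    (auto simp: klin_compose klin_intros klin_Rp Rp_bs Xp_bs klin_zero[OF klin_Rp] klin_zero[OF klin_Xp] tv_wcat dest: tv_Xg)

lemma Rp_Ep: "Rp c (Ep n x) = Ep n (Rp c x)"
  by (rule klin_eqI[where f = "\<lambda>x. Rp c (Ep n x)" and g = "\<lambda>x. Ep n (Rp c x)"])
    (auto simp: klin_compose klin_intros klin_Rp Rp_bs Ep_bs klin_zero[OF klin_Rp] klin_zero[OF klin_Ep] tv_wcat)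

text \<open>The exchange is driven by the transposition word alone; trailing faces are carried along
  and may be attached before or after it.\<close>

lemma (in twist) Rp_Dp: "Rp c (Dp t n i x) = Dp t n i (Rp c x :: 'k tens)"
proof (rule klin_eqI[where f = "\<lambda>x. Rp c (Dp t n i x)" and g = "\<lambda>x. Dp t n i (Rp c x)"])
  fix p
  have "Rp c (face_on t n gs b i :: 'k tens) = (if wsrc b = wtgt c \<and> wvalid Dgens c then face_on t n gs (wcat b c) i else 0)"
    if "wvalid Xgens (n, gs)" "wvalid Dgens b" "n = wtgt b" "i \<le> n" for gs b
    using that(1,4)
  proof (induction gs arbitrary: i)
    case Nil
    then show ?case using that(2,3) by (cases b; cases c) (auto simp: Rp_bs tv_pair)
  next
    case (Cons g gs)
    then obtain j where g: "g = Xg n j" "j < n" by (auto elim!: XgensE simp: wtgt_Xgens)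
    have "Rp c (face_on t n (g # gs) b i :: 'k tens) = tstep t (Xp (Suc n)) j (\<lambda>l. Rp c (face_on t n gs b l)) i"
      unfolding face_on.simps g gidx.simps
      by (rule tstep_hom) (simp_all add: Rp_Xp klin_add[OF klin_Rp])
    also have "\<dots> = tstep t (Xp (Suc n)) j (if wsrc b = wtgt c \<and> wvalid Dgens c then face_on t n gs (wcat b c) else (\<lambda>l. 0)) i"
    proof (rule tstep_cong)
      fix s "is" l assume "(s, is, l) \<in> set (t i j)"
      then have "l \<le> n" using t_D[OF g(2)] Cons.prems by blast
      then show "Rp c (face_on t n gs b l :: 'k tens)
        = (if wsrc b = wtgt c \<and> wvalid Dgens c then face_on t n gs (wcat b c) else (\<lambda>l. 0)) l"
        using Cons by simp
    qed
    also have "\<dots> = (if wsrc b = wtgt c \<and> wvalid Dgens c then face_on t n (g # gs) (wcat b c) i else 0)"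
      by (simp add: tstep_zero klin_Xp g)
    finally show ?case .
  qed
  note * = this
  show "Rp c (Dp t n i (bs p) :: 'k tens) = Dp t n i (Rp c (bs p))"
  proof (cases "tv p \<and> fst (fst p) = n \<and> i \<le> n")
    case True
    then obtain gs b where p: "p = ((n, gs), b)" by (cases p; cases "fst p") auto
    show ?thesis
      using True *[of gs b] tv_wcat[of p c]
      by (simp add: p Rp_bs Dp_bs tv_pair klin_zero[OF klin_Dp] klin_zero[OF klin_Rp])
  next
    case False
    then show ?thesis
      using tv_wcat[of p c] by (auto simp: Rp_bs Dp_bs klin_zero[OF klin_Rp] klin_zero[OF klin_Dp])
  qed
qed (simp_all add: klin_compose klin_intros klin_Rp)

subsection \<open>The action of words\<close>

fun gop :: "(nat \<Rightarrow> nat \<Rightarrow> 'k::field tens \<Rightarrow> 'k tens) \<Rightarrow> gen \<Rightarrow> 'k tens \<Rightarrow> 'k tens" where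
  "gop D (Xg n i) = Xp n i"
| "gop D (Dg n i) = D n i"

definition wact :: "(nat \<Rightarrow> nat \<Rightarrow> 'k::field tens \<Rightarrow> 'k tens) \<Rightarrow> word \<Rightarrow> 'k tens \<Rightarrow> 'k tens" where
  "wact D w v = foldr (gop D) (snd w) (Ep (fst w) v)"

lemma wact_Nil [simp]: "wact D (n, []) v = Ep n v"
  and wact_Cons [simp]: "wact D (n, g # gs) v = gop D g (wact D (n, gs) v)"
  by (simp_all add: wact_def)

definition aact :: "(nat \<Rightarrow> nat \<Rightarrow> 'k::field tens \<Rightarrow> 'k tens) \<Rightarrow> (word \<Rightarrow>\<^sub>0 'k) \<Rightarrow> 'k tens \<Rightarrow> 'k tens" where
  "aact D r v = lin (\<lambda>w. wact D w v) r"

text \<open>For \<open>D = Dp t\<close> this is the multiplication of the twisted product, seen as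
  an action of the left factor; \<open>tw_mact\<close> makes this precise modulo the kernel.\<close>

definition mact :: "(nat \<Rightarrow> nat \<Rightarrow> 'k::field tens \<Rightarrow> 'k tens) \<Rightarrow> 'k tens \<Rightarrow> 'k tens \<Rightarrow> 'k tens" where
  "mact D x v = lin (\<lambda>p. if tv p then wact D (fst p) (wact D (snd p) v) else 0) x"

lemma klin_aact1: "klin (\<lambda>r. aact D r v)" and klin_mact1: "klin (\<lambda>x. mact D x v)"
  by (simp_all add: aact_def mact_def klin_lin)

lemma aact_bs [simp]: "aact D (bs w) v = wact D w v"
  by (simp add: aact_def)

lemma mact_bs: "mact D (bs p) v = (if tv p then wact D (fst p) (wact D (snd p) v) else 0)"
  by (simp add: mact_def)

lemma klin_fmul1: "klin (\<lambda>x. fmul x y)" and klin_fmul2: "klin (fmul x)"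
  by (simp_all add: fmul_def klin_bil1 klin_bil2)

lemma Xp_out: "m \<noteq> n \<or> n \<le> i \<Longrightarrow> Xp n i (Ep m v) = 0"
  by (rule klin_eqI[where f = "\<lambda>v. Xp n i (Ep m v)"])
    (auto simp: klin_compose klin_intros Xp_bs Ep_bs klin_zero[OF klin_Xp])

text \<open>Kept apart from the exchange rule, because words are also made to act through
  \<open>rho_face\<close> and \<open>delta_face\<close>, which obey such a rule only modulo a
  kernel.\<close>

locale face_family =
  fixes D :: "nat \<Rightarrow> nat \<Rightarrow> 'k::field tens \<Rightarrow> 'k tens"
  assumes klin_D: "klin (D n i)"
    and Ep_D: "Ep (Suc n) (D n i v) = D n i v"
    and D_Ep: "D n i (Ep n v) = D n i v"
    and D_tsp: "v \<in> tsp n m \<Longrightarrow> D n i v \<in> tsp (Suc n) m"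
begin

lemma klin_gop: "klin (gop D g)"
  by (cases g) (simp_all add: klin_D klin_Xp)

lemma Ep_gop: "Ep (gtgt g) (gop D g v) = gop D g v"
  by (cases g) (simp_all add: Ep_D Ep_Xp)

lemma gop_Ep: "gop D g (Ep (gsrc g) v) = gop D g v"
  by (cases g) (simp_all add: D_Ep Xp_Ep)

lemma gop_tsp: "v \<in> tsp (gsrc g) m \<Longrightarrow> gop D g v \<in> tsp (gtgt g) m"
  by (cases g) (simp_all add: D_tsp Xp_tsp)

lemma klin_wact: "klin (wact D w)"
proof -
  have "klin (wact D (n, gs))" for n gs
    by (induction gs) (simp_all add: klin_Ep klin_gop klin_compose)
  then show ?thesis by (cases w) simp
qed

lemma Ep_wact: "Ep (wtgt w) (wact D w v) = wact D w v"
  by (cases w; cases "snd w") (auto simp: Ep_Ep Ep_gop)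

lemma wact_Ep: "wact D w (Ep (wsrc w) v) = wact D w v"
  by (cases w) (simp add: wact_def Ep_Ep)

lemma wact_wact: "wact D u (wact D w v) = (if wsrc u = wtgt w then wact D (wcat u w) v else 0)"
proof -
  obtain m gs k hs where uw: "u = (m, gs)" "w = (k, hs)" by (cases u; cases w)
  have E: "Ep m (wact D w v) = (if m = wtgt w then wact D w v else 0)"
    using Ep_wact[of w v] by (metis Ep_Ep)
  have "wact D (m, gs) (wact D w v) = (if m = wtgt w then wact D (k, gs @ hs) v else 0)"
    by (induction gs) (auto simp: E[unfolded uw] uw klin_zero[OF klin_gop])
  then show ?thesis by (simp add: uw)
qed

lemma klin_aact2: "klin (aact D r)"
  unfolding aact_def klin_def
  by (simp add: klin_add[OF klin_wact] klin_smult[OF klin_wact])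
    (simp add: lin_def pm.scale_right_distrib sum.distrib pm.scale_sum_right mult.commute)

lemma klin_mact2: "klin (mact D x)"
proof -
  have k: "klin (\<lambda>v. if tv p then wact D (fst p) (wact D (snd p) v) else 0)" for p
    by (intro klin_if klin_compose[OF klin_wact] klin_wact klin_const_zero)
  show ?thesis
    unfolding mact_def klin_def
    by (simp add: klin_add[OF k] klin_smult[OF k])
      (simp add: lin_def pm.scale_right_distrib sum.distrib pm.scale_sum_right mult.commute)
qed

lemma aact_fmul: "aact D (fmul x y) v = aact D x (aact D y v)"
proof -
  have *: "aact D (fmul (bs u) (bs w)) v = aact D (bs u) (aact D (bs w) v)" for u w
    by (simp add: fmul_def wmul_def wact_wact klin_zero[OF klin_aact1])
  have "aact D (fmul (bs u) y) v = aact D (bs u) (aact D y v)" for u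
    by (rule klin_eqI[where f = "\<lambda>y. aact D (fmul (bs u) y) v", OF klin_compose[OF klin_aact1 klin_fmul2]
          klin_compose[OF klin_aact2 klin_aact1] *])
  then show ?thesis
    by (rule klin_eqI[where f = "\<lambda>x. aact D (fmul x y) v", OF klin_compose[OF klin_aact1 klin_fmul1] klin_aact1])
qed

lemma wact_tsp:
  assumes "x \<in> tsp (wsrc w) m" "wvalid G w"
  shows "wact D w x \<in> tsp (wtgt w) m"
proof -
  obtain n gs where w: "w = (n, gs)" by (cases w)
  have "wvalid G (n, gs) \<Longrightarrow> wact D (n, gs) x \<in> tsp (wtgt (n, gs)) m"
    using assms(1) by (induction gs) (auto simp: w Ep_in_tsp gop_tsp)
  then show ?thesis using assms by (simp add: w)
qed

lemma wact_X_unit: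
  assumes "wvalid Xgens a" "wvalid Dgens b"
  shows "wact D a (bs (unitw (wtgt b), b)) = (if fst a = wtgt b then bs (a, b) else 0)"
proof -
  obtain m gs where a: "a = (m, gs)" by (cases a)
  have "wact D (m, gs) (bs (unitw (wtgt b), b)) = (if m = wtgt b then bs ((m, gs), b) else 0)"
    using assms(1) unfolding a
  proof (induction gs)
    case (Cons g gs)
    then obtain i where g: "g = Xg m i" "i < m" by (auto elim!: XgensE simp: wtgt_Xgens)
    show ?case
      using Cons g assms(2) by (auto simp: Xp_bs tv_pair klin_zero[OF klin_Xp])
  qed (use assms(2) in \<open>auto simp: Ep_bs unitw_pair tv_pair\<close>)
  then show ?thesis by (simp add: a)
qed

end

text \<open>The maps \<open>x \<mapsto> x \<cdot> v\<close> and the homomorphisms out of the tensor product are of this form.\<close>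

definition xlift :: "(nat \<Rightarrow> nat \<Rightarrow> 'k::field tens \<Rightarrow> 'k tens) \<Rightarrow> (word \<Rightarrow> 'k tens) \<Rightarrow> 'k tens \<Rightarrow> 'k tens" where
  "xlift D h = lin (\<lambda>p. if tv p then wact D (fst p) (h (snd p)) else 0)"

lemma klin_xlift: "klin (xlift D h)"
  by (simp add: xlift_def klin_lin)

lemma xlift_bs: "xlift D h (bs p) = (if tv p then wact D (fst p) (h (snd p)) else 0)"
  by (simp add: xlift_def)

context face_family begin

lemma xlift_Xp: "xlift D h (Xp n i x) = Xp n i (xlift D h x)"
proof (rule klin_eqI[where f = "\<lambda>x. xlift D h (Xp n i x)" and g = "\<lambda>x. Xp n i (xlift D h x)"])
  fix p
  show "xlift D h (Xp n i (bs p)) = Xp n i (xlift D h (bs p))"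
  proof (cases "tv p")
    case True
    then obtain gs b where p: "p = ((wtgt b, gs), b)" "wvalid Xgens (wtgt b, gs)" by (auto elim!: tv_cases)
    have *: "Xp n i (wact D (m, gs) z) = 0" if "m = wtgt b" "m \<noteq> n \<or> \<not> i < n" for m z
      using Ep_wact[of "(m, gs)" z] wtgt_Xgens[OF p(2)] that Xp_out[of m n i "wact D (m, gs) z"] by auto
    show ?thesis
      using True tv_Xg[OF True, of n i] * by (auto simp: xlift_bs Xp_bs p klin_zero[OF klin_xlift])
  qed (simp add: Xp_bs xlift_bs klin_zero[OF klin_xlift] klin_zero[OF klin_Xp])
qed (auto intro!: klin_compose[OF klin_xlift] klin_compose[OF klin_Xp] klin_xlift klin_Xp)

lemma xlift_Ep: "xlift D h (Ep n x) = Ep n (xlift D h x)"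
proof (rule klin_eqI[where f = "\<lambda>x. xlift D h (Ep n x)" and g = "\<lambda>x. Ep n (xlift D h x)"])
  fix p
  have "Ep n (wact D w z) = (if n = wtgt w then wact D w z else 0)" for w z
    using Ep_wact[of w z] by (metis Ep_Ep)
  then show "xlift D h (Ep n (bs p)) = Ep n (xlift D h (bs p))"
    by (simp add: Ep_bs xlift_bs klin_zero[OF klin_xlift] klin_zero[OF klin_Ep] tvalid_def wtgt_Xgens)
qed (auto intro!: klin_compose[OF klin_xlift] klin_compose[OF klin_Ep] klin_xlift klin_Ep)

end

context twist begin

abbreviation D :: "nat \<Rightarrow> nat \<Rightarrow> 'k tens \<Rightarrow> 'k tens" where "D \<equiv> Dp t"

sublocale face_family D
  by standard (simp_all add: klin_Dp Ep_Dp Dp_Ep Dp_tsp)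

lemma wact_D_unit:
  assumes "wvalid Dgens u" "wvalid Dgens v"
  shows "wact D u (bs (unitw (wtgt v), v)) = (if wsrc u = wtgt v then bs (unitw (wtgt u), wcat u v) else 0)"
proof -
  obtain m gs k hs where uv: "u = (m, gs)" "v = (k, hs)" by (cases u; cases v)
  have "wact D (m, gs) (bs (unitw (wtgt v), v)) = (if m = wtgt v then bs (unitw (wtgt (m, gs)), (k, gs @ hs)) else 0)"
    using assms(1) unfolding uv(1)
  proof (induction gs)
    case (Cons g gs)
    then obtain n i where g: "g = Dg n i" "i \<le> n" by (auto elim!: DgensE)
    show ?case
      using Cons g assms(2) wvalid_wcat[of Dgens "(m, gs)" v]
      by (auto simp: Dp_bs tv_pair klin_zero[OF klin_Dp] unitw_pair uv)
  qed (use assms(2) in \<open>auto simp: Ep_bs unitw_pair tv_pair uv\<close>)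
  then show ?thesis by (simp add: uv)
qed

lemma mact_Xp: "mact D (Xp n i x) v = Xp n i (mact D x v)"
  and mact_Ep: "mact D (Ep n x) v = Ep n (mact D x v)"
  using xlift_Xp[of "\<lambda>w. wact D w v"] xlift_Ep[of "\<lambda>w. wact D w v"] by (simp_all add: mact_def xlift_def)

lemma D_grade: "m \<noteq> n \<Longrightarrow> D n i (Ep m v) = 0"
  using Dp_Ep[of t n i "Ep m v"] by (simp add: Ep_Ep klin_zero[OF klin_Dp])

text \<open>The core of associativity. It holds exactly and not just modulo relations, because
  \<open>face_on\<close> and the operator rule \<open>Dp_Xp\<close> run through the same recursion
  over the transposition word.\<close>

lemma mact_Dp: "mact D (D n i x) v = D n i (mact D x v)"
proof (rule klin_eqI[where f = "\<lambda>x. mact D (D n i x) v" and g = "\<lambda>x. D n i (mact D x v)"])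
  fix p
  show "mact D (D n i (bs p)) v = D n i (mact D (bs p) v)"
  proof (cases "tv p \<and> fst (fst p) = n \<and> i \<le> n")
    case True
    then obtain gs b where p: "p = ((n, gs), b)" "wvalid Xgens (n, gs)" "wvalid Dgens b" "n = wtgt b"
      by (auto elim!: tv_cases)
    have "mact D (face_on t n gs b i) v = D n i (wact D (n, gs) (wact D b v))"
      using p(2) True[THEN conjunct2, THEN conjunct2]
    proof (induction gs arbitrary: i)
      case Nil
      then show ?case using p(3,4) by (cases b) (simp add: mact_bs tv_pair Ep_D D_Ep)
    next
      case (Cons g gs)
      then obtain j where g: "g = Xg n j" "j < n" by (auto elim!: XgensE simp: wtgt_Xgens)
      have "mact D (face_on t n (g # gs) b i) v = tstep t (Xp (Suc n)) j (\<lambda>l. mact D (face_on t n gs b l) v) i"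
        unfolding face_on.simps g gidx.simps
        by (rule tstep_hom) (simp_all add: mact_Xp klin_add[OF klin_mact1])
      also have "\<dots> = tstep t (Xp (Suc n)) j (\<lambda>l. D n l (wact D (n, gs) (wact D b v))) i"
      proof (rule tstep_cong)
        fix s "is" l assume "(s, is, l) \<in> set (t i j)"
        then have "l \<le> n" using t_D[OF g(2)] Cons.prems by blast
        then show "mact D (face_on t n gs b l) v = D n l (wact D (n, gs) (wact D b v))"
          using Cons by simp
      qed
      finally show ?case using g by (simp add: Dp_Xp)
    qed
    then show ?thesis using True by (simp add: Dp_bs mact_bs p)
  next
    case False
    then consider "\<not> tv p" | "n < i" | "tv p" "fst (fst p) \<noteq> n" by linarith
    then show ?thesis
    proof cases
      case 3
      then have "D n i (wact D (fst p) z) = 0" for z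
        using D_grade[of "fst (fst p)" n i] Ep_wact[of "fst p" z] by (metis tvalid_def wtgt_Xgens)
      then show ?thesis using 3 by (simp add: Dp_bs mact_bs klin_zero[OF klin_mact1])
    qed (simp_all add: Dp_bs mact_bs klin_zero[OF klin_mact1] klin_zero[OF klin_Dp] Dp_out)
  qed
qed (auto intro!: klin_compose[OF klin_mact1] klin_compose[OF klin_Dp] klin_mact1 klin_Dp)

lemma mact_gop: "mact D (gop D g x) v = gop D g (mact D x v)"
  by (cases g) (simp_all add: mact_Xp mact_Dp)

lemma mact_wact: "mact D (wact D w x) v = wact D w (mact D x v)"
proof -
  have "mact D (wact D (n, gs) x) v = wact D (n, gs) (mact D x v)" for n gs
    by (induction gs) (simp_all add: mact_Ep mact_gop)
  then show ?thesis by (cases w) simp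
qed

lemma mact_aact: "mact D (aact D r x) v = aact D r (mact D x v)"
  by (simp add: aact_def klin_apply_lin[OF klin_mact1] mact_wact)

end

subsection \<open>Ideals\<close>

definition gspan :: "gen set \<Rightarrow> (word \<Rightarrow>\<^sub>0 'k::field) set" where
  "gspan G = {x. \<forall>w\<in>Poly_Mapping.keys x. wvalid G w}"

text \<open>With the source fixed, all words of a combination act on one and the same unit.\<close>

definition gsp :: "gen set \<Rightarrow> nat \<Rightarrow> (word \<Rightarrow>\<^sub>0 'k::field) set" where
  "gsp G s = {x. \<forall>w\<in>Poly_Mapping.keys x. wvalid G w \<and> fst w = s}"

lemma subspace_gspan: "pm.subspace (gspan G)" and subspace_gsp: "pm.subspace (gsp G s)"
  unfolding gspan_def gsp_def by (rule subspace_keys)+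

lemma bs_gspan: "wvalid G w \<Longrightarrow> bs w \<in> gspan G"
  and bs_gsp: "wvalid G w \<Longrightarrow> fst w = s \<Longrightarrow> bs w \<in> gsp G s"
  by (simp_all add: gspan_def gsp_def)

lemma fmul_gspan: "x \<in> gspan G \<Longrightarrow> y \<in> gspan G \<Longrightarrow> fmul x y \<in> gspan G"
  unfolding fmul_def bil_def
  by (intro lin_in_subspace[OF subspace_gspan])
    (auto simp: wmul_def gspan_def[of G, THEN eq_reflection] pm.subspace_0[OF subspace_gspan, unfolded gspan_def] wvalid_wcat)

lemma fmul_gsp: "x \<in> gspan G \<Longrightarrow> wvalid G v \<Longrightarrow> fmul x (bs v) \<in> gsp G (fst v)"
  unfolding fmul_def bil_def lin_bs
  by (intro lin_in_subspace[OF subspace_gsp])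
    (auto simp: wmul_def gspan_def pm.subspace_0[OF subspace_gsp] wvalid_wcat wcat_def[of _ v, THEN arg_cong[of _ _ fst]] intro!: bs_gsp)

lemma ideal_of_mem: "wvalid G u \<Longrightarrow> r \<in> R \<Longrightarrow> wvalid G v \<Longrightarrow> fmul (fmul (bs u) r) (bs v) \<in> ideal_of G R"
  unfolding ideal_of_def by (rule lspan_base) blast

lemma sym_rels_gspan: "r \<in> sym_rels \<Longrightarrow> r \<in> gspan Xgens"
  by (auto simp: sym_rels_def braid_rels_def xw_def unitw_pair intro!: pm.subspace_diff[OF subspace_gspan] bs_gspan)

lemma (in twist) RB_gspan: "r \<in> RB \<Longrightarrow> r \<in> gspan Dgens"
  using P_le by (fastforce simp: RB_eq dd_def intro!: pm.subspace_diff[OF subspace_gspan] bs_gspan)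

context twist begin

abbreviation K :: "'k tens set" where "K \<equiv> tensK Xgens sym_rels Dgens RB"

lemma subspace_K: "pm.subspace K"
  by (simp add: tensK_def subspace_lspan)

lemma tens_lw_eq:
  assumes "x \<in> gspan Xgens" "wvalid Dgens b"
  shows "tens_lw x b = aact D x (bs (unitw (wtgt b), b))"
  unfolding tens_lw_def aact_def
  by (rule lin_cong) (use assms in \<open>auto simp: gspan_def wact_X_unit wsrc_def\<close>)

lemma tens_wl_eq:
  assumes "wvalid Xgens a" "y \<in> gsp Dgens s"
  shows "tens_wl a y = wact D a (aact D y (bs (unitw s, unitw s)))"
  unfolding tens_wl_def aact_def klin_apply_lin[OF klin_wact]
proof (rule lin_cong)
  fix w assume "w \<in> Poly_Mapping.keys y"
  then have w: "wvalid Dgens w" "fst w = s" using assms(2) by (auto simp: gsp_def)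
  show "(if wsrc a = wtgt w then bs (a, w) else 0) = wact D a (wact D w (bs (unitw s, unitw s)))"
    using wact_D_unit[OF w(1), of "unitw s"] wact_X_unit[OF assms(1) w(1)] w
    by (cases w) (simp add: unitw_pair wsrc_def)
qed

lemma K_mem_sym:
  assumes "wvalid Xgens u" "r \<in> sym_rels" "tv p"
  shows "wact D u (aact D r (bs p)) \<in> K"
proof -
  have p: "wvalid Xgens (fst p)" "wvalid Dgens (snd p)" "fst (fst p) = wtgt (snd p)"
    using assms by (auto simp: tvalid_def wsrc_def)
  have "tens_lw (fmul (fmul (bs u) r) (bs (fst p))) (snd p) = wact D u (aact D r (bs p))"
    using p assms
    by (simp add: tens_lw_eq fmul_gspan bs_gspan sym_rels_gspan aact_fmul wact_X_unit)
  moreover have "tens_lw (fmul (fmul (bs u) r) (bs (fst p))) (snd p) \<in> K"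
    unfolding tensK_def by (rule lspan_base) (use ideal_of_mem p assms in blast)
  ultimately show ?thesis by simp
qed

lemma K_mem_face:
  assumes "wvalid Xgens a" "wvalid Dgens u" "r \<in> RB" "wvalid Dgens v"
  shows "wact D a (wact D u (aact D r (bs (unitw (wtgt v), v)))) \<in> K"
proof -
  have "tens_wl a (fmul (fmul (bs u) r) (bs v)) = wact D a (wact D u (aact D r (bs (unitw (wtgt v), v))))"
    using assms wact_D_unit[of v "unitw (fst v)"]
    by (simp add: tens_wl_eq[OF _ fmul_gsp] fmul_gspan bs_gspan RB_gspan aact_fmul)
      (cases v, simp add: unitw_pair)
  moreover have "tens_wl a (fmul (fmul (bs u) r) (bs v)) \<in> K"
    unfolding tensK_def by (rule lspan_base) (use ideal_of_mem assms in blast)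
  ultimately show ?thesis by simp
qed

text \<open>The kernel is a span over two ideals that are spans themselves. Both levels are unfolded
  here once and for all, leaving relators between words as products of operators, on which closure
  properties are easy to test.\<close>

lemma K_map:
  fixes f :: "'k tens \<Rightarrow> 'b \<Rightarrow>\<^sub>0 'k"
  assumes f: "klin f" and K': "pm.subspace K'" and x: "x \<in> K"
    and sym: "\<And>u r p. wvalid Xgens u \<Longrightarrow> r \<in> sym_rels \<Longrightarrow> tv p \<Longrightarrow> f (wact D u (aact D r (bs p))) \<in> K'"
    and face: "\<And>a u r v. wvalid Xgens a \<Longrightarrow> wvalid Dgens u \<Longrightarrow> r \<in> RB \<Longrightarrow> wvalid Dgens v \<Longrightarrow>
      f (wact D a (wact D u (aact D r (bs (unitw (wtgt v), v))))) \<in> K'"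
  shows "f x \<in> K'"
proof (rule klin_lspan[OF f K' _ x[unfolded tensK_def]])
  fix s assume "s \<in> {tens_lw x b |x b. x \<in> ideal_of Xgens sym_rels \<and> wvalid Dgens b}
    \<union> {tens_wl a y |a y. wvalid Xgens a \<and> y \<in> ideal_of Dgens RB}"
  then consider x b where "s = tens_lw x b" "x \<in> ideal_of Xgens sym_rels" "wvalid Dgens b"
    | a y where "s = tens_wl a y" "wvalid Xgens a" "y \<in> ideal_of Dgens RB"
    by blast
  then show "f s \<in> K'"
  proof cases
    case 1
    have "f (tens_lw x b) \<in> K'"
    proof (rule klin_lspan[OF _ K' _ 1(2)[unfolded ideal_of_def], of "\<lambda>x. f (tens_lw x b)"])
      show "klin (\<lambda>x. f (tens_lw x b))" unfolding tens_lw_def by (rule klin_compose[OF f klin_lin])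
      fix s :: "word \<Rightarrow>\<^sub>0 'k" assume "s \<in> {fmul (fmul (bs u) r) (bs v) |u r v. wvalid Xgens u \<and> r \<in> sym_rels \<and> wvalid Xgens v}"
      then obtain u r v where s: "s = fmul (fmul (bs u) r) (bs v)" "wvalid Xgens u" "r \<in> sym_rels" "wvalid Xgens v"
        by blast
      have "tens_lw s b = wact D u (aact D r (if fst v = wtgt b then bs (v, b) else 0))"
        using s 1 by (simp add: tens_lw_eq fmul_gspan bs_gspan sym_rels_gspan aact_fmul wact_X_unit)
      then show "f (tens_lw s b) \<in> K'"
        using sym[OF s(2,3), of "(v, b)"] s(4) 1(3) pm.subspace_0[OF K']
        by (simp add: tvalid_def wsrc_def klin_zero[OF klin_aact2] klin_zero[OF klin_wact] klin_zero[OF f])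
    qed
    then show ?thesis using 1 by simp
  next
    case 2
    have "f (tens_wl a y) \<in> K'"
    proof (rule klin_lspan[OF _ K' _ 2(3)[unfolded ideal_of_def], of "\<lambda>y. f (tens_wl a y)"])
      show "klin (\<lambda>y. f (tens_wl a y))" unfolding tens_wl_def by (rule klin_compose[OF f klin_lin])
      fix s :: "word \<Rightarrow>\<^sub>0 'k" assume "s \<in> {fmul (fmul (bs u) r) (bs v) |u r v. wvalid Dgens u \<and> r \<in> RB \<and> wvalid Dgens v}"
      then obtain u r v where s: "s = fmul (fmul (bs u) r) (bs v)" "wvalid Dgens u" "r \<in> RB" "wvalid Dgens v"
        by blast
      have "tens_wl a s = wact D a (wact D u (aact D r (bs (unitw (wtgt v), v))))"
        using s 2(2) wact_D_unit[of v "unitw (fst v)"]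
        by (simp add: tens_wl_eq[OF _ fmul_gsp] fmul_gspan bs_gspan RB_gspan aact_fmul)
          (cases v, simp add: unitw_pair)
      then show "f (tens_wl a s) \<in> K'" using face[OF 2(2) s(2-4)] by simp
    qed
    then show ?thesis using 2 by simp
  qed
qed

end

section \<open>Quotients on which the symmetric groups act\<close>

locale sym_ideal =
  fixes K :: "'k::field tens set"
  assumes subspace: "pm.subspace K"
    and Xp_in: "x \<in> K \<Longrightarrow> Xp n i x \<in> K"
    and Ep_in: "x \<in> K \<Longrightarrow> Ep n x \<in> K"
    and sq: "i < n \<Longrightarrow> Xp n i (Xp n i v) - Ep n v \<in> K"
    and comm: "i + 2 \<le> j \<Longrightarrow> j < n \<Longrightarrow> Xp n j (Xp n i v) - Xp n i (Xp n j v) \<in> K"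
    and braid: "Suc i < n \<Longrightarrow>
      Xp n (Suc i) (Xp n i (Xp n (Suc i) v)) - Xp n i (Xp n (Suc i) (Xp n i v)) \<in> K"
begin

abbreviation "qE n v \<equiv> nf K (Ep n v)"
abbreviation "qX n i v \<equiv> nf K (Xp n i v)"
abbreviation "qD D n i v \<equiv> nf K (D n i v)"

lemma nf_add: "nf K (x + y) = nf K x + nf K y"
  by (rule klin_add[OF klin_nf[OF subspace]])

lemma nf_X: "nf K (Xp n i (nf K v)) = nf K (Xp n i v)"
  and nf_E: "nf K (Ep n (nf K v)) = nf K (Ep n v)"
  by (simp_all add: nf_map[OF subspace] klin_intros Xp_in Ep_in)

lemmas nf_iff = nf_eq_iff[OF subspace]

lemma sym_q: "sym_action n (qE n) (qX n)"
proof
  fix i v assume "i < n"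
  then show "qX n i (qX n i v) = qE n v" by (simp add: nf_X nf_iff sq)
next
  fix i j v assume "i + 2 \<le> j" "j < n"
  then show "qX n j (qX n i v) = qX n i (qX n j v)" by (simp only: nf_X) (simp add: nf_iff comm)
next
  fix i v assume "Suc i < n"
  then show "qX n (Suc i) (qX n i (qX n (Suc i) v)) = qX n i (qX n (Suc i) (qX n i v))"
    by (simp only: nf_X nf_map[OF subspace klin_compose[OF klin_Xp klin_Xp]] Xp_in) (simp add: nf_iff braid)
qed (simp_all add: nf_add klin_add[OF klin_Xp] nf_X nf_E Xp_Ep Ep_Xp)

lemma nf_tstep: "nf K (tstep t (Xp n) j v i) = tstep t (qX n) j (\<lambda>l. nf K (v l)) i"
  by (rule tstep_hom) (simp_all add: nf_add nf_X)

text \<open>The outer step has families as its vectors, so naturality is applied to the pointwise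
  normalisation of families.\<close>

lemma nf_tstep2: "nf K (tstep t (tstep t (Xp n)) k w j i) = tstep t (tstep t (qX n)) k (\<lambda>j i. nf K (w j i)) j i"
proof -
  have "(\<lambda>i. nf K (tstep t (tstep t (Xp n)) k w j i)) = tstep t (tstep t (qX n)) k (\<lambda>j i. nf K (w j i)) j"
    by (rule tstep_hom[where f = "\<lambda>u i. nf K (u i)"]) (simp_all add: nf_add fun_eq_iff nf_tstep)
  then show ?thesis by metis
qed

lemma face_action_q:
  assumes "\<And>n i. klin (D n i)" "\<And>n i v. Ep (Suc n) (D n i v) = D n i v" "\<And>n i v. D n i (Ep n v) = D n i v"
    and D_in: "\<And>x n i. x \<in> K \<Longrightarrow> D n i x \<in> K"
    and ex: "\<And>n i j v. j < n \<Longrightarrow> i \<le> n \<Longrightarrow> D n i (Xp n j v) - tstep t (Xp (Suc n)) j (\<lambda>i. D n i v) i \<in> K"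
  shows "face_action t qE qX (qD D)"
proof (rule face_action.intro)
  have D: "nf K (D n i (nf K v)) = nf K (D n i v)" for n i v
    by (rule nf_map) (simp_all add: subspace assms)
  fix n i j u v
  show "qE (Suc n) (qD D n i v) = qD D n i v" by (simp add: nf_E assms)
  show "qD D n i (qE n v) = qD D n i v" by (simp add: D assms)
  show "qD D n i (u + v) = qD D n i u + qD D n i v" by (simp add: nf_add klin_add assms)
  assume "j < n" "i \<le> n"
  then show "qD D n i (qX n j v) = tstep t (qX (Suc n)) j (\<lambda>i. qD D n i v) i"
    using ex[of j n i v] by (simp add: D nf_iff flip: nf_tstep)
qed (rule sym_q)

end

context face_family begin

lemma gop_wact:
  assumes "wvalid G w"
  shows "gop D g (wact D w v) = (if gsrc g = wtgt w then wact D (fst w, g # snd w) v else 0)"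
proof (cases "gsrc g = wtgt w")
  case False
  have "gop D g (wact D w v) = gop D g (Ep (gsrc g) (Ep (wtgt w) (wact D w v)))"
    by (simp only: gop_Ep Ep_wact)
  also have "\<dots> = 0" using False by (simp add: Ep_Ep klin_zero[OF klin_gop])
  finally show ?thesis using False by simp
qed (simp add: wact_def)

lemma Ep_wact': "Ep n (wact D w v) = (if n = wtgt w then wact D w v else 0)"
  using Ep_wact[of w v] by (metis Ep_Ep)

lemma aact_Ep:
  assumes "r \<in> gspan Xgens"
  shows "aact D r (Ep n v) = Ep n (aact D r v)"
  unfolding aact_def klin_apply_lin[OF klin_Ep]
proof (rule lin_cong)
  fix w assume "w \<in> Poly_Mapping.keys r"
  then have "wtgt w = fst w" using assms by (auto simp: gspan_def wtgt_Xgens)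
  then show "wact D w (Ep n v) = Ep n (wact D w v)"
    using wact_Ep[of w "Ep n v"] wact_Ep[of w v]
    by (auto simp: Ep_wact' Ep_Ep wsrc_def klin_zero[OF klin_wact])
qed

end

section \<open>Stability of the tensor kernel under the action\<close>

context twist begin

lemma K_X: "x \<in> K \<Longrightarrow> Xp n i x \<in> K"
proof (rule K_map[where f = "Xp n i"])
  have *: "Xp n i (wact D u z) \<in> K"
    if "wvalid Xgens u" and z: "\<And>u. wvalid Xgens u \<Longrightarrow> wact D u z \<in> K" for u z
  proof (cases "i < n")
    case True
    then show ?thesis
      using gop_wact[OF that(1), of "Xg n i" z] z[of "(fst u, Xg n i # snd u)"] that(1) pm.subspace_0[OF subspace_K]
      by (simp add: wtgt_Xgens)
  next
    case False
    then show ?thesis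
      using Xp_out[of n n i "wact D u z"] by (simp add: Xp_Ep pm.subspace_0[OF subspace_K])
  qed
  show "Xp n i (wact D u (aact D r (bs p))) \<in> K" if "wvalid Xgens u" "r \<in> sym_rels" "tv p" for u r p
    using that by (intro * K_mem_sym)
  show "Xp n i (wact D a (wact D u (aact D r (bs (unitw (wtgt v), v))))) \<in> K"
    if "wvalid Xgens a" "wvalid Dgens u" "r \<in> RB" "wvalid Dgens v" for a u r v
    using that by (intro * K_mem_face)
qed (simp_all add: klin_Xp subspace_K)

lemma K_E: "x \<in> K \<Longrightarrow> Ep n x \<in> K"
  by (rule K_map[where f = "Ep n"])
    (auto simp: klin_Ep subspace_K Ep_wact' K_mem_sym K_mem_face pm.subspace_0)

lemma bs_grade: "aact D r (bs p) = (if tv p then aact D r (Ep (fst (fst p)) (bs p)) else 0)"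
proof -
  have "wact D w (bs p) = 0" if "\<not> tv p" for w
    using wact_Ep[of w "bs p"] that by (simp add: Ep_bs klin_zero[OF klin_wact])
  then show ?thesis by (auto simp: Ep_bs aact_def lin_def)
qed

lemma K_sym: "r \<in> sym_rels \<Longrightarrow> aact D r v \<in> K"
proof (rule klin_in_subspace[OF klin_aact2 subspace_K])
  fix p assume r: "r \<in> sym_rels"
  have "wact D (unitw (fst (fst p))) (aact D r (bs p)) \<in> K" if "tv p"
    using that r by (intro K_mem_sym) (simp_all add: unitw_pair)
  then show "aact D r (bs p) \<in> K"
    using pm.subspace_0[OF subspace_K]
    by (subst bs_grade) (simp add: aact_Ep sym_rels_gspan r unitw_pair)
qed

lemma aact_diff: "aact D (x - y) v = aact D x v - aact D y v"
  by (rule klin_diff[OF klin_aact1])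

sublocale sym_ideal K
proof
  fix i n :: nat and v assume "i < n"
  then have "bs (xw n [i, i]) - bs (unitw n) \<in> sym_rels" by (auto simp: sym_rels_def)
  from K_sym[OF this, of v] show "Xp n i (Xp n i v) - Ep n v \<in> K"
    by (simp add: aact_diff xw_def unitw_pair Xp_Ep)
next
  fix i j n :: nat and v assume "i + 2 \<le> j" "j < n"
  then have "bs (xw n [j, i]) - bs (xw n [i, j]) \<in> sym_rels"
    unfolding sym_rels_def braid_rels_def
    by (intro UnI1 CollectI exI[of _ n] exI[of _ j] exI[of _ i]) auto
  from K_sym[OF this, of v] show "Xp n j (Xp n i v) - Xp n i (Xp n j v) \<in> K"
    by (simp add: aact_diff xw_def Xp_Ep)
next
  fix i n :: nat and v assume "Suc i < n"
  then have "bs (xw n [i, Suc i, i]) - bs (xw n [Suc i, i, Suc i]) \<in> sym_rels"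
    by (fastforce simp: sym_rels_def braid_rels_def)
  from K_sym[OF this, of v] have "Xp n i (Xp n (Suc i) (Xp n i v)) - Xp n (Suc i) (Xp n i (Xp n (Suc i) v)) \<in> K"
    by (simp add: aact_diff xw_def Xp_Ep)
  from pm.subspace_neg[OF subspace_K this]
  show "Xp n (Suc i) (Xp n i (Xp n (Suc i) v)) - Xp n i (Xp n (Suc i) (Xp n i v)) \<in> K" by simp
qed (simp_all add: subspace_K K_X K_E)

lemma nf_D_X: "j < n \<Longrightarrow> nf K (D n i (Xp n j v)) = tstep t (qX (Suc n)) j (\<lambda>i. nf K (D n i v)) i"
  by (simp add: Dp_Xp nf_tstep)

lemma nf_D_E: "qE (Suc n) (nf K (D n i v)) = nf K (D n i v)"
  by (simp add: nf_E Ep_D)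

text \<open>Moving the face through both sides of a relator produces iterated exchange steps on the
  family of all \<open>nf K (D n i v)\<close>. That they agree is the compatibility of the table
  with Sym, used in the quotient.\<close>

lemma D_sym_K:
  assumes r: "r \<in> sym_rels"
  shows "D n i (aact D r v) \<in> K"
proof (cases "i \<le> n")
  case False
  then show ?thesis by (simp add: Dp_out pm.subspace_0[OF subspace_K])
next
  case True
  \<comment> \<open>Only degree \<open>n\<close> is seen by \<open>D n i\<close>; with
    \<open>Ep n v\<close> in place of \<open>v\<close>, relators of any other degree contribute
    zero.\<close>
  have *: "D n i (aact D r (Ep n v)) \<in> K"
  proof -
    consider m j k where "r = bs (xw m [j, k]) - bs (xw m [k, j])" "j + 2 \<le> k" "k < m"
      | m j k where "r = bs (xw m [k, j]) - bs (xw m [j, k])" "j + 2 \<le> k" "k < m"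
      | m j where "r = bs (xw m [j, Suc j, j]) - bs (xw m [Suc j, j, Suc j])" "Suc j < m"
      | m j where "r = bs (xw m [j, j]) - bs (unitw m)" "j < m"
      using r unfolding sym_rels_def braid_rels_def by fastforce
    then show ?thesis
    proof cases
      case 1
      then show ?thesis
        using t_comm[where v = "\<lambda>i. nf K (D n i v)" and X = "qX (Suc n)" and E = "qE (Suc n)" and i = i and j = j and k = k and n = n, OF sym_q nf_D_E] True
        by (auto simp: aact_diff xw_def Ep_Ep klin_diff[OF klin_Dp] Xp_Ep klin_zero[OF klin_Xp] klin_zero[OF klin_Dp]
            pm.subspace_0[OF subspace_K] nf_D_X simp flip: nf_iff)
    next
      case 2
      then show ?thesis
        using t_comm[where v = "\<lambda>i. nf K (D n i v)" and X = "qX (Suc n)" and E = "qE (Suc n)" and i = i and j = j and k = k and n = n, OF sym_q nf_D_E] True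
        by (auto simp: aact_diff xw_def Ep_Ep klin_diff[OF klin_Dp] Xp_Ep klin_zero[OF klin_Xp] klin_zero[OF klin_Dp]
            pm.subspace_0[OF subspace_K] nf_D_X simp flip: nf_iff)
    next
      case 3
      then show ?thesis
        using t_braid[where v = "\<lambda>i. nf K (D n i v)" and X = "qX (Suc n)" and E = "qE (Suc n)" and i = i and j = j and n = n, OF sym_q nf_D_E] True
        by (auto simp: aact_diff xw_def Ep_Ep klin_diff[OF klin_Dp] Xp_Ep klin_zero[OF klin_Xp] klin_zero[OF klin_Dp]
            pm.subspace_0[OF subspace_K] nf_D_X simp flip: nf_iff)
    next
      case 4
      then show ?thesis
        using t_sq[where v = "\<lambda>i. nf K (D n i v)" and X = "qX (Suc n)" and E = "qE (Suc n)" and i = i and j = j and n = n, OF sym_q nf_D_E] True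
        by (auto simp: aact_diff xw_def unitw_pair Ep_Ep klin_diff[OF klin_Dp] Xp_Ep D_Ep klin_zero[OF klin_Xp] klin_zero[OF klin_Dp]
            pm.subspace_0[OF subspace_K] nf_D_X simp flip: nf_iff)
    qed
  qed
  then show ?thesis
    using D_Ep[of n i "aact D r v"] by (simp add: aact_Ep sym_rels_gspan r)
qed

text \<open>Passing a transposition changes the face index, so all faces of \<open>z\<close> are
  assumed to lie in \<open>K'\<close> at once. The subspace is arbitrary because the Leibniz ideal
  needs the same argument.\<close>

lemma D_push:
  assumes "pm.subspace K'" "\<And>n i x. x \<in> K' \<Longrightarrow> Xp n i x \<in> K'" "\<And>n i. D n i z \<in> K'" "wvalid Xgens u"
  shows "D n i (wact D u z) \<in> K'"
proof -
  obtain m gs where u: "u = (m, gs)" by (cases u)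
  have "wvalid Xgens (m, gs) \<Longrightarrow> D n i (wact D (m, gs) z) \<in> K'" for n i
  proof (induction gs arbitrary: n i)
    case Nil
    then show ?case
      using assms(3)[of n i] D_grade[of m n i z] by (cases "m = n") (simp_all add: D_Ep pm.subspace_0[OF assms(1)])
  next
    case (Cons g gs)
    then obtain j where g: "g = Xg m j" "j < m" by (auto elim!: XgensE simp: wtgt_Xgens)
    show ?case
    proof (cases "m = n")
      case True
      then have "D n i (wact D (m, g # gs) z) = tstep t (Xp (Suc n)) j (\<lambda>i. D n i (wact D (m, gs) z)) i"
        using g by (simp add: Dp_Xp)
      also have "\<dots> \<in> K'"
        by (rule tstep_in_subspace[OF assms(1)]) (use Cons assms(2) in auto)
      finally show ?thesis .
    next
      case False
      then have "D n i (Xp m j y) = 0" for y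
        using D_grade[of m n i "Xp m j y"] by (simp add: Ep_Xp)
      then show ?thesis using g by (simp add: pm.subspace_0[OF assms(1)])
    qed
  qed
  then show ?thesis using assms(4) u by simp
qed

text \<open>On face relators the new face, once past the transpositions, merely lengthens the word
  \<open>u\<close>, and a generator of the kernel appears again. On symmetric relators the work is
  done by \<open>D_sym_K\<close>.\<close>

lemma K_D: "x \<in> K \<Longrightarrow> D n i x \<in> K"
proof (rule K_map[where f = "D n i"])
  fix a u r v assume *: "wvalid Xgens a" "wvalid Dgens u" "r \<in> RB" "wvalid Dgens v"
  define z where "z = aact D r (bs (unitw (wtgt v), v))"
  have "D n i (wact D u z) \<in> K" for n i
  proof (cases "i \<le> n \<and> n = wtgt u")
    case True
    then have "D n i (wact D u z) = wact D (unitw (Suc n)) (wact D (fst u, Dg n i # snd u) z)"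
      using gop_wact[OF *(2), of "Dg n i" z] by (simp add: unitw_pair Ep_D flip: wact_def)
    then show ?thesis
      using K_mem_face[of "unitw (Suc n)" "(fst u, Dg n i # snd u)" r v] True * by (simp add: unitw_pair z_def)
  next
    case False
    then show ?thesis
      using gop_wact[OF *(2), of "Dg n i" z] pm.subspace_0[OF subspace_K] by (auto simp: Dp_out)
  qed
  from D_push[OF subspace_K K_X this *(1)]
  show "D n i (wact D a (wact D u (aact D r (bs (unitw (wtgt v), v))))) \<in> K"
    by (simp add: z_def)
qed (auto intro!: D_push D_sym_K simp: klin_Dp subspace_K K_X)

lemma face_q: "face_action t qE qX (qD D)"
  by (rule face_action_q) (simp_all add: klin_Dp Ep_D D_Ep K_D Dp_Xp pm.subspace_0[OF subspace_K])

lemma nf_D: "nf K (D n i (nf K v)) = nf K (D n i v)"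
  by (simp add: nf_map[OF subspace_K] klin_intros K_D)

text \<open>Without transpositions the two sides differ by a face relator up to sign, which lies in
  \<open>K\<close>. Each further transposition is moved past both faces, and \<open>t_face\<close>
  compares the results through the family of all pairs of faces.\<close>

lemma D_face:
  assumes "P i j" "j \<le> n"
  shows "D (Suc n) (Suc j) (D n i v) - D (Suc n) i (D n j v) \<in> K"
proof -
  define W where "W i j v = nf K (D (Suc n) i (D n j v))" for i j v
  have "W (Suc j) i (bs ((n, gs), b)) = W i j (bs ((n, gs), b))"
    if "wvalid Xgens (n, gs)" "wvalid Dgens b" "n = wtgt b" "P i j" "j \<le> n" for gs b i j
    using that(1,4,5)
  proof (induction gs arbitrary: i j)
    case Nil
    define z where "z = (bs (unitw n, b) :: 'k tens)"
    have "dd n i j - dd n (Suc j) i \<in> RB" using Nil by (auto simp: RB_eq)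
    then have "wact D (unitw (Suc (Suc n))) (wact D (unitw (Suc (Suc n))) (aact D (dd n i j - dd n (Suc j) i) z)) \<in> K"
      unfolding z_def that(3) using that(2) by (intro K_mem_face) (simp_all add: unitw_pair)
    then have "D (Suc n) i (D n j z) - D (Suc n) (Suc j) (D n i z) \<in> K"
      by (simp add: aact_diff dd_def unitw_pair D_Ep klin_diff[OF klin_Ep] Ep_D)
    then show ?case by (simp add: W_def unitw_pair z_def flip: nf_iff)
  next
    case (Cons g gs)
    then obtain k where g: "g = Xg n k" "k < n" by (auto elim!: XgensE simp: wtgt_Xgens)
    define m where "m = (bs ((n, gs), b) :: 'k tens)"
    have m: "bs ((n, g # gs), b) = Xp n k m"
      using Cons g that(2,3) by (simp add: m_def Xp_bs tv_pair)
    have W: "W i j (Xp n k m) = tstep t (tstep t (qX (Suc (Suc n)))) k (\<lambda>j i. W i j m) j i" for i j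
    proof -
      \<comment> \<open>All outer faces are applied at once: as a map into families they turn a
        transposition into a whole exchange step. The bound \<open>t_X\<close> keeps the
        transpositions left behind by the inner face in the range of the rule.\<close>
      have "(\<lambda>i. D (Suc n) i (D n j (Xp n k m)))
        = tstep t (tstep t (Xp (Suc (Suc n)))) k (\<lambda>j i. D (Suc n) i (D n j m)) j"
        unfolding Dp_Xp[OF g(2)]
        by (rule tstep_hom) (auto simp: klin_add[OF klin_Dp] fun_eq_iff less_Suc_eq_le intro!: Dp_Xp intro: t_X[OF g(2)])
      from fun_cong[OF this, of i] show ?thesis
        unfolding W_def by (simp add: nf_tstep2)
    qed
    show ?case
      unfolding m W
      by (rule t_face[symmetric, OF sym_q[of "Suc (Suc n)"] _ _ g(2)]) (use Cons in \<open>auto simp: W_def nf_E Ep_D m_def\<close>)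
  qed
  then have base: "W (Suc j) i (bs p) = W i j (bs p)" if "tv p" "fst (fst p) = n" for p
    using that assms by (auto elim!: tv_cases)
  show ?thesis
  proof (rule klin_in_subspace[of "\<lambda>v. D (Suc n) (Suc j) (D n i v) - D (Suc n) i (D n j v)", OF _ subspace_K])
    fix p
    show "D (Suc n) (Suc j) (D n i (bs p)) - D (Suc n) i (D n j (bs p)) \<in> K"
    proof (cases "tv p \<and> fst (fst p) = n")
      case True
      then show ?thesis using base by (simp add: W_def nf_iff)
    qed (auto simp: Dp_bs klin_zero[OF klin_Dp] pm.subspace_0[OF subspace_K])
  qed (intro klin_minus_fun klin_compose[OF klin_Dp klin_Dp])
qed

lemma K_face: "r \<in> RB \<Longrightarrow> aact D r v \<in> K"
  using pm.subspace_neg[OF subspace_K D_face[of _ _ _ v]]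
  by (auto simp: RB_eq aact_diff dd_def D_Ep)

lemma K_gop: "x \<in> K \<Longrightarrow> gop D g x \<in> K"
  by (cases g) (simp_all add: K_X K_D)

lemma K_wact: "x \<in> K \<Longrightarrow> wact D w x \<in> K"
proof -
  assume x: "x \<in> K"
  have "wact D (n, gs) x \<in> K" for n gs
    by (induction gs) (simp_all add: x K_E K_gop)
  then show ?thesis by (cases w) simp
qed

text \<open>Relators act into \<open>K\<close> on every vector, not only on units; hence
  \<open>K\<close> absorbs multiplication on the right.\<close>

lemma K_mact1: "x \<in> K \<Longrightarrow> mact D x v \<in> K"
  by (rule K_map[where f = "\<lambda>x. mact D x v"])
    (simp_all add: klin_mact1 subspace_K mact_wact mact_aact K_wact K_sym K_face)

lemma Rp_wact: "Rp c (wact D w x) = wact D w (Rp c x)"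
proof -
  have "Rp c (wact D (n, gs) x) = wact D (n, gs) (Rp c x)" for n gs
  proof (induction gs)
    case (Cons g gs)
    then show ?case by (cases g) (simp_all add: Rp_Xp Rp_Dp)
  qed (simp add: Rp_Ep)
  then show ?thesis by (cases w) simp
qed

lemma K_Rp: "x \<in> K \<Longrightarrow> Rp c x \<in> K"
proof (rule K_map[where f = "Rp c"])
  have "Rp c (aact D r x) = aact D r (Rp c x)" for r x
    by (simp add: aact_def klin_apply_lin[OF klin_Rp] Rp_wact)
  then show "\<And>u r p. r \<in> sym_rels \<Longrightarrow> Rp c (wact D u (aact D r (bs p))) \<in> K"
    and "\<And>a u r v. r \<in> RB \<Longrightarrow> Rp c (wact D a (wact D u (aact D r (bs (unitw (wtgt v), v))))) \<in> K"
    by (simp_all add: Rp_wact K_wact K_sym K_face)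
qed (simp_all add: klin_Rp subspace_K)

end

lemma lin_diff_fun: "lin (\<lambda>a. f a - g a) x = lin f x - lin g x"
  by (simp add: lin_def pm.scale_right_diff_distrib sum_subtractf)

lemma distlaw_tsp:
  assumes "distlaw Dgens RB Xgens RA \<omega>" "tvalid Dgens Xgens (b, a)"
  shows "\<omega> (b, a) \<in> tsp (wtgt b) (wsrc a)"
proof -
  have "\<omega> (b, a) \<in> tspace Xgens Dgens"
    and *: "\<forall>p\<in>Poly_Mapping.keys (\<omega> (b, a)). wtgt (fst p) = wtgt b \<and> wsrc (snd p) = wsrc a"
    using assms(1)[unfolded distlaw_def, THEN conjunct1] assms(2) by blast+
  show ?thesis
    unfolding tsp_def
  proof (intro CollectI ballI)
    fix p assume "p \<in> Poly_Mapping.keys (\<omega> (b, a))"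
    with * \<open>\<omega> (b, a) \<in> tspace Xgens Dgens\<close> have p: "tv p" "wtgt (fst p) = wtgt b \<and> wsrc (snd p) = wsrc a"
      by (auto simp only: tspace_def)
    then show "tv p \<and> fst (fst p) = wtgt b \<and> wsrc (snd p) = wsrc a"
      using wtgt_Xgens[of "fst p"] by (simp add: tvalid_def)
  qed
qed

lemma klin_tw1: "klin (\<lambda>x. tw \<omega> x y)" and klin_tw2: "klin (tw \<omega> x)"
  by (simp_all add: tw_def klin_bil1 klin_bil2)

lemma (in face_family) hom_wact_X:
  assumes "klin f" "\<And>n i x. f (Xp n i x) = Xp n i (f x)" "\<And>n x. f (Ep n x) = Ep n (f x)"
  shows "wvalid Xgens w \<Longrightarrow> f (wact D w x) = wact D w (f x)"
    and "r \<in> gspan Xgens \<Longrightarrow> f (aact D r x) = aact D r (f x)"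
proof -
  have "wvalid Xgens (n, gs) \<Longrightarrow> f (wact D (n, gs) x) = wact D (n, gs) (f x)" for n gs
    by (induction gs) (auto simp: assms elim!: XgensE)
  then show *: "wvalid Xgens w \<Longrightarrow> f (wact D w x) = wact D w (f x)" for w
    by (cases w) simp
  show "r \<in> gspan Xgens \<Longrightarrow> f (aact D r x) = aact D r (f x)"
    unfolding aact_def klin_apply_lin[OF assms(1)] by (rule lin_cong) (auto simp: gspan_def *)
qed

lemma (in face_family) wact_X_bs:
  assumes "wvalid Xgens a" "tv (a', b)" "fst a = fst a'"
  shows "wact D a (bs (a', b)) = bs (wcat a a', b)"
proof -
  have *: "wvalid Xgens a'" "wvalid Dgens b" "fst a' = wtgt b" using assms(2) by (auto simp: tvalid_def wsrc_def)
  have "wact D a (wact D a' (bs (unitw (wtgt b), b))) = wact D (wcat a a') (bs (unitw (wtgt b), b))"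
    using * assms by (simp add: wact_wact wsrc_def wtgt_Xgens)
  then show ?thesis
    using * assms wvalid_wcat[of Xgens a a'] by (simp add: wact_X_unit wsrc_def wtgt_Xgens wcat_def)
qed

section \<open>The distributive law given by the action\<close>

context twist begin

definition law :: "word \<times> word \<Rightarrow> 'k tens" where
  "law p = wact D (fst p) (bs (snd p, unitw (wsrc (snd p))))"

lemma ideal_in:
  assumes "pm.subspace L" "\<And>x r v. x \<in> R \<Longrightarrow> aact D x v \<in> L" "\<And>u x. wvalid G u \<Longrightarrow> x \<in> L \<Longrightarrow> wact D u x \<in> L"
    and "x \<in> ideal_of G R"
  shows "aact D x v \<in> L"
  by (rule klin_lspan[OF klin_aact1 assms(1) _ assms(4)[unfolded ideal_of_def]])
    (auto simp: aact_fmul assms)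

lemma unit_tsp: "wvalid Xgens a \<Longrightarrow> (bs (a, unitw (wsrc a)) :: 'k tens) \<in> tsp (fst a) (fst a)"
  by (cases a) (auto intro!: bs_in_tsp simp: tv_pair unitw_pair)

lemma law_tsp:
  assumes "tvalid Dgens Xgens (b, a)"
  shows "law (b, a) \<in> tsp (wtgt b) (wsrc a)"
  using assms unit_tsp[of a] unfolding law_def tvalid_def
  by (auto intro!: wact_tsp simp: wtgt_Xgens wsrc_def)

lemma tsp_keys:
  assumes "x \<in> tsp n m" "p \<in> Poly_Mapping.keys x"
  shows "tv p" "wvalid Xgens (fst p)" "wvalid Dgens (snd p)" "fst (fst p) = n" "wtgt (fst p) = n"
    "wtgt (snd p) = n" "wsrc (snd p) = m" "wsrc (fst p) = n"
  using assms wtgt_Xgens[of "fst p"] by (auto simp: tsp_def tvalid_def wsrc_def)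

lemma wact_grade: "wsrc w \<noteq> n \<Longrightarrow> v \<in> tsp n m \<Longrightarrow> wact D w v = 0"
  using wact_Ep[of w v] Ep_tsp[of v n m] by (metis Ep_Ep klin_zero[OF klin_wact])

lemma Rp_tsp_eq:
  assumes "x \<in> tsp n (wtgt c)" "wvalid Dgens c"
  shows "Rp c x = lin (\<lambda>(a, b). bs (a, wcat b c)) x"
  unfolding Rp_def using assms by (intro lin_cong) (auto simp: tsp_def)

lemma Rp_unit: "tv (a, c) \<Longrightarrow> Rp c (bs (a, unitw (wsrc a))) = (bs (a, c) :: 'k tens)"
  by (cases a; cases c) (auto simp: Rp_bs tv_pair unitw_pair)

text \<open>A face relator on the left acts into \<open>K\<close> on any vector. A symmetric relator
  on the right produces an element of \<open>K\<close>, and \<open>K\<close> is stable under the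
  faces that act on it.\<close>

lemma tens_K_law:
  assumes "x \<in> tensK Dgens RB Xgens sym_rels"
  shows "lin law x \<in> K"
proof (rule klin_lspan[OF klin_lin subspace_K _ assms[unfolded tensK_def]])
  fix s :: "word \<times> word \<Rightarrow>\<^sub>0 'k"
  assume "s \<in> {tens_lw x b |x b. x \<in> ideal_of Dgens RB \<and> wvalid Xgens b}
    \<union> {tens_wl a y |a y. wvalid Dgens a \<and> y \<in> ideal_of Xgens sym_rels}"
  then consider x a where "s = tens_lw x a" "x \<in> ideal_of Dgens RB" "wvalid Xgens a"
    | b y where "s = tens_wl b y" "wvalid Dgens b" "y \<in> ideal_of Xgens sym_rels"
    by blast
  then show "lin law s \<in> K"
  proof cases
    case 1
    have "lin law s = aact D x (bs (a, unitw (wsrc a)))"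
      unfolding 1(1) tens_lw_def aact_def klin_apply_lin[OF klin_lin]
      using wact_grade[OF _ unit_tsp[OF 1(3)]] 1(3)
      by (intro lin_cong) (auto simp: law_def wtgt_Xgens)
    also have "\<dots> \<in> K" by (rule ideal_in[OF subspace_K K_face K_wact 1(2)])
    finally show ?thesis .
  next
    case 2
    have "lin law (tens_wl b y) \<in> K"
    proof (rule klin_lspan[OF _ subspace_K _ 2(3)[unfolded ideal_of_def], of "\<lambda>y. lin law (tens_wl b y)"])
      show "klin (\<lambda>y. lin law (tens_wl b y))" unfolding tens_wl_def by (rule klin_compose[OF klin_lin klin_lin])
      fix s :: "word \<Rightarrow>\<^sub>0 'k"
      assume "s \<in> {fmul (fmul (bs u) r) (bs v) |u r v. wvalid Xgens u \<and> r \<in> sym_rels \<and> wvalid Xgens v}"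
      then obtain u r v where s: "s = fmul (fmul (bs u) r) (bs v)" "wvalid Xgens u" "r \<in> sym_rels" "wvalid Xgens v"
        by blast
      have gs: "s \<in> gsp Xgens (fst v)"
        unfolding s(1) using s by (intro fmul_gsp fmul_gspan bs_gspan sym_rels_gspan)
      have "lin law (tens_wl b s) = wact D b (aact D s (bs (unitw (fst v), unitw (fst v))))"
        unfolding tens_wl_def aact_def klin_apply_lin[OF klin_lin] klin_apply_lin[OF klin_wact]
      proof (rule lin_cong)
        fix a assume "a \<in> Poly_Mapping.keys s"
        then have a: "wvalid Xgens a" "fst a = fst v" using gs by (auto simp: gsp_def)
        have "wact D a (bs (unitw (fst v), unitw (fst v))) = bs (a, unitw (fst v))"
          using wact_X_unit[OF a(1), of "unitw (fst v)"] a by (simp add: unitw_pair)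
        then show "lin law (if wsrc b = wtgt a then bs (b, a) else 0)
            = wact D b (wact D a (bs (unitw (fst v), unitw (fst v))))"
          using wact_grade[OF _ unit_tsp[OF a(1)], of b] a by (auto simp: law_def wtgt_Xgens wsrc_def)
      qed
      then show "lin law (tens_wl b s) \<in> K"
        unfolding s(1) aact_fmul using s(3) by (simp add: K_wact K_sym)
    qed
    then show ?thesis using 2 by simp
  qed
qed

lemma mact_unit: "tv (a, unitw (wsrc a)) \<Longrightarrow> mact D (bs (a, unitw (wsrc a))) v = wact D a v"
  using wact_Ep[of a v] by (simp add: mact_bs unitw_pair)

lemma distlaw_law: "distlaw Dgens RB Xgens sym_rels law"
  unfolding distlaw_def
proof (intro conjI allI impI ballI)
  fix b a assume "tvalid Dgens Xgens (b, a)"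
  note l = law_tsp[OF this]
  then show "law (b, a) \<in> tspace Xgens Dgens" by (rule tsp_tspace)
  fix p assume p: "p \<in> Poly_Mapping.keys (law (b, a))"
  show "wtgt (fst p) = wtgt b" "wsrc (snd p) = wsrc a" using tsp_keys[OF l p] by auto
next
  fix x :: "word \<times> word \<Rightarrow>\<^sub>0 'k" assume "x \<in> tensK Dgens RB Xgens sym_rels"
  then show "lin law x \<in> K" by (rule tens_K_law)
next
  fix b1 b2 a
  assume *: "wvalid Dgens b1 \<and> wvalid Dgens b2 \<and> wvalid Xgens a \<and> wsrc b1 = wtgt b2 \<and> wsrc b2 = wtgt a"
  then have l: "law (b2, a) \<in> tsp (wtgt b2) (wsrc a)" by (intro law_tsp) (simp add: tvalid_def)
  \<comment> \<open>Right multiplication by \<open>b2'\<close> commutes with the action, so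
    exchanging \<open>b1\<close> with \<open>a'\<close> and then appending \<open>b2'\<close> is the
    action of \<open>b1\<close> on the pair.\<close>
  have "lin (\<lambda>(a', b2'). lin (\<lambda>(a'', b1'). bs (a'', wcat b1' b2')) (law (b1, a'))) (law (b2, a))
    = lin (\<lambda>p. wact D b1 (bs p)) (law (b2, a))"
  proof (rule lin_cong, clarify)
    fix a' b2' assume "(a', b2') \<in> Poly_Mapping.keys (law (b2, a))"
    note k = tsp_keys[OF l this]
    have "law (b1, a') \<in> tsp (wtgt b1) (wtgt b2')"
      using law_tsp[of b1 a'] k * by (simp add: tvalid_def)
    then have "lin (\<lambda>(a'', b1'). bs (a'', wcat b1' b2')) (law (b1, a')) = Rp b2' (law (b1, a'))"
      using k by (simp add: Rp_tsp_eq)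
    also have "\<dots> = wact D b1 (bs (a', b2'))"
      using Rp_unit[OF k(1)] by (simp add: law_def Rp_wact)
    finally show "lin (\<lambda>(a'', b1'). bs (a'', wcat b1' b2')) (law (b1, a')) = wact D b1 (bs (a', b2'))" .
  qed
  also have "\<dots> = wact D b1 (law (b2, a))" by (rule klin_eq_lin[OF klin_wact, symmetric])
  also have "\<dots> = law (wcat b1 b2, a)" using * by (simp add: law_def wact_wact)
  finally show "law (wcat b1 b2, a)
    - lin (\<lambda>(a', b2'). lin (\<lambda>(a'', b1'). bs (a'', wcat b1' b2')) (law (b1, a'))) (law (b2, a)) \<in> K"
    by (simp add: pm.subspace_0[OF subspace_K])
next
  fix b a1 a2
  assume *: "wvalid Dgens b \<and> wvalid Xgens a1 \<and> wvalid Xgens a2 \<and> wsrc b = wtgt a1 \<and> wsrc a1 = wtgt a2"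
  then have l: "law (b, a1) \<in> tsp (wtgt b) (wsrc a1)" by (intro law_tsp) (simp add: tvalid_def)
  \<comment> \<open>The composite is the product of \<open>law (b, a1)\<close> with the tensor of
    \<open>a2\<close> and a unit, so the second axiom becomes the associativity
    \<open>mact_wact\<close>.\<close>
  have "lin (\<lambda>(a1', b'). lin (\<lambda>(a2', b''). bs (wcat a1' a2', b'')) (law (b', a2))) (law (b, a1))
    = lin (\<lambda>p. mact D (bs p) (bs (a2, unitw (wsrc a2)))) (law (b, a1))"
  proof (rule lin_cong, clarify)
    fix a1' b' assume "(a1', b') \<in> Poly_Mapping.keys (law (b, a1))"
    note k = tsp_keys[OF l this]
    have l2: "law (b', a2) \<in> tsp (wtgt b') (wsrc a2)"
      using k * by (intro law_tsp) (simp add: tvalid_def)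
    have "lin (\<lambda>(a2', b''). bs (wcat a1' a2', b'')) (law (b', a2)) = lin (\<lambda>p. wact D a1' (bs p)) (law (b', a2))"
    proof (rule lin_cong, clarify)
      fix a2' b'' assume "(a2', b'') \<in> Poly_Mapping.keys (law (b', a2))"
      from tsp_keys[OF l2 this] show "bs (wcat a1' a2', b'') = wact D a1' (bs (a2', b''))"
        using k by (simp add: wact_X_bs)
    qed
    also have "\<dots> = mact D (bs (a1', b')) (bs (a2, unitw (wsrc a2)))"
      using k by (simp add: klin_eq_lin[OF klin_wact, symmetric] mact_bs law_def)
    finally show "lin (\<lambda>(a2', b''). bs (wcat a1' a2', b'')) (law (b', a2)) = mact D (bs (a1', b')) (bs (a2, unitw (wsrc a2)))" .
  qed
  also have "\<dots> = mact D (law (b, a1)) (bs (a2, unitw (wsrc a2)))" by (rule klin_eq_lin[OF klin_mact1, symmetric])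
  also have "\<dots> = wact D b (wact D a1 (bs (a2, unitw (wsrc a2))))"
  proof -
    have "tv (a1, unitw (wsrc a1))" using unit_tsp[of a1] * by (simp add: tsp_def)
    from mact_unit[OF this] show ?thesis by (simp only: law_def fst_conv snd_conv mact_wact)
  qed
  also have "\<dots> = law (b, wcat a1 a2)"
  proof -
    have "tv (a2, unitw (wsrc a2))" using unit_tsp[of a2] * by (simp add: tsp_def)
    then have "wact D a1 (bs (a2, unitw (wsrc a2))) = bs (wcat a1 a2, unitw (wsrc a2))"
      using * by (intro wact_X_bs) (simp_all add: wsrc_def wtgt_Xgens)
    then show ?thesis by (simp add: law_def wsrc_wcat)
  qed
  finally show "law (b, wcat a1 a2)
    - lin (\<lambda>(a1', b'). lin (\<lambda>(a2', b''). bs (wcat a1' a2', b'')) (law (b', a2))) (law (b, a1)) \<in> K"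
    by (simp add: pm.subspace_0[OF subspace_K])
next
  fix b assume "wvalid Dgens b"
  then show "law (b, unitw (wsrc b)) - bs (unitw (wtgt b), b) \<in> K"
    using wact_D_unit[of b "unitw (wsrc b)"] pm.subspace_0[OF subspace_K]
    by (cases b) (simp add: law_def unitw_pair)
next
  fix a assume a: "wvalid Xgens a"
  then show "law (unitw (wtgt a), a) - bs (a, unitw (wsrc a)) \<in> K"
    using Ep_tsp[OF unit_tsp[OF a]] pm.subspace_0[OF subspace_K]
    by (simp add: law_def unitw_pair wtgt_Xgens)
qed

subsection \<open>Uniqueness\<close>

lemma unit_face: "l \<le> n \<Longrightarrow> D n l (bs (unitw n, unitw n)) = bs (unitw (Suc n), dw n l)"
  by (simp add: Dp_bs unitw_pair tv_pair dw_def)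

lemma law_dw: "wvalid Xgens a \<Longrightarrow> law (dw n i, a) = D n i (bs (a, unitw (wsrc a)))"
  by (simp add: law_def dw_def D_Ep)

text \<open>The law \<open>zeta\<close> is an arbitrary choice and can only be computed with through this fact.\<close>

theorem distlaw_unique:
  assumes dl: "distlaw Dgens RB Xgens sym_rels \<omega>"
    and gen: "\<And>n i j. i \<le> n \<Longrightarrow> j < n \<Longrightarrow> \<omega> (dw n i, xw n [j]) - law (dw n i, xw n [j]) \<in> K"
    and v: "tvalid Dgens Xgens (b, a)"
  shows "\<omega> (b, a) - law (b, a) \<in> K"
proof -
  note dl' = dl[unfolded distlaw_def]
  note \<omega>_tsp = distlaw_tsp[OF dl]
  have \<omega>_K: "lin \<omega> x \<in> K" if "x \<in> tensK Dgens RB Xgens sym_rels" for x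
    using dl'[THEN conjunct2, THEN conjunct1] that by blast
  \<comment> \<open>Single faces come first. The induction over the transposition word treats all
    face indices together, since the exchange rule mixes them.\<close>
  have face: "\<omega> (dw n i, a) - law (dw n i, a) \<in> K" if a: "wvalid Xgens a" "fst a = n" "i \<le> n" for n i a
  proof -
    obtain xs where a': "a = (n, xs)" using a by (cases a) auto
    have "\<omega> (dw n i, (n, xs)) - law (dw n i, (n, xs)) \<in> K"
      using a(1)[unfolded a'] \<open>i \<le> n\<close>
    proof (induction xs arbitrary: i)
      case Nil
      have w: "wvalid Dgens (dw n i)" using Nil by (simp add: dw_def)
      have "\<omega> (dw n i, unitw (wsrc (dw n i))) - bs (unitw (wtgt (dw n i)), dw n i) \<in> K"
        using dl'[THEN conjunct2, THEN conjunct2, THEN conjunct2, THEN conjunct2, THEN conjunct1] w by blast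
      moreover have "law (dw n i, unitw n) = bs (unitw (Suc n), dw n i)"
        using Nil unit_face[of i n] by (simp add: law_dw unitw_pair)
      ultimately show ?case by (simp add: unitw_pair wsrc_def) (simp add: dw_def)
    next
      case (Cons x xs)
      then obtain j where x: "x = Xg n j" "j < n" by (auto elim!: XgensE simp: wtgt_Xgens)
      have xs: "wvalid Xgens (n, xs)" "wtgt (n, xs) = n" using Cons by (auto simp: wtgt_Xgens)
      let ?a = "(n, xs)"
      \<comment> \<open>On words that do not compose \<open>\<omega>\<close> is unconstrained, hence
        the default zero. The map \<open>G\<close> sends \<open>a' \<otimes> b'\<close> to
        \<open>a'\<close> times \<open>\<omega>(b' \<otimes> ?a)\<close>, which is the outer part of
        the axiom for products in Sym.\<close>
      define h where "h b = (if wsrc b = n then \<omega> (b, ?a) else 0)" for b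
      define G where "G = xlift D h"
      have kG: "klin G" by (simp add: G_def klin_xlift)
      have G_bs: "G (bs p) = (if tv p \<and> wsrc (snd p) = n then wact D (fst p) (\<omega> (snd p, ?a)) else 0)" for p
        by (simp add: G_def xlift_bs h_def klin_zero[OF klin_wact])
      have G_E: "G (Ep m z) = Ep m (G z)" and G_X: "G (Xp m k z) = Xp m k (G z)" for m k z
        by (simp_all add: G_def xlift_Ep xlift_Xp)
      note G_hom = hom_wact_X[OF kG G_X G_E]
      \<comment> \<open>The generator values are known only modulo \<open>K\<close>, so they can be
        inserted into \<open>G\<close> only if it respects \<open>K\<close>. On face relators this
        is the assumption that \<open>\<omega>\<close> is well defined on the quotient.\<close>
      have G_K: "G z \<in> K" if "z \<in> K" for z
      proof (rule K_map[OF kG subspace_K that])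
        fix u p and r :: "word \<Rightarrow>\<^sub>0 'k" assume "wvalid Xgens u" "r \<in> sym_rels" "tv p"
        then show "G (wact D u (aact D r (bs p))) \<in> K"
          by (simp add: G_hom sym_rels_gspan K_wact K_sym)
      next
        fix a u v and r :: "word \<Rightarrow>\<^sub>0 'k" assume *: "wvalid Xgens a" "wvalid Dgens u" "r \<in> RB" "wvalid Dgens v"
        define y where "y = fmul (fmul (bs u) r) (bs v)"
        have y: "y \<in> gsp Dgens (fst v)"
          unfolding y_def using * by (intro fmul_gsp fmul_gspan bs_gspan RB_gspan)
        have "wact D u (aact D r (bs (unitw (wtgt v), v))) = aact D y (bs (unitw (fst v), unitw (fst v)))"
          using wact_D_unit[OF *(4), of "unitw (fst v)"]
          by (cases v) (simp add: y_def aact_fmul unitw_pair)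
        also have "G \<dots> = lin \<omega> (tens_lw y ?a)"
          unfolding aact_def tens_lw_def klin_apply_lin[OF kG] klin_apply_lin[OF klin_lin]
        proof (rule lin_cong)
          fix b assume "b \<in> Poly_Mapping.keys y"
          then have b: "wvalid Dgens b" "fst b = fst v" using y by (auto simp: gsp_def)
          have "wact D b (bs (unitw (fst v), unitw (fst v))) = bs (unitw (wtgt b), b)"
            using wact_D_unit[OF b(1), of "unitw (fst v)"] b by (cases b) (simp add: unitw_pair)
          then show "G (wact D b (bs (unitw (fst v), unitw (fst v)))) = lin \<omega> (if wsrc b = wtgt ?a then bs (b, ?a) else 0)"
            using b xs Ep_tsp[OF \<omega>_tsp[of b ?a]] by (auto simp: G_bs tvalid_def unitw_pair)
        qed
        also have "\<dots> \<in> K"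
        proof (rule \<omega>_K)
          have "y \<in> ideal_of Dgens RB" unfolding y_def using * by (intro ideal_of_mem)
          then show "tens_lw y ?a \<in> tensK Dgens RB Xgens sym_rels"
            unfolding tensK_def using xs by (intro lspan_base) blast
        qed
        finally show "G (wact D a (wact D u (aact D r (bs (unitw (wtgt v), v))))) \<in> K"
          using * by (simp add: G_hom K_wact)
      qed
      define u where "u = (bs (unitw n, unitw n) :: 'k tens)"
      have xj: "wvalid Xgens (xw n [j])" "bs (xw n [j], unitw (wsrc (xw n [j]))) = Xp n j u"
        using x by (simp_all add: xw_def u_def Xp_bs tv_pair unitw_pair)
      have dw: "wvalid Dgens (dw n i)" "wsrc (dw n i) = n" "wtgt (dw n i) = Suc n"
        using Cons by (simp_all add: dw_def)
      have t1: "\<omega> (dw n i, xw n [j]) \<in> tsp (Suc n) n"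
        using \<omega>_tsp[of "dw n i" "xw n [j]"] dw xj x by (simp add: tvalid_def xw_def)
      have "\<omega> (dw n i, wcat (xw n [j]) ?a)
        - lin (\<lambda>(a1', b'). lin (\<lambda>(a2', b''). bs (wcat a1' a2', b'')) (\<omega> (b', ?a))) (\<omega> (dw n i, xw n [j])) \<in> K"
        by (rule dl'[THEN conjunct2, THEN conjunct2, THEN conjunct2, THEN conjunct1, rule_format])
          (use dw xj(1) xs x in \<open>simp add: xw_def\<close>)
      also have "lin (\<lambda>(a1', b'). lin (\<lambda>(a2', b''). bs (wcat a1' a2', b'')) (\<omega> (b', ?a))) (\<omega> (dw n i, xw n [j]))
        = G (\<omega> (dw n i, xw n [j]))"
        unfolding klin_eq_lin[OF kG, of "\<omega> (dw n i, xw n [j])"] G_bs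
      proof (rule lin_cong, clarify)
        fix m gs b' assume "((m, gs), b') \<in> Poly_Mapping.keys (\<omega> (dw n i, xw n [j]))"
        note k = tsp_keys[OF t1 this]
        have t2: "\<omega> (b', ?a) \<in> tsp (wtgt b') n"
          using \<omega>_tsp[of b' ?a] k xs by (simp add: tvalid_def)
        have "lin (\<lambda>(a2', b''). bs (wcat (m, gs) a2', b'')) (\<omega> (b', ?a)) = lin (\<lambda>p. wact D (m, gs) (bs p)) (\<omega> (b', ?a))"
        proof (rule lin_cong, unfold split_paired_all prod.case)
          fix m' gs' k' hs' assume "((m', gs'), k', hs') \<in> Poly_Mapping.keys (\<omega> (b', ?a))"
          from tsp_keys[OF t2 this] show "bs (wcat (m, gs) (m', gs'), k', hs') = wact D (m, gs) (bs ((m', gs'), k', hs'))"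
            using k by (subst wact_X_bs) simp_all
        qed
        then show "lin (\<lambda>(a2', b''). bs (wcat (m, gs) a2', b'')) (\<omega> (b', ?a))
          = (if tv ((m, gs), b') \<and> wsrc (snd ((m, gs), b')) = n then wact D (fst ((m, gs), b')) (\<omega> (snd ((m, gs), b'), ?a)) else 0)"
          using k by (simp add: klin_eq_lin[OF klin_wact, symmetric])
      qed
      finally have 1: "\<omega> (dw n i, (n, x # xs)) - G (\<omega> (dw n i, xw n [j])) \<in> K"
        using x by (simp add: xw_def)
      have 2: "G (\<omega> (dw n i, xw n [j])) - G (law (dw n i, xw n [j])) \<in> K"
        using G_K[OF gen[of i n j]] Cons x by (simp add: klin_diff[OF kG])
      have lD: "l \<le> n" if "(s, is, l) \<in> set (t i j)" for s "is" l
        using t_D[OF x(2) that] Cons by simp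
      have G_law: "G (law (dw n i, xw n [j])) = tstep t (Xp (Suc n)) j (\<lambda>l. \<omega> (dw n l, ?a)) i"
      proof -
        have "law (dw n i, xw n [j]) = tstep t (Xp (Suc n)) j (\<lambda>l. D n l u) i"
          using x xj by (simp add: law_dw Dp_Xp)
        also have "G \<dots> = tstep t (Xp (Suc n)) j (\<lambda>l. G (D n l u)) i"
          by (rule tstep_hom) (simp_all add: klin_add[OF kG] G_X)
        also have "\<dots> = tstep t (Xp (Suc n)) j (\<lambda>l. \<omega> (dw n l, ?a)) i"
        proof (rule tstep_cong)
          fix s "is" l assume "(s, is, l) \<in> set (t i j)"
          then have "l \<le> n" by (rule lD)
          then have "D n l u = bs (unitw (Suc n), dw n l)" by (simp add: u_def unit_face)
          with \<open>l \<le> n\<close> show "G (D n l u) = \<omega> (dw n l, ?a)"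
            using Ep_tsp[OF \<omega>_tsp[of "dw n l" ?a]] xs
            by (simp add: G_bs tvalid_def unitw_pair dw_def)
        qed
        finally show ?thesis .
      qed
      have law_a: "law (dw n i, (n, x # xs)) = tstep t (Xp (Suc n)) j (\<lambda>l. law (dw n l, ?a)) i"
      proof -
        have "bs ((n, x # xs), unitw n) = Xp n j (bs (?a, unitw n) :: 'k tens)"
          using x xs by (simp add: Xp_bs tv_pair unitw_pair)
        then show ?thesis using x xs Cons by (simp add: law_dw Dp_Xp)
      qed
      have "tstep t (Xp (Suc n)) j (\<lambda>l. \<omega> (dw n l, ?a)) i - tstep t (Xp (Suc n)) j (\<lambda>l. law (dw n l, ?a)) i \<in> K"
        unfolding nf_iff[symmetric] nf_tstep
        by (rule tstep_cong) (use Cons.IH[OF xs(1)] lD in \<open>simp add: nf_iff\<close>)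
      with 1 2 show ?case
        unfolding G_law law_a by (simp flip: nf_iff)
    qed
    then show ?thesis using a' by simp
  qed
  have a: "wvalid Xgens a" "wvalid Dgens b" "wsrc b = fst a"
    using v wtgt_Xgens[of a] by (auto simp: tvalid_def)
  obtain gs where b: "b = (fst a, gs)" using a by (cases b) (simp add: wsrc_def)
  \<comment> \<open>For words of faces the other product axiom is used: the first face is exchanged
    with the transpositions of the pairs already computed, while their faces are only multiplied on
    the right.\<close>
  have "\<omega> ((fst a, gs), a) - law ((fst a, gs), a) \<in> K"
    using a(2)[unfolded b]
  proof (induction gs)
    case Nil
    have "\<omega> (unitw (wtgt a), a) - bs (a, unitw (wsrc a)) \<in> K"
      using dl'[THEN conjunct2, THEN conjunct2, THEN conjunct2, THEN conjunct2, THEN conjunct2] a(1) by blast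
    then show ?case
      using Ep_tsp[OF unit_tsp[OF a(1)]] by (simp add: law_def wtgt_Xgens[OF a(1)] unitw_pair)
  next
    case (Cons g gs)
    then obtain n i where g: "g = Dg n i" "i \<le> n" "n = wtgt (fst a, gs)" by (auto elim!: DgensE)
    let ?b = "(fst a, gs)"
    have bv: "wvalid Dgens ?b" "tvalid Dgens Xgens (?b, a)"
      using Cons a by (auto simp: tvalid_def wtgt_Xgens)
    have dw: "wvalid Dgens (dw n i)" "wsrc (dw n i) = n" using g by (simp_all add: dw_def)
    define z where "z = \<omega> (?b, a)"
    have z: "z \<in> tsp n (wsrc a)" unfolding z_def g(3) by (rule \<omega>_tsp[OF bv(2)])
    have "\<omega> (wcat (dw n i) ?b, a)
      - lin (\<lambda>(a', b2'). lin (\<lambda>(a'', b1'). bs (a'', wcat b1' b2')) (\<omega> (dw n i, a'))) (\<omega> (?b, a)) \<in> K"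
      by (rule dl'[THEN conjunct2, THEN conjunct2, THEN conjunct1, rule_format])
        (use dw bv a(1) g in \<open>simp add: wtgt_Xgens\<close>)
    also have "lin (\<lambda>(a', b2'). lin (\<lambda>(a'', b1'). bs (a'', wcat b1' b2')) (\<omega> (dw n i, a'))) (\<omega> (?b, a))
      = lin (\<lambda>p. Rp (snd p) (\<omega> (dw n i, fst p))) z"
      unfolding z_def[symmetric]
    proof (rule lin_cong, clarify)
      fix a' b' assume "(a', b') \<in> Poly_Mapping.keys z"
      note k = tsp_keys[OF z this]
      have "\<omega> (dw n i, a') \<in> tsp (wtgt (dw n i)) (wtgt b')"
        using \<omega>_tsp[of "dw n i" a'] k dw by (simp add: tvalid_def)
      then show "lin (\<lambda>(a'', b1'). bs (a'', wcat b1' b')) (\<omega> (dw n i, a')) = Rp (snd (a', b')) (\<omega> (dw n i, fst (a', b')))"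
        using k by (simp add: Rp_tsp_eq)
    qed
    finally have 1: "\<omega> (wcat (dw n i) ?b, a) - lin (\<lambda>p. Rp (snd p) (\<omega> (dw n i, fst p))) z \<in> K" .
    have "D n i z = lin (\<lambda>p. Rp (snd p) (law (dw n i, fst p))) z"
      unfolding klin_eq_lin[OF klin_Dp, of t n i z]
    proof (rule lin_cong)
      fix p assume "p \<in> Poly_Mapping.keys z"
      note k = tsp_keys[OF z this]
      show "D n i (bs p) = Rp (snd p) (law (dw n i, fst p))"
        using k Rp_unit[of "fst p" "snd p"] by (simp add: law_dw Rp_Dp)
    qed
    moreover have "lin (\<lambda>p. Rp (snd p) (\<omega> (dw n i, fst p)) - Rp (snd p) (law (dw n i, fst p))) z \<in> K"
    proof (rule lin_in_subspace[OF subspace_K])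
      fix p assume "p \<in> Poly_Mapping.keys z"
      note k = tsp_keys[OF z this]
      show "Rp (snd p) (\<omega> (dw n i, fst p)) - Rp (snd p) (law (dw n i, fst p)) \<in> K"
        unfolding klin_diff[OF klin_Rp, symmetric] using k g(2) by (intro K_Rp face) auto
    qed
    ultimately have 2: "lin (\<lambda>p. Rp (snd p) (\<omega> (dw n i, fst p))) z - D n i z \<in> K"
      by (simp add: lin_diff_fun)
    have 3: "D n i z - D n i (law (?b, a)) \<in> K"
      using K_D[OF Cons.IH[OF bv(1)], of n i] by (simp add: z_def klin_diff[OF klin_Dp])
    have "D n i (law (?b, a)) = law ((fst a, g # gs), a)" by (simp add: law_def g(1))
    with 1 2 3 show ?case
      by (simp add: g(1) dw_def flip: nf_iff)
  qed
  then show ?thesis using b by simp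
qed

section \<open>Twisted multiplication as an action\<close>

lemma tw_bs:
  assumes \<omega>: "\<omega> (snd p, fst q) \<in> tsp (wtgt (snd p)) (wsrc (fst q))"
    and "tv p" "tv q" "wsrc (snd p) = wtgt (fst q)"
  shows "tw \<omega> (bs p) (bs q) = wact D (fst p) (Rp (snd q) (\<omega> (snd p, fst q)))"
proof -
  have p: "wvalid Xgens (fst p)" "wvalid Dgens (snd p)" "fst (fst p) = wtgt (snd p)"
    and q: "wvalid Xgens (fst q)" "wvalid Dgens (snd q)" "wsrc (fst q) = wtgt (snd q)"
    using assms(2,3) by (auto simp: tvalid_def wsrc_def)
  define z where "z = \<omega> (snd p, fst q)"
  have z: "z \<in> tsp (wtgt (snd p)) (wtgt (snd q))" using \<omega> q by (simp add: z_def)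
  have "tw \<omega> (bs p) (bs q) = lin (\<lambda>r. wact D (fst p) (Rp (snd q) (bs r))) z"
    unfolding tw_def bil_bs tw_basis_def z_def[symmetric] using assms(4)
  proof (simp, intro lin_cong, clarify)
    fix a b assume "(a, b) \<in> Poly_Mapping.keys z"
    note k = tsp_keys[OF z this]
    show "bs (wcat (fst p) a, wcat b (snd q)) = wact D (fst p) (Rp (snd q) (bs (a, b)))"
      using k p q tv_wcat[of "(a, b)" "snd q"] by (simp add: Rp_bs wact_X_bs)
  qed
  also have "\<dots> = wact D (fst p) (Rp (snd q) z)"
    by (rule klin_eq_lin[OF klin_compose[OF klin_wact klin_Rp], symmetric])
  finally show ?thesis by (simp add: z_def)
qed

lemma tw_tspace:
  fixes \<omega> :: "word \<times> word \<Rightarrow> 'k tens"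
  assumes \<omega>: "\<And>b a. tvalid Dgens Xgens (b, a) \<Longrightarrow> \<omega> (b, a) \<in> tsp (wtgt b) (wsrc a)"
    and "x \<in> tspace Xgens Dgens" "y \<in> tspace Xgens Dgens"
  shows "tw \<omega> x y \<in> tspace Xgens Dgens"
proof -
  have basis: "tw \<omega> (bs p) (bs q) \<in> tspace Xgens Dgens" if "tv p" "tv q" for p q
  proof (cases "wsrc (snd p) = wtgt (fst q)")
    case True
    then have "\<omega> (snd p, fst q) \<in> tsp (wtgt (snd p)) (wsrc (fst q))"
      using that by (intro \<omega>) (simp add: tvalid_def)
    then have "wact D (fst p) (Rp (snd q) (\<omega> (snd p, fst q))) \<in> tsp (wtgt (fst p)) (wsrc (snd q))"
      using that by (intro wact_tsp Rp_tsp) (auto simp: tvalid_def)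
    with \<open>\<omega> (snd p, fst q) \<in> tsp _ _\<close> show ?thesis
      using that True by (simp add: tw_bs tsp_tspace)
  next
    case False
    then show ?thesis by (simp add: tw_def tw_basis_def pm.subspace_0[OF subspace_tspace])
  qed
  have left: "tw \<omega> (bs p) y \<in> tspace Xgens Dgens" if "tv p" for p
  proof (rule klin_in_subspace[OF klin_tw2 subspace_tspace])
    fix q assume "q \<in> Poly_Mapping.keys y"
    then show "tw \<omega> (bs p) (bs q) \<in> tspace Xgens Dgens"
      using assms(3) by (intro basis that) (simp add: tspace_def)
  qed
  show ?thesis
  proof (rule klin_in_subspace[OF klin_tw1 subspace_tspace])
    fix p assume "p \<in> Poly_Mapping.keys x"
    then show "tw \<omega> (bs p) y \<in> tspace Xgens Dgens"
      using assms(2) by (intro left) (simp add: tspace_def)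
  qed
qed

text \<open>The twisted product depends on the law only modulo the kernel, because left actions and
  right multiplication by faces preserve it. This makes products formed with \<open>zeta\<close>
  computable.\<close>

lemma tw_mact:
  assumes \<omega>: "\<And>b a. tvalid Dgens Xgens (b, a) \<Longrightarrow> \<omega> (b, a) \<in> tsp (wtgt b) (wsrc a) \<and> \<omega> (b, a) - law (b, a) \<in> K"
    and "x \<in> tspace Xgens Dgens" "y \<in> tspace Xgens Dgens"
  shows "tw \<omega> x y - mact D x y \<in> K"
proof -
  have basis: "tw \<omega> (bs p) (bs q) - mact D (bs p) (bs q) \<in> K" if "tv p" "tv q" for p q
  proof (cases "wsrc (snd p) = wtgt (fst q)")
    case True
    have p: "wvalid Xgens (fst p)" "wvalid Dgens (snd p)" "fst (fst p) = wtgt (snd p)"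
      and q: "wvalid Xgens (fst q)" "wvalid Dgens (snd q)" "wsrc (fst q) = wtgt (snd q)"
      using that by (auto simp: tvalid_def wsrc_def)
    have v: "tvalid Dgens Xgens (snd p, fst q)" using True p q by (simp add: tvalid_def)
    define z where "z = \<omega> (snd p, fst q)"
    have z: "z \<in> tsp (wtgt (snd p)) (wtgt (snd q))" "z - law (snd p, fst q) \<in> K"
      using \<omega>[OF v] q by (auto simp: z_def)
    have 1: "tw \<omega> (bs p) (bs q) = wact D (fst p) (Rp (snd q) z)"
      unfolding z_def using \<omega>[OF v] that True by (intro tw_bs) auto
    have "mact D (bs p) (bs q) = wact D (fst p) (Rp (snd q) (law (snd p, fst q)))"
      using that Rp_unit[of "fst q" "snd q"] by (simp add: mact_bs law_def Rp_wact)
    then show ?thesis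
      unfolding 1 using K_wact[OF K_Rp[OF z(2), of "snd q"], of "fst p"]
      by (simp add: klin_diff[OF klin_Rp] klin_diff[OF klin_wact])
  next
    case False
    have "(bs q :: 'k tens) \<in> tsp (wtgt (fst q)) (wsrc (snd q))"
      using that by (auto simp: tvalid_def wtgt_Xgens intro: bs_in_tsp)
    from wact_grade[OF False this] show ?thesis
      using False
      by (simp add: tw_def tw_basis_def mact_bs klin_zero[OF klin_wact] pm.subspace_0[OF subspace_K])
  qed
  have left: "tw \<omega> (bs p) y - mact D (bs p) y \<in> K" if "tv p" for p
  proof (rule klin_in_subspace[of "\<lambda>y. tw \<omega> (bs p) y - mact D (bs p) y", OF _ subspace_K])
    fix q assume "q \<in> Poly_Mapping.keys y"
    then show "tw \<omega> (bs p) (bs q) - mact D (bs p) (bs q) \<in> K"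
      using assms(3) by (intro basis that) (simp add: tspace_def)
  qed (intro klin_minus_fun klin_tw2 klin_mact2)
  show ?thesis
  proof (rule klin_in_subspace[of "\<lambda>x. tw \<omega> x y - mact D x y", OF _ subspace_K])
    fix p assume "p \<in> Poly_Mapping.keys x"
    then show "tw \<omega> (bs p) y - mact D (bs p) y \<in> K"
      using assms(2) by (intro left) (simp add: tspace_def)
  qed (intro klin_minus_fun klin_tw1 klin_mact1)
qed

end

lemma wact_X_indep: "wvalid Xgens w \<Longrightarrow> wact D w v = wact D' w v"
proof -
  have "wvalid Xgens (n, gs) \<Longrightarrow> wact D (n, gs) v = wact D' (n, gs) v" for n gs
    by (induction gs) (auto elim!: XgensE)
  then show "wvalid Xgens w \<Longrightarrow> wact D w v = wact D' w v" by (cases w) simp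
qed

lemma (in sym_ideal) sym_aact:
  assumes "r \<in> sym_rels"
  shows "aact D r v \<in> K"
proof -
  have d: "aact D (x - y) v = aact D x v - aact D y v" for x y
    by (rule klin_diff[OF klin_aact1])
  have n: "y - x \<in> K" if "x - y \<in> K" for x y
    using pm.subspace_neg[OF subspace that] by simp
  consider m j k where "r = bs (xw m [j, k]) - bs (xw m [k, j])" "j + 2 \<le> k" "k < m"
    | m j k where "r = bs (xw m [k, j]) - bs (xw m [j, k])" "j + 2 \<le> k" "k < m"
    | m j where "r = bs (xw m [j, Suc j, j]) - bs (xw m [Suc j, j, Suc j])" "Suc j < m"
    | m j where "r = bs (xw m [j, j]) - bs (unitw m)" "j < m"
    using assms unfolding sym_rels_def braid_rels_def by fastforce
  then show ?thesis
    by cases (simp_all add: d xw_def unitw_pair Xp_Ep sq comm braid n)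
qed

section \<open>Homomorphisms out of a twisted product\<close>

locale face_map = T: twist t P RB + L: sym_ideal L + F: face_family F
  for t P and RB :: "(word \<Rightarrow>\<^sub>0 'k::field) set" and L :: "'k tens set" and F :: "nat \<Rightarrow> nat \<Rightarrow> 'k tens \<Rightarrow> 'k tens" +
  assumes F_in: "x \<in> L \<Longrightarrow> F n i x \<in> L"
    and F_X: "j < n \<Longrightarrow> i \<le> n \<Longrightarrow> F n i (Xp n j v) - tstep t (Xp (Suc n)) j (\<lambda>i. F n i v) i \<in> L"
    and F_face: "P i j \<Longrightarrow> j \<le> n \<Longrightarrow> F (Suc n) (Suc j) (F n i v) - F (Suc n) i (F n j v) \<in> L"
begin

text \<open>Since a pair is the product of its two words applied to a unit, a homomorphism that
  fixes the transpositions and sends faces to \<open>F\<close> has no other choice.\<close>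

definition ext :: "'k tens \<Rightarrow> 'k tens" where
  "ext = xlift F (\<lambda>b. wact F b (bs (unitw (wsrc b), unitw (wsrc b))))"

lemma klin_ext: "klin ext"
  by (simp add: ext_def klin_xlift)

lemma ext_Xp: "ext (Xp n i x) = Xp n i (ext x)" and ext_Ep: "ext (Ep n x) = Ep n (ext x)"
  by (simp_all add: ext_def F.xlift_Xp F.xlift_Ep)

lemmas ext_X = T.hom_wact_X[OF klin_ext ext_Xp ext_Ep]

lemma ext_bs: "tv p \<Longrightarrow> ext (bs p) = wact F (fst p) (wact F (snd p) (bs (unitw (wsrc (snd p)), unitw (wsrc (snd p)))))"
  by (simp add: ext_def xlift_bs)

lemma unit_in_tsp: "bs (unitw n, unitw n) \<in> tsp n n"
  by (rule bs_in_tsp) (simp_all add: tv_pair unitw_pair)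

lemma ext_unit: "ext (bs (unitw n, unitw n)) = bs (unitw n, unitw n)"
  using Ep_tsp[OF unit_in_tsp[where 'a = 'k]] by (subst ext_bs) (simp_all add: tv_pair unitw_pair)

lemma ext_tsp:
  assumes "tv p"
  shows "ext (bs p) \<in> tsp (fst (fst p)) (wsrc (snd p))"
  unfolding ext_bs[OF assms] using assms wtgt_Xgens[of "fst p"] unit_in_tsp[of "wsrc (snd p)"]
  F.wact_tsp[of _ "fst p" _ Xgens] F.wact_tsp[of _ "snd p" _ Dgens]
  by (auto simp: tvalid_def)

lemma ext_tspace: "x \<in> tspace Xgens Dgens \<Longrightarrow> ext x \<in> tspace Xgens Dgens"
proof (rule klin_in_subspace[OF klin_ext subspace_tspace])
  fix p assume "x \<in> tspace Xgens Dgens" "p \<in> Poly_Mapping.keys x"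
  then show "ext (bs p) \<in> tspace Xgens Dgens" by (intro tsp_tspace[OF ext_tsp]) (simp add: tspace_def)
qed

lemma L_diff_trans: "x - y \<in> L \<Longrightarrow> y - z \<in> L \<Longrightarrow> x - z \<in> L"
  using pm.subspace_add[OF L.subspace, of "x - y" "y - z"] by simp

lemma L_zero: "0 \<in> L"
  by (rule pm.subspace_0[OF L.subspace])

text \<open>Both sides obey the same exchange rule, \<open>F\<close> only modulo \<open>L\<close>.
  Without transpositions they are equal, because prepending a face to the word means one more
  application of \<open>F\<close>.\<close>

lemma ext_D:
  assumes "i \<le> n"
  shows "ext (T.D n i x) - F n i (ext x) \<in> L"
proof (rule klin_in_subspace[of "\<lambda>x. ext (T.D n i x) - F n i (ext x)", OF _ L.subspace])
  fix p
  show "ext (T.D n i (bs p)) - F n i (ext (bs p)) \<in> L"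
  proof (cases "tv p \<and> fst (fst p) = n")
    case True
    then obtain gs b where p: "p = ((n, gs), b)" "wvalid Xgens (n, gs)" "wvalid Dgens b" "n = wtgt b"
      by (auto elim!: tv_cases)
    have "ext (T.D n i (bs ((n, gs), b))) - F n i (ext (bs ((n, gs), b))) \<in> L"
      using p(2) assms
    proof (induction gs arbitrary: i)
      case Nil
      have 1: "tv ((n, []), b)" using p by (simp add: tv_pair)
      have 2: "T.D n i (bs ((n, []), b)) = bs ((Suc n, []), (fst b, Dg n i # snd b))"
        using 1 Nil by (simp add: Dp_bs)
      have 3: "tv ((Suc n, []), (fst b, Dg n i # snd b))"
        using p Nil by (cases b) (simp add: tv_pair)
      show ?case
        unfolding 2 ext_bs[OF 1] ext_bs[OF 3] using p(3,4)
        by (cases b) (simp add: F.Ep_D F.D_Ep L_zero)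
    next
      case (Cons g gs)
      then obtain j where g: "g = Xg n j" "j < n" by (auto elim!: XgensE simp: wtgt_Xgens)
      define m where "m = (bs ((n, gs), b) :: 'k tens)"
      have m: "bs ((n, g # gs), b) = Xp n j m"
        using Cons g p by (simp add: m_def Xp_bs tv_pair)
      have "nf L (ext (T.D n i (Xp n j m))) = tstep t (L.qX (Suc n)) j (\<lambda>l. nf L (ext (T.D n l m))) i"
        unfolding T.Dp_Xp[OF g(2)]
        by (rule tstep_hom[where f = "\<lambda>x. nf L (ext x)"]) (simp_all add: klin_add[OF klin_ext] L.nf_add ext_Xp L.nf_X)
      also have "\<dots> = tstep t (L.qX (Suc n)) j (\<lambda>l. nf L (F n l (ext m))) i"
      proof (rule tstep_cong)
        fix s "is" l assume "(s, is, l) \<in> set (t i j)"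
        then have "l \<le> n" using T.t_D[OF g(2)] Cons.prems by blast
        then show "nf L (ext (T.D n l m)) = nf L (F n l (ext m))"
          using Cons.IH[of l] Cons.prems by (simp add: m_def L.nf_iff)
      qed
      also have "\<dots> = nf L (F n i (Xp n j (ext m)))"
        unfolding L.nf_tstep[symmetric] using F_X[OF g(2) Cons.prems(2), of "ext m"] by (simp add: L.nf_iff[symmetric])
      finally show ?case by (simp add: m ext_Xp L.nf_iff)
    qed
    then show ?thesis by (simp add: p)
  next
    case False
    have "F n i (ext (bs p)) = F n i (ext (Ep n (bs p)))"
      by (simp add: ext_Ep F.D_Ep)
    then show ?thesis
      using False by (auto simp: Dp_bs Ep_bs klin_zero[OF klin_ext] klin_zero[OF F.klin_D] L_zero)
  qed
qed (intro klin_minus_fun klin_compose[OF klin_ext klin_Dp] klin_compose[OF F.klin_D klin_ext])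

text \<open>The two families are left free: besides faces against \<open>F\<close>, it compares
  \<open>rho_face\<close> and \<open>delta_face\<close> with faces when the two homomorphisms are
  composed.\<close>

lemma ext_wact:
  assumes H: "\<And>n j y. j \<le> n \<Longrightarrow> ext (H n j y) - H' n j (ext y) \<in> L"
    and H': "\<And>n j. klin (H' n j)" "\<And>n j x. x \<in> L \<Longrightarrow> H' n j x \<in> L"
    and w: "wvalid Dgens w"
  shows "ext (wact H w x) - wact H' w (ext x) \<in> L"
proof -
  have "wvalid Dgens (n, gs) \<Longrightarrow> ext (wact H (n, gs) x) - wact H' (n, gs) (ext x) \<in> L" for n gs
  proof (induction gs)
    case (Cons g gs)
    then obtain m i where g: "g = Dg m i" "i \<le> m" by (auto elim!: DgensE)
    have "H' m i (ext (wact H (n, gs) x)) - H' m i (wact H' (n, gs) (ext x)) \<in> L"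
      using H'(2)[OF Cons.IH, of m i] Cons.prems by (simp add: klin_diff[OF H'(1)])
    from L_diff_trans[OF H[OF g(2)] this] show ?case using g by simp
  qed (simp add: ext_Ep L_zero)
  then show ?thesis using w by (cases w) simp
qed

lemma ext_D_wact: "wvalid Dgens w \<Longrightarrow> ext (wact T.D w x) - wact F w (ext x) \<in> L"
  by (rule ext_wact) (simp_all add: ext_D F.klin_D F_in)

lemma ext_aact:
  assumes "r \<in> gspan Dgens"
  shows "ext (aact T.D r x) - aact F r (ext x) \<in> L"
  unfolding aact_def klin_apply_lin[OF klin_ext] lin_diff_fun[symmetric]
  by (rule lin_in_subspace[OF L.subspace]) (use assms in \<open>auto simp: gspan_def intro: ext_D_wact\<close>)

lemma L_gop: "x \<in> L \<Longrightarrow> gop F g x \<in> L"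
  by (cases g) (simp_all add: L.Xp_in F_in)

lemma L_wact: "x \<in> L \<Longrightarrow> wact F w x \<in> L"
proof -
  assume x: "x \<in> L"
  have "wact F (n, gs) x \<in> L" for n gs
    by (induction gs) (simp_all add: x L.Ep_in L_gop)
  then show ?thesis by (cases w) simp
qed

lemma L_face: "r \<in> RB \<Longrightarrow> aact F r v \<in> L"
  using pm.subspace_neg[OF L.subspace F_face[of _ _ _ v]]
  by (auto simp: T.RB_eq klin_diff[OF klin_aact1] dd_def F.D_Ep)

text \<open>Symmetric relators commute with \<open>ext\<close>, and face relators turn into the same
  relators in the operators \<open>F\<close>, up to \<open>L\<close>. Both act into
  \<open>L\<close>, which is stable under all operators involved.\<close>

lemma ext_K: "x \<in> T.K \<Longrightarrow> ext x \<in> L"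
proof (rule T.K_map[OF klin_ext L.subspace])
  fix u p and r :: "word \<Rightarrow>\<^sub>0 'k" assume *: "wvalid Xgens u" "r \<in> sym_rels"
  then have "ext (wact T.D u (aact T.D r (bs p))) = wact T.D u (aact T.D r (ext (bs p)))"
    by (simp add: ext_X sym_rels_gspan)
  also have "\<dots> = wact F u (aact T.D r (ext (bs p)))" by (rule wact_X_indep[OF *(1)])
  finally show "ext (wact T.D u (aact T.D r (bs p))) \<in> L"
    using * by (simp add: L_wact L.sym_aact)
next
  fix a u v and r :: "word \<Rightarrow>\<^sub>0 'k" assume *: "wvalid Xgens a" "wvalid Dgens u" "r \<in> RB" "wvalid Dgens v"
  define y where "y = (bs (unitw (wtgt v), v) :: 'k tens)"
  have "ext (wact T.D u (aact T.D r y)) - wact F u (ext (aact T.D r y)) \<in> L"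
    by (rule ext_D_wact[OF *(2)])
  moreover have "wact F u (ext (aact T.D r y)) - wact F u (aact F r (ext y)) \<in> L"
    using L_wact[OF ext_aact[OF T.RB_gspan[OF *(3)], of y], of u] by (simp add: klin_diff[OF F.klin_wact])
  moreover have "wact F u (aact F r (ext y)) \<in> L" using * by (intro L_wact L_face)
  ultimately have "ext (wact T.D u (aact T.D r y)) \<in> L"
    using L_diff_trans[of _ _ 0] by (metis diff_zero)
  then have "wact F a (ext (wact T.D u (aact T.D r y))) \<in> L" by (rule L_wact)
  then show "ext (wact T.D a (wact T.D u (aact T.D r (bs (unitw (wtgt v), v))))) \<in> L"
    unfolding ext_X(1)[OF *(1)] y_def by (simp only: wact_X_indep[OF *(1), of T.D _ F])
qed

end

section \<open>The two substitutions on tensors and modulo a kernel\<close>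

lemma klin_rho_face:
  assumes "\<And>n i. klin (D n i)"
  shows "klin (rho_face Xp D n i)"
proof (induction i)
  case 0
  then show ?case using assms[of n 0] by (simp add: klin_def)
next
  case (Suc i)
  have "rho_face Xp D n (Suc i) = (\<lambda>v. D n (Suc i) v + Xp (Suc n) (Suc i) (rho_face Xp D n i v))"
    by (simp add: fun_eq_iff)
  then show ?case by (simp only:) (intro klin_plus assms klin_compose[OF klin_Xp Suc])
qed

lemma klin_delta_face:
  assumes "\<And>n i. klin (D n i)"
  shows "klin (delta_face Xp D n i)"
  unfolding delta_face_def
  by (cases i) (auto intro!: klin_minus_fun assms klin_const_zero klin_compose[OF klin_Xp])

context face_family begin

lemma face_family_rho: "face_family (rho_face Xp D)"
proof
  fix n i m v
  show "Ep (Suc n) (rho_face Xp D n i v) = rho_face Xp D n i v"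
    by (induction i) (simp_all add: Ep_D Ep_Xp klin_add[OF klin_Ep])
  show "rho_face Xp D n i (Ep n v) = rho_face Xp D n i v"
    by (induction i) (simp_all add: D_Ep)
  assume v: "v \<in> tsp n m"
  show "rho_face Xp D n i v \<in> tsp (Suc n) m"
    by (induction i) (simp_all add: D_tsp v Xp_tsp pm.subspace_add[OF subspace_tsp])
qed (simp add: klin_rho_face klin_D)

lemma face_family_delta: "face_family (delta_face Xp D)"
proof
  fix n i m v
  show "Ep (Suc n) (delta_face Xp D n i v) = delta_face Xp D n i v"
    by (simp add: delta_face_def Ep_D Ep_Xp klin_diff[OF klin_Ep] klin_zero[OF klin_Ep])
  show "delta_face Xp D n i (Ep n v) = delta_face Xp D n i v"
    by (simp add: delta_face_def D_Ep)
  assume v: "v \<in> tsp n m"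
  then show "delta_face Xp D n i v \<in> tsp (Suc n) m"
    by (simp add: delta_face_def D_tsp Xp_tsp pm.subspace_diff[OF subspace_tsp])
qed (simp add: klin_delta_face klin_D)

end

context sym_ideal begin

lemma nf_rho: "nf K (rho_face Xp D n i v) = rho_face qX (qD D) n i v"
proof (induction i)
  case (Suc i)
  show ?case using nf_X[of "Suc n" "Suc i" "rho_face Xp D n i v"] by (simp add: nf_add Suc)
qed simp

lemma nf_delta: "nf K (delta_face Xp D n i v) = delta_face qX (qD D) n i v"
  by (simp add: delta_face_def klin_diff[OF klin_nf[OF subspace]] klin_zero[OF klin_nf[OF subspace]] nf_X)

lemma rho_in: "(\<And>n i x. x \<in> K \<Longrightarrow> D n i x \<in> K) \<Longrightarrow> x \<in> K \<Longrightarrow> rho_face Xp D n i x \<in> K"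
  by (induction i) (simp_all add: Xp_in pm.subspace_add[OF subspace])

lemma delta_in: "(\<And>n i x. x \<in> K \<Longrightarrow> D n i x \<in> K) \<Longrightarrow> x \<in> K \<Longrightarrow> delta_face Xp D n i x \<in> K"
  by (simp add: delta_face_def Xp_in pm.subspace_diff[OF subspace])

lemma rho_q_nf:
  assumes "\<And>n i. klin (D n i)" "\<And>n i x. x \<in> K \<Longrightarrow> D n i x \<in> K"
  shows "rho_face qX (qD D) n i (nf K v) = rho_face qX (qD D) n i v"
  unfolding nf_rho[symmetric] by (rule nf_map) (simp_all add: subspace klin_rho_face assms rho_in)

lemma delta_q_nf:
  assumes "\<And>n i. klin (D n i)" "\<And>n i x. x \<in> K \<Longrightarrow> D n i x \<in> K"
  shows "delta_face qX (qD D) n i (nf K v) = delta_face qX (qD D) n i v"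
  unfolding nf_delta[symmetric] by (rule nf_map) (simp_all add: subspace klin_delta_face assms delta_in)

lemma nf_rho_rho:
  assumes "\<And>n i. klin (D n i)" "\<And>n i x. x \<in> K \<Longrightarrow> D n i x \<in> K"
  shows "nf K (rho_face Xp D m i (rho_face Xp D n j v)) = rho_face qX (qD D) m i (rho_face qX (qD D) n j v)"
    and "nf K (rho_face Xp D n i (Xp n j v)) = rho_face qX (qD D) n i (qX n j v)"
proof -
  have *: "nf K (rho_face Xp D m i w) = rho_face qX (qD D) m i (nf K w)" for m w
    by (rule trans[OF nf_rho rho_q_nf[OF assms, symmetric]])
  show "nf K (rho_face Xp D m i (rho_face Xp D n j v)) = rho_face qX (qD D) m i (rho_face qX (qD D) n j v)"
    by (rule trans[OF *]) (simp only: nf_rho)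
  show "nf K (rho_face Xp D n i (Xp n j v)) = rho_face qX (qD D) n i (qX n j v)"
    by (rule *)
qed

lemma nf_delta_delta:
  assumes "\<And>n i. klin (D n i)" "\<And>n i x. x \<in> K \<Longrightarrow> D n i x \<in> K"
  shows "nf K (delta_face Xp D m i (delta_face Xp D n j v)) = delta_face qX (qD D) m i (delta_face qX (qD D) n j v)"
    and "nf K (delta_face Xp D n i (Xp n j v)) = delta_face qX (qD D) n i (qX n j v)"
proof -
  have *: "nf K (delta_face Xp D m i w) = delta_face qX (qD D) m i (nf K w)" for m w
    by (rule trans[OF nf_delta delta_q_nf[OF assms, symmetric]])
  show "nf K (delta_face Xp D m i (delta_face Xp D n j v)) = delta_face qX (qD D) m i (delta_face qX (qD D) n j v)"
    by (rule trans[OF *]) (simp only: nf_delta)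
  show "nf K (delta_face Xp D n i (Xp n j v)) = delta_face qX (qD D) n i (qX n j v)"
    by (rule *)
qed

end

lemma delta_face_simps:
  "delta_face X D n 0 v = D n 0 v"
  "delta_face X D n (Suc j) v = D n (Suc j) v - X (Suc n) (Suc j) (D n j v)"
  by (simp_all add: delta_face_def)

subsection \<open>Values on generators\<close>

lemma Xp_xw:
  assumes "k \<le> n" "l \<le> n" "\<forall>j\<in>set is. j \<le> n"
  shows "Xp (Suc n) k (bs (xw (Suc n) is, dw n l)) = bs (xw (Suc n) (k # is), dw n l)"
proof -
  have "wvalid Xgens (Suc n, map (Xg (Suc n)) is)"
    using assms(3) by (induction "is") (auto simp: wtgt_Xgens)
  then show ?thesis using assms by (simp add: Xp_bs tv_pair xw_def dw_def)
qed

lemma (in twist) law_gen: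
  assumes "i \<le> n" "j < n"
  shows "law (dw n i, xw n [j]) = tstep t (Xp (Suc n)) j (\<lambda>l. bs (xw (Suc n) [], dw n l)) i"
proof -
  have "law (dw n i, xw n [j]) = D n i (Xp n j (bs (unitw n, unitw n)))"
    using assms by (simp add: law_dw xw_def Xp_bs tv_pair unitw_pair)
  also have "\<dots> = tstep t (Xp (Suc n)) j (\<lambda>l. D n l (bs (unitw n, unitw n))) i"
    by (rule Dp_Xp[OF assms(2)])
  also have "\<dots> = tstep t (Xp (Suc n)) j (\<lambda>l. bs (xw (Suc n) [], dw n l)) i"
    by (rule tstep_cong) (use t_D[OF assms(2)] assms(1) unit_face in \<open>auto simp: xw_def unitw_pair\<close>)
  finally show ?thesis .
qed

lemma (in twist) wact_D_one:
  "wvalid Dgens b \<Longrightarrow> wact D b (bs (unitw (wsrc b), unitw (wsrc b))) = bs (unitw (wtgt b), b)"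
  using wact_D_unit[of b "unitw (wsrc b)"] by (cases b) (simp add: unitw_pair)

interpretation om: twist omega_terms "(\<le>)" simp_rels
  by (rule twist_omega)

interpretation ze: twist zeta_terms "(<)" mag_rels
  by (rule twist_zeta)

lemma omega_law_gen: "i \<le> n \<Longrightarrow> j < n \<Longrightarrow> om.law (dw n i, xw n [j]) = omega_gen n i j"
  by (simp add: om.law_gen tstep_def omega_terms_def omega_gen_def Xp_xw)

lemma zeta_law_gen: "i \<le> n \<Longrightarrow> j < n \<Longrightarrow> ze.law (dw n i, xw n [j]) = zeta_gen n i j"
  by (simp add: ze.law_gen tstep_def zeta_terms_def zeta_gen_def Xp_xw)

text \<open>A choice has the chosen property only if something has it; \<open>ze.law\<close> is the
  witness.\<close>

lemma zeta_distlaw: "distlaw Dgens mag_rels Xgens sym_rels (zeta :: word \<times> word \<Rightarrow> 'a::field tens)"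
  and zeta_gen_values: "has_gen_values zeta_gen ze.K (zeta :: word \<times> word \<Rightarrow> 'a::field tens)"
proof -
  have "has_gen_values zeta_gen ze.K (ze.law :: word \<times> word \<Rightarrow> 'a tens)"
    by (simp add: has_gen_values_def zeta_law_gen pm.subspace_0[OF ze.subspace_K])
  then have "\<exists>\<zeta> :: word \<times> word \<Rightarrow> 'a tens. distlaw Dgens mag_rels Xgens sym_rels \<zeta> \<and> has_gen_values zeta_gen ze.K \<zeta>"
    using ze.distlaw_law by blast
  from someI_ex[OF this, folded zeta_def]
  show "distlaw Dgens mag_rels Xgens sym_rels (zeta :: word \<times> word \<Rightarrow> 'a tens)"
    "has_gen_values zeta_gen ze.K (zeta :: word \<times> word \<Rightarrow> 'a tens)" by auto
qed

lemma zeta_law: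
  assumes "tvalid Dgens Xgens (b, a)"
  shows "zeta (b, a) \<in> tsp (wtgt b) (wsrc a)" "zeta (b, a) - ze.law (b, a) \<in> ze.K"
proof -
  show "zeta (b, a) \<in> tsp (wtgt b) (wsrc a)" by (rule distlaw_tsp[OF zeta_distlaw assms])
  show "zeta (b, a) - ze.law (b, a) \<in> ze.K"
    by (intro ze.distlaw_unique[OF zeta_distlaw _ assms])
      (simp add: zeta_law_gen zeta_gen_values[unfolded has_gen_values_def, rule_format])
qed

subsection \<open>The Leibniz ideal\<close>

abbreviation "Dz \<equiv> Dp zeta_terms"
abbreviation "Dw \<equiv> Dp omega_terms"

lemma zeta_tw: "x \<in> tspace Xgens Dgens \<Longrightarrow> y \<in> tspace Xgens Dgens \<Longrightarrow> tw zeta x y - mact Dz x y \<in> ze.K"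
  by (rule ze.tw_mact) (simp_all add: zeta_law)

lemma tv_leib: "j \<le> n \<Longrightarrow> i \<le> Suc n \<Longrightarrow> tv (unitw (Suc (Suc n)), (n, [Dg (Suc n) i, Dg n j]))"
  and tv_leib': "j \<le> n \<Longrightarrow> i \<le> Suc n \<Longrightarrow> k \<le> Suc n \<Longrightarrow> tv (xw (Suc (Suc n)) [k], (n, [Dg (Suc n) i, Dg n j]))"
  by (simp_all add: unitw_pair xw_def tv_pair)

lemma leib_rels_tspace: "r \<in> leib_rels \<Longrightarrow> r \<in> tspace Xgens Dgens"
proof -
  have b: "bs p \<in> tspace Xgens Dgens" if "tv p" for p
    using that by (simp add: tspace_def)
  assume "r \<in> leib_rels"
  then show ?thesis
    by (auto simp: leib_rels_def intro!: pm.subspace_add[OF subspace_tspace] pm.subspace_diff[OF subspace_tspace] b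
        tv_leib tv_leib')
qed

lemma mact_leib:
  assumes "j \<le> n"
  shows "mact Dz (bs (unitw (n + 2), (n, [Dg (Suc n) (Suc j), Dg n j]))
                - bs (unitw (n + 2), (n, [Dg (Suc n) j, Dg n j]))
                + bs (xw (n + 2) [Suc j], (n, [Dg (Suc n) j, Dg n j]))) v
    = Dz (Suc n) (Suc j) (Dz n j v) - Dz (Suc n) j (Dz n j v) + Xp (Suc (Suc n)) (Suc j) (Dz (Suc n) j (Dz n j v))"
  using assms tv_leib[of j n] tv_leib'[of j n j "Suc j"]
  by (simp add: klin_add[OF klin_mact1] klin_diff[OF klin_mact1] mact_bs)
    (simp add: unitw_pair xw_def Xp_Ep ze.Ep_D ze.D_Ep)

text \<open>The generators of the ideal are products formed with the chosen \<open>zeta\<close>.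
  Modulo the tensor kernel they become words acting on a relator, and the relator acting on a
  pair.\<close>

lemma leib_gen_diff:
  assumes "tv u" "r \<in> leib_rels" "tv v"
  shows "tw zeta (tw zeta (bs u) r) (bs v) - wact Dz (fst u) (wact Dz (snd u) (mact Dz r (bs v))) \<in> ze.K"
proof -
  have b: "bs p \<in> tspace Xgens Dgens" if "tv p" for p
    using that by (simp add: tspace_def)
  note r = leib_rels_tspace[OF assms(2)]
  have 1: "tw zeta (bs u) r \<in> tspace Xgens Dgens"
    by (rule ze.tw_tspace) (simp_all add: zeta_law assms b r)
  have 2: "tw zeta (tw zeta (bs u) r) (bs v) - mact Dz (tw zeta (bs u) r) (bs v) \<in> ze.K"
    by (intro zeta_tw 1 b assms)
  have 3: "mact Dz (tw zeta (bs u) r) (bs v) - mact Dz (mact Dz (bs u) r) (bs v) \<in> ze.K"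
    unfolding klin_diff[OF klin_mact1, symmetric] by (intro ze.K_mact1 zeta_tw b assms r)
  have "mact Dz (mact Dz (bs u) r) (bs v) = wact Dz (fst u) (wact Dz (snd u) (mact Dz r (bs v)))"
    using assms(1) by (simp add: mact_bs ze.mact_wact)
  then show ?thesis using pm.subspace_add[OF ze.subspace_K 2 3] by simp
qed

lemma subspace_leibK: "pm.subspace leibK"
  by (simp add: leibK_def subspace_lspan)

lemma K_leibK: "x \<in> ze.K \<Longrightarrow> x \<in> leibK"
  unfolding leibK_def by (rule lspan_base) simp

lemma leibK_mem:
  assumes "wvalid Xgens a" "wvalid Dgens b" "r \<in> leib_rels" "tv v"
  shows "wact Dz a (wact Dz b (mact Dz r (bs v))) \<in> leibK"
proof (cases "wsrc a = wtgt b")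
  case True
  then have u: "tv (a, b)" using assms by (simp add: tvalid_def)
  have "tw zeta (tw zeta (bs (a, b)) r) (bs v) \<in> leibK"
    unfolding leibK_def using u assms by (intro lspan_base) blast
  from pm.subspace_diff[OF subspace_leibK this K_leibK[OF leib_gen_diff[OF u assms(3,4)]]]
  show ?thesis by simp
next
  case False
  then show ?thesis by (simp add: ze.wact_wact pm.subspace_0[OF subspace_leibK])
qed

text \<open>The counterpart of \<open>K_map\<close> for the Leibniz ideal. Since its generators are
  stated through the action, the arguments that follow no longer involve
  \<open>zeta\<close>.\<close>

lemma leibK_map:
  fixes f :: "'a::field tens \<Rightarrow> 'b \<Rightarrow>\<^sub>0 'a"
  assumes f: "klin f" and K': "pm.subspace K'" and x: "x \<in> leibK"
    and K: "\<And>x. x \<in> ze.K \<Longrightarrow> f x \<in> K'"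
    and g: "\<And>a b r v. wvalid Xgens a \<Longrightarrow> wvalid Dgens b \<Longrightarrow> r \<in> leib_rels \<Longrightarrow> tv v \<Longrightarrow>
      f (wact Dz a (wact Dz b (mact Dz r (bs v)))) \<in> K'"
  shows "f x \<in> K'"
proof (rule klin_lspan[OF f K' _ x[unfolded leibK_def]])
  fix s :: "'a tens"
  assume "s \<in> ze.K \<union> {tw zeta (tw zeta (bs u) r) (bs v) |u r v. tv u \<and> r \<in> leib_rels \<and> tv v}"
  then consider "s \<in> ze.K" | u r v where "s = tw zeta (tw zeta (bs u) r) (bs v)" "tv u" "r \<in> leib_rels" "tv v"
    by blast
  then show "f s \<in> K'"
  proof cases
    case 2
    have "f (wact Dz (fst u) (wact Dz (snd u) (mact Dz r (bs v)))) \<in> K'"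
      using 2 by (intro g) (auto simp: tvalid_def)
    from pm.subspace_add[OF K' K[OF leib_gen_diff[OF 2(2-4)]] this]
    show ?thesis by (simp add: 2(1) klin_diff[OF f])
  qed (rule K)
qed

lemma leibK_X: "x \<in> leibK \<Longrightarrow> Xp n i x \<in> leibK"
proof (rule leibK_map[where f = "Xp n i"])
  fix a b r v assume *: "wvalid Xgens a" "wvalid Dgens b" "r \<in> leib_rels" "tv v"
  define z where "z = wact Dz b (mact Dz r (bs v))"
  show "Xp n i (wact Dz a (wact Dz b (mact Dz r (bs v)))) \<in> leibK"
  proof (cases "i < n")
    case True
    then show ?thesis
      using ze.gop_wact[OF *(1), of "Xg n i" z] leibK_mem[of "(fst a, Xg n i # snd a)" b r v] *
      by (simp add: wtgt_Xgens z_def pm.subspace_0[OF subspace_leibK])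
  next
    case False
    then show ?thesis
      using Xp_out[of n n i "wact Dz a z"] by (simp add: Xp_Ep z_def pm.subspace_0[OF subspace_leibK])
  qed
qed (simp_all add: klin_Xp subspace_leibK K_leibK ze.K_X)

lemma leibK_E: "x \<in> leibK \<Longrightarrow> Ep n x \<in> leibK"
  by (rule leibK_map[where f = "Ep n"])
    (auto simp: klin_Ep subspace_leibK K_leibK ze.K_E ze.Ep_wact' leibK_mem pm.subspace_0)

lemma leibK_D: "x \<in> leibK \<Longrightarrow> Dz n i x \<in> leibK"
proof (rule leibK_map[where f = "Dz n i"])
  fix a b r v assume *: "wvalid Xgens a" "wvalid Dgens b" "r \<in> leib_rels" "tv v"
  define z where "z = mact Dz r (bs v)"
  have "Dz n i (wact Dz b z) \<in> leibK" for n i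
  proof (cases "i \<le> n \<and> n = wtgt b")
    case True
    then have "Dz n i (wact Dz b z) = wact Dz (unitw (Suc n)) (wact Dz (fst b, Dg n i # snd b) z)"
      using ze.gop_wact[OF *(2), of "Dg n i" z] by (simp add: unitw_pair ze.Ep_D flip: wact_def)
    then show ?thesis
      using leibK_mem[of "unitw (Suc n)" "(fst b, Dg n i # snd b)" r v] True * by (simp add: unitw_pair z_def)
  next
    case False
    then show ?thesis
      using ze.gop_wact[OF *(2), of "Dg n i" z] by (auto simp: Dp_out pm.subspace_0[OF subspace_leibK])
  qed
  from ze.D_push[OF subspace_leibK leibK_X this *(1)]
  show "Dz n i (wact Dz a (wact Dz b (mact Dz r (bs v)))) \<in> leibK"
    by (simp add: z_def)
qed (simp_all add: klin_Dp subspace_leibK K_leibK ze.K_D)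

interpretation L: sym_ideal leibK
  by standard (simp_all add: subspace_leibK leibK_X leibK_E K_leibK ze.sq ze.comm ze.braid)

text \<open>The ideal contains the relators multiplied on the right by any basis pair; read as left
  actions, this is an identity of operators on the quotient.\<close>

lemma leib_rel_leibK:
  assumes "j \<le> n"
  shows "Dz (Suc n) (Suc j) (Dz n j v) - Dz (Suc n) j (Dz n j v) + Xp (Suc (Suc n)) (Suc j) (Dz (Suc n) j (Dz n j v)) \<in> leibK"
    (is "?f v \<in> _")
proof (rule klin_in_subspace[of ?f, OF _ subspace_leibK])
  fix p
  show "?f (bs p) \<in> leibK"
  proof (cases "tv p")
    case True
    define r where "r = (bs (unitw (n + 2), (n, [Dg (Suc n) (Suc j), Dg n j]))
                - bs (unitw (n + 2), (n, [Dg (Suc n) j, Dg n j]))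
                + bs (xw (n + 2) [Suc j], (n, [Dg (Suc n) j, Dg n j])) :: 'a tens)"
    have r: "r \<in> leib_rels" using assms by (auto simp: leib_rels_def r_def)
    have "wact Dz (unitw (n + 2)) (wact Dz (unitw (n + 2)) (mact Dz r (bs p))) \<in> leibK"
      using True by (intro leibK_mem r) (simp_all add: unitw_pair)
    then show ?thesis
      unfolding r_def mact_leib[OF assms]
      by (simp add: unitw_pair klin_add[OF klin_Ep] klin_diff[OF klin_Ep] ze.Ep_D Ep_Xp)
  qed (simp add: Dp_bs klin_zero[OF klin_Dp] klin_zero[OF klin_Xp] pm.subspace_0[OF subspace_leibK])
qed (intro klin_plus klin_minus_fun klin_compose[OF klin_Dp klin_Dp] klin_compose[OF klin_Xp] )

text \<open>With this the abstract computations with \<open>rho_face\<close> become statements about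
  Leib.\<close>

lemma leib_q: "leib_action L.qE L.qX (L.qD Dz)"
proof (intro leib_action.intro leib_action_axioms.intro L.face_action_q)
  have n: "nf leibK (Dz n i (nf leibK v)) = nf leibK (Dz n i v)" for n i v
    by (rule nf_map) (simp_all add: subspace_leibK klin_Dp leibK_D)
  fix i j n :: nat and v
  show "L.qD Dz (Suc n) (Suc j) (L.qD Dz n i v) = L.qD Dz (Suc n) i (L.qD Dz n j v)" if "i < j" "j \<le> n"
    using K_leibK[OF ze.D_face[OF that, of v]] by (simp add: n L.nf_iff)
  show "L.qD Dz (Suc n) (Suc j) (L.qD Dz n j v) = L.qD Dz (Suc n) j (L.qD Dz n j v)
    - L.qX (Suc (Suc n)) (Suc j) (L.qD Dz (Suc n) j (L.qD Dz n j v))" if "j \<le> n"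
    unfolding n L.nf_X klin_diff[OF klin_nf[OF subspace_leibK], symmetric] L.nf_iff
    using leib_rel_leibK[OF that, of v] by (simp add: algebra_simps)
qed (simp_all add: klin_Dp ze.Ep_D ze.D_Ep leibK_D ze.Dp_Xp pm.subspace_0[OF subspace_leibK])

lemma omega_q: "omega_action om.qE om.qX (om.qD Dw)"
proof (intro omega_action.intro omega_action_axioms.intro om.face_q)
  fix i j n :: nat and v assume "i \<le> j" "j \<le> n"
  then show "om.qD Dw (Suc n) (Suc j) (om.qD Dw n i v) = om.qD Dw (Suc n) i (om.qD Dw n j v)"
    using om.D_face[of i j n v] by (simp add: om.nf_D om.nf_iff)
qed

subsection \<open>The two homomorphisms\<close>

interpretation rz: face_family "rho_face Xp Dz"
  by (rule ze.face_family_rho)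

interpretation dw: face_family "delta_face Xp Dw"
  by (rule om.face_family_delta)

lemma rho_q:
  "nf leibK (rho_face Xp Dz m i (rho_face Xp Dz n j v)) = rho_face L.qX (L.qD Dz) m i (rho_face L.qX (L.qD Dz) n j v)"
  "nf leibK (rho_face Xp Dz n i (Xp n j v)) = rho_face L.qX (L.qD Dz) n i (L.qX n j v)"
  by (rule L.nf_rho_rho; simp add: klin_Dp leibK_D)+

lemma delta_q:
  "nf om.K (delta_face Xp Dw m i (delta_face Xp Dw n j v)) = delta_face om.qX (om.qD Dw) m i (delta_face om.qX (om.qD Dw) n j v)"
  "nf om.K (delta_face Xp Dw n i (Xp n j v)) = delta_face om.qX (om.qD Dw) n i (om.qX n j v)"
  by (rule om.nf_delta_delta; simp add: klin_Dp om.K_D)+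

text \<open>The map from the twisted product to Leib. Its two conditions, the exchange rule and the
  simplicial relations, are \<open>rho_X\<close> and \<open>rho_simp\<close> read modulo the Leibniz
  ideal.\<close>

interpretation phi: face_map omega_terms "(\<le>)" simp_rels leibK "rho_face Xp Dz"
proof
  fix n i v
  show "x \<in> leibK \<Longrightarrow> rho_face Xp Dz n i x \<in> leibK" for x
    by (rule L.rho_in[OF leibK_D])
  fix j
  show "rho_face Xp Dz n i (Xp n j v) - tstep omega_terms (Xp (Suc n)) j (\<lambda>i. rho_face Xp Dz n i v) i \<in> leibK"
    if "j < n" "i \<le> n"
    unfolding L.nf_iff[symmetric] L.nf_tstep
    by (rule trans[OF rho_q(2)]) (simp only: L.nf_rho[where D = Dz], rule leib_action.rho_X[OF leib_q that])
  show "rho_face Xp Dz (Suc n) (Suc j) (rho_face Xp Dz n i v) - rho_face Xp Dz (Suc n) i (rho_face Xp Dz n j v) \<in> leibK"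
    if "i \<le> j" "j \<le> n"
    unfolding L.nf_iff[symmetric] rho_q(1)
    by (rule leib_action.rho_simp[OF leib_q that])
qed

text \<open>The map in the other direction, at this point defined modulo the tensor kernel of Sym
  and Mag only; the Leibniz relators are dealt with in \<open>psi_leibK\<close>.\<close>

interpretation psi: face_map zeta_terms "(<)" mag_rels om.K "delta_face Xp Dw"
proof
  fix n i v
  show "x \<in> om.K \<Longrightarrow> delta_face Xp Dw n i x \<in> om.K" for x
    by (rule om.delta_in[OF om.K_D])
  fix j
  show "delta_face Xp Dw n i (Xp n j v) - tstep zeta_terms (Xp (Suc n)) j (\<lambda>i. delta_face Xp Dw n i v) i \<in> om.K"
    if "j < n" "i \<le> n"
    unfolding om.nf_iff[symmetric] om.nf_tstep
    by (rule trans[OF delta_q(2)]) (simp only: om.nf_delta[where D = Dw], rule omega_action.delta_X[OF omega_q that])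
  show "delta_face Xp Dw (Suc n) (Suc j) (delta_face Xp Dw n i v) - delta_face Xp Dw (Suc n) i (delta_face Xp Dw n j v) \<in> om.K"
    if "i < j" "j \<le> n"
    unfolding om.nf_iff[symmetric] delta_q(1)
    by (rule omega_action.delta_mag[OF omega_q that])
qed

lemma delta_leib_K:
  assumes "j \<le> n"
  defines "F \<equiv> delta_face Xp Dw"
  shows "F (Suc n) (Suc j) (F n j v) - F (Suc n) j (F n j v) + Xp (Suc (Suc n)) (Suc j) (F (Suc n) j (F n j v)) \<in> om.K"
proof -
  have n: "nf om.K (F m i (F n k v)) = delta_face om.qX (om.qD Dw) m i (delta_face om.qX (om.qD Dw) n k v)" for m n i k v
    unfolding F_def by (rule delta_q(1))
  have "nf om.K (F (Suc n) (Suc j) (F n j v)) = nf om.K (F (Suc n) j (F n j v) - Xp (Suc (Suc n)) (Suc j) (F (Suc n) j (F n j v)))"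
    using omega_action.delta_leib[OF omega_q assms(1), of v]
    unfolding klin_diff[OF klin_nf[OF om.subspace_K]] om.nf_X[symmetric, of _ _ "F _ _ _"] n .
  then show ?thesis unfolding om.nf_iff by (simp add: algebra_simps)
qed

text \<open>The inverse map descends to Leib. A relator acts as an expression in two successive
  faces; \<open>psi.ext\<close> replaces both by differences, and the result vanishes by
  \<open>delta_leib\<close>. The surrounding words preserve the kernel.\<close>

lemma psi_leibK:
  fixes x :: "'a::field tens"
  shows "x \<in> leibK \<Longrightarrow> psi.ext x \<in> om.K"
proof (rule leibK_map[OF psi.klin_ext om.subspace_K])
  fix a b v and r :: "'a tens" assume *: "wvalid Xgens a" "wvalid Dgens b" "r \<in> leib_rels" "tv v"
  then obtain n j where r: "j \<le> n" "r = bs (unitw (n + 2), (n, [Dg (Suc n) (Suc j), Dg n j]))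
                - bs (unitw (n + 2), (n, [Dg (Suc n) j, Dg n j]))
                + bs (xw (n + 2) [Suc j], (n, [Dg (Suc n) j, Dg n j]))"
    by (auto simp: leib_rels_def)
  let ?F = "delta_face Xp Dw" and ?v = "bs v :: 'a tens"
  have D: "nf om.K (psi.ext (Dz n i y)) = nf om.K (?F n i (psi.ext y))" if "i \<le> n" for n i y
    using psi.ext_D[OF that] by (simp add: om.nf_iff)
  have F: "nf om.K (?F n i (nf om.K y)) = nf om.K (?F n i y)" for n i y
    by (rule nf_map) (simp_all add: om.subspace_K dw.klin_D psi.F_in)
  \<comment> \<open>The outer face is replaced first; for the inner one the congruence has to be
    carried through the outer operator, which is possible since that preserves the kernel.\<close>
  have DD: "nf om.K (psi.ext (Dz (Suc n) i (Dz n j ?v))) = nf om.K (?F (Suc n) i (?F n j (psi.ext ?v)))"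
    if "i \<le> Suc n" for i
    using D[OF that, of "Dz n j ?v"] D[OF r(1), of ?v] F by metis
  have XDD: "om.qX (Suc (Suc n)) (Suc j) (psi.ext (Dz (Suc n) j (Dz n j ?v)))
    = om.qX (Suc (Suc n)) (Suc j) (?F (Suc n) j (?F n j (psi.ext ?v)))"
    using DD[of j] om.nf_X[of "Suc (Suc n)" "Suc j"] r(1) by (metis le_SucI)
  have "nf om.K (psi.ext (mact Dz r ?v)) = nf om.K (?F (Suc n) (Suc j) (?F n j (psi.ext ?v))
    - ?F (Suc n) j (?F n j (psi.ext ?v)) + Xp (Suc (Suc n)) (Suc j) (?F (Suc n) j (?F n j (psi.ext ?v))))"
    unfolding r(2) mact_leib[OF r(1)]
    using DD[of "Suc j"] DD[of j] XDD r(1)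
    by (simp add: klin_add[OF psi.klin_ext] klin_diff[OF psi.klin_ext] om.nf_add klin_diff[OF klin_nf[OF om.subspace_K]] psi.ext_Xp)
  also have "\<dots> = 0"
    using delta_leib_K[OF r(1)] by (simp add: nf_eq_0_iff[OF om.subspace_K])
  finally have "psi.ext (mact Dz r ?v) \<in> om.K" by (simp add: nf_eq_0_iff[OF om.subspace_K])
  then have 1: "wact ?F b (psi.ext (mact Dz r ?v)) \<in> om.K" by (rule psi.L_wact)
  have "psi.ext (wact Dz b (mact Dz r ?v)) \<in> om.K"
    using pm.subspace_add[OF om.subspace_K psi.ext_D_wact[OF *(2), of "mact Dz r ?v"] 1] by simp
  then show "psi.ext (wact Dz a (wact Dz b (mact Dz r ?v))) \<in> om.K"
    unfolding psi.ext_X(1)[OF *(1)] using om.K_wact[of _ a] by (simp only: wact_X_indep[OF *(1), of Dz _ Dw])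
qed (auto intro: psi.ext_K)

text \<open>The recursion for \<open>\<rho>\<close> telescopes against the differences: the term
  subtracted from the leading face is restored by the recursive part.\<close>

lemma psi_rho: "j \<le> n \<Longrightarrow> psi.ext (rho_face Xp Dz n j y) - Dw n j (psi.ext y) \<in> om.K"
proof (induction j)
  case 0
  then show ?case using psi.ext_D[of 0 n y] by (simp add: delta_face_simps)
next
  case (Suc j)
  have "Xp (Suc n) (Suc j) (psi.ext (rho_face Xp Dz n j y) - Dw n j (psi.ext y)) \<in> om.K"
    using Suc by (intro om.K_X) simp
  with psi.ext_D[of "Suc j" n y] Suc.prems
  have "(psi.ext (Dz n (Suc j) y) - delta_face Xp Dw n (Suc j) (psi.ext y))
    + Xp (Suc n) (Suc j) (psi.ext (rho_face Xp Dz n j y) - Dw n j (psi.ext y)) \<in> om.K"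
    by (intro pm.subspace_add[OF om.subspace_K])
  then show ?case
    by (simp add: klin_add[OF psi.klin_ext] psi.ext_Xp klin_diff[OF klin_Xp] delta_face_simps algebra_simps)
qed

lemma phi_delta: "j \<le> n \<Longrightarrow> phi.ext (delta_face Xp Dw n j y) - Dz n j (phi.ext y) \<in> leibK"
proof (cases j)
  case 0
  then show ?thesis using phi.ext_D[of 0 n y] by (simp add: 0 delta_face_simps)
next
  case (Suc i)
  assume j: "j \<le> n"
  have "Xp (Suc n) j (phi.ext (Dw n i y) - rho_face Xp Dz n i (phi.ext y)) \<in> leibK"
    using Suc j by (intro leibK_X phi.ext_D) simp
  from pm.subspace_diff[OF subspace_leibK phi.ext_D[OF j, of y] this]
  have "(phi.ext (Dw n j y) - rho_face Xp Dz n j (phi.ext y))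
    - Xp (Suc n) j (phi.ext (Dw n i y) - rho_face Xp Dz n i (phi.ext y)) \<in> leibK" .
  then show ?thesis using Suc
    by (simp add: klin_diff[OF phi.klin_ext] phi.ext_Xp klin_diff[OF klin_Xp] delta_face_simps algebra_simps)
qed

text \<open>\<open>phi.ext\<close> evaluates the face word in the operators \<open>\<rho>\<close>;
  \<open>psi.ext\<close> turns these letter by letter into faces again, and applied to the unit they
  rebuild the pair.\<close>

lemma psi_phi:
  assumes "tv p"
  shows "psi.ext (phi.ext (bs p)) - bs p \<in> (om.K :: 'a::field tens set)"
proof -
  obtain a b where p: "p = (a, b)" "wvalid Xgens a" "wvalid Dgens b" "fst a = wtgt b"
    using assms by (cases p) (auto simp: tvalid_def wsrc_def)
  let ?R = "rho_face Xp Dz" and ?e = "bs (unitw (wsrc b), unitw (wsrc b)) :: 'a tens"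
  have "psi.ext (wact ?R b ?e) - wact Dw b (psi.ext ?e) \<in> om.K"
    by (rule psi.ext_wact[OF psi_rho klin_Dp om.K_D p(3)])
  then have "psi.ext (wact ?R b ?e) - bs (unitw (wtgt b), b) \<in> om.K"
    by (simp only: psi.ext_unit om.wact_D_one[OF p(3)])
  from om.K_wact[OF this, of a]
  have "wact Dw a (psi.ext (wact ?R b ?e)) - bs p \<in> om.K"
    using p by (simp add: klin_diff[OF om.klin_wact] om.wact_X_unit)
  moreover have "psi.ext (wact ?R a z) = wact Dw a (psi.ext z)" for z :: "'a tens"
    using psi.ext_X(1)[OF p(2)] by (simp only: wact_X_indep[OF p(2), of ?R _ Dz] wact_X_indep[OF p(2), of Dz _ Dw])
  ultimately show ?thesis by (simp add: p(1) phi.ext_bs[OF assms[unfolded p(1)]])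
qed

lemma phi_psi:
  assumes "tv p"
  shows "phi.ext (psi.ext (bs p)) - bs p \<in> (leibK :: 'a::field tens set)"
proof -
  obtain a b where p: "p = (a, b)" "wvalid Xgens a" "wvalid Dgens b" "fst a = wtgt b"
    using assms by (cases p) (auto simp: tvalid_def wsrc_def)
  let ?F = "delta_face Xp Dw" and ?R = "rho_face Xp Dz" and ?e = "bs (unitw (wsrc b), unitw (wsrc b)) :: 'a tens"
  have "phi.ext (wact ?F b ?e) - wact Dz b (phi.ext ?e) \<in> leibK"
    by (rule phi.ext_wact[OF phi_delta klin_Dp leibK_D p(3)])
  then have "phi.ext (wact ?F b ?e) - bs (unitw (wtgt b), b) \<in> leibK"
    by (simp only: phi.ext_unit ze.wact_D_one[OF p(3)])
  from phi.L_wact[OF this, of a]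
  have "wact ?R a (phi.ext (wact ?F b ?e)) - bs p \<in> leibK"
    using p by (simp add: klin_diff[OF rz.klin_wact] rz.wact_X_unit)
  moreover have "phi.ext (wact ?F a z) = wact ?R a (phi.ext z)" for z :: "'a tens"
    using phi.ext_X(1)[OF p(2)] by (simp only: wact_X_indep[OF p(2), of ?F _ Dw] wact_X_indep[OF p(2), of Dw _ ?R])
  ultimately show ?thesis by (simp add: p(1) psi.ext_bs[OF assms[unfolded p(1)]])
qed

text \<open>\<open>rho_face\<close> is composed of left operators, so right multiplication commutes
  with it.\<close>

lemma mact_rho: "mact Dz (wact (rho_face Xp Dz) w x) y = wact (rho_face Xp Dz) w (mact Dz x y)"
proof -
  have r: "mact Dz (rho_face Xp Dz n i x) y = rho_face Xp Dz n i (mact Dz x y)" for n i x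
    by (induction i) (simp_all add: ze.mact_Dp ze.mact_Xp klin_add[OF klin_mact1])
  have "mact Dz (wact (rho_face Xp Dz) (n, gs) x) y = wact (rho_face Xp Dz) (n, gs) (mact Dz x y)" for n gs
  proof (induction gs)
    case (Cons g gs)
    then show ?case by (cases g) (simp_all add: r ze.mact_Xp)
  qed (simp add: ze.mact_Ep)
  then show ?thesis by (cases w) simp
qed

text \<open>Modulo the kernels both twisted products are actions of their left factors.
  \<open>phi.ext\<close> turns acting faces into \<open>rho_face\<close>, and by
  \<open>mact_rho\<close> this is the action of the image of \<open>p\<close>.\<close>

lemma phi_mult:
  assumes "tv p" "tv q"
  shows "phi.ext (tw om.law (bs p) (bs q)) - tw zeta (phi.ext (bs p)) (phi.ext (bs q)) \<in> (leibK :: 'a::field tens set)"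
proof -
  obtain a b where p: "p = (a, b)" "wvalid Xgens a" "wvalid Dgens b"
    using assms by (cases p) (auto simp: tvalid_def)
  let ?R = "rho_face Xp Dz" and ?y = "phi.ext (bs q) :: 'a tens"
  have t: "(bs p :: 'a tens) \<in> tspace Xgens Dgens" if "tv p" for p using that by (simp add: tspace_def)
  have "tw om.law (bs p) (bs q) - mact Dw (bs p) (bs q) \<in> (om.K :: 'a tens set)"
    by (rule om.tw_mact) (simp_all add: om.law_tsp t assms pm.subspace_0[OF om.subspace_K])
  then have 1: "phi.ext (tw om.law (bs p) (bs q)) - phi.ext (mact Dw (bs p) (bs q)) \<in> (leibK :: 'a tens set)"
    unfolding klin_diff[OF phi.klin_ext, symmetric] by (rule phi.ext_K)
  have X: "phi.ext (wact Dw a z) = wact ?R a (phi.ext z)" for z :: "'a tens"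
    using phi.ext_X(1)[OF p(2)] by (simp only: wact_X_indep[OF p(2), of Dw _ ?R])
  have "wact ?R a (phi.ext (wact Dw b (bs q)) - wact ?R b ?y) \<in> leibK"
    by (intro phi.L_wact phi.ext_D_wact p)
  then have 2: "phi.ext (mact Dw (bs p) (bs q)) - wact ?R a (wact ?R b ?y) \<in> leibK"
    using assms by (simp add: p(1) mact_bs X klin_diff[OF rz.klin_wact])
  have "mact Dz (bs (unitw (wsrc b), unitw (wsrc b))) ?y = Ep (wsrc b) ?y"
    by (simp add: mact_bs tv_pair unitw_pair Ep_Ep)
  then have "wact ?R a (wact ?R b ?y) = mact Dz (phi.ext (bs p)) ?y"
    using rz.wact_Ep[of b ?y] by (simp add: mact_rho phi.ext_bs[OF assms(1)[unfolded p(1)]] p(1))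
  moreover have "tw zeta (phi.ext (bs p)) ?y - mact Dz (phi.ext (bs p)) ?y \<in> leibK"
    by (intro K_leibK zeta_tw phi.ext_tspace t assms)
  ultimately have 3: "wact ?R a (wact ?R b ?y) - tw zeta (phi.ext (bs p)) ?y \<in> leibK"
    using pm.subspace_neg[OF subspace_leibK, of "tw zeta (phi.ext (bs p)) ?y - mact Dz (phi.ext (bs p)) ?y"] by simp
  show ?thesis by (rule phi.L_diff_trans[OF 1 phi.L_diff_trans[OF 2 3]])
qed

text \<open>One step of the recursion lengthens every descending word by its new first letter, while
  the former leading face becomes the summand for \<open>a = Suc j\<close>.\<close>

lemma rho_eq: "j \<le> n \<Longrightarrow> rho_face Xp Dz n j (bs (unitw n, unitw n)) = rho n j"
proof (induction j)
  case 0
  then show ?case by (simp add: rho_def ze.unit_face)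
next
  case (Suc j)
  have "Xp (Suc n) (Suc j) (rho n j) = Xp (Suc n) (Suc j) (bs (xw (Suc n) [], dw n j))
    + (\<Sum>a\<in>{1..j}. Xp (Suc n) (Suc j) (bs (xw (Suc n) (rev [a..<Suc j]), dw n (a - 1))))"
    by (simp only: rho_def klin_add[OF klin_Xp] klin_sum[OF klin_Xp]) (simp add: xw_def unitw_pair)
  also have "\<dots> = bs (xw (Suc n) [Suc j], dw n j)
    + (\<Sum>a\<in>{1..j}. bs (xw (Suc n) (Suc j # rev [a..<Suc j]), dw n (a - 1)))"
    by (intro arg_cong2[of _ _ _ _ plus] sum.cong refl Xp_xw) (use Suc.prems in auto)
  also have "\<dots> = (\<Sum>a\<in>{1..Suc j}. bs (xw (Suc n) (rev [a..<Suc (Suc j)]), dw n (a - 1)))"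
    by (simp add: sum.cl_ivl_Suc add.commute)
  finally show ?case using Suc by (simp add: rho_def ze.unit_face)
qed

theorem theorem3p10:
  shows "\<exists>\<omega> :: word \<times> word \<Rightarrow> (word \<times> word \<Rightarrow>\<^sub>0 'k::field).
           distlaw Dgens simp_rels Xgens sym_rels \<omega>
         \<and> has_gen_values omega_gen (tensK Xgens sym_rels Dgens simp_rels) \<omega>
         \<and> (\<exists>\<phi>. leib_iso \<omega> \<phi>)"
proof (intro exI conjI)
  show "distlaw Dgens simp_rels Xgens sym_rels (om.law :: word \<times> word \<Rightarrow> 'k tens)"
    by (rule om.distlaw_law)
  show "has_gen_values omega_gen om.K (om.law :: word \<times> word \<Rightarrow> 'k tens)"
    by (simp add: has_gen_values_def omega_law_gen pm.subspace_0[OF om.subspace_K])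
  have lin: "lin (\<lambda>p. phi.ext (bs p)) x = phi.ext x" for x :: "'k tens"
    by (rule klin_eq_lin[OF phi.klin_ext, symmetric])
  show "leib_iso om.law (\<lambda>p. phi.ext (bs p) :: 'k tens)"
    unfolding leib_iso_def lin
  proof (intro conjI allI impI ballI)
    fix p assume "tv p"
    note t = phi.ext_tsp[OF this]
    show "phi.ext (bs p :: 'k tens) \<in> tspace Xgens Dgens" by (rule tsp_tspace[OF t])
    fix q assume q: "q \<in> Poly_Mapping.keys (phi.ext (bs p :: 'k tens))"
    show "wtgt (fst q) = wtgt (fst p)" "wsrc (snd q) = wsrc (snd p)"
      using om.tsp_keys[OF t q] \<open>tv p\<close> by (auto simp: tvalid_def wtgt_Xgens)
  next
    fix x :: "'k tens" assume "x \<in> om.K"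
    then show "phi.ext x \<in> leibK" by (rule phi.ext_K)
  next
    fix p q assume "tv p \<and> tv q"
    then show "phi.ext (tw om.law (bs p) (bs q)) - tw zeta (phi.ext (bs p)) (phi.ext (bs q) :: 'k tens) \<in> leibK"
      by (intro phi_mult) auto
  next
    fix n
    show "phi.ext (bs (unitw n, unitw n)) - bs (unitw n, unitw n) \<in> (leibK :: 'k tens set)"
      by (simp add: phi.ext_unit phi.L_zero)
  next
    fix x :: "'k tens" assume x: "x \<in> tspace Xgens Dgens" "phi.ext x \<in> leibK"
    \<comment> \<open>Injectivity from the left inverse: \<open>psi.ext\<close> sends
      \<open>phi.ext x\<close> into \<open>om.K\<close>, and the result differs from
      \<open>x\<close> only by an element of \<open>om.K\<close>.\<close>
    have "psi.ext (phi.ext x) - x \<in> om.K"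
    proof (rule klin_in_subspace[of "\<lambda>x. psi.ext (phi.ext x) - x", OF _ om.subspace_K])
      fix p assume "p \<in> Poly_Mapping.keys x"
      then show "psi.ext (phi.ext (bs p)) - bs p \<in> (om.K :: 'k tens set)"
        using x(1) by (intro psi_phi) (simp add: tspace_def)
    qed (intro klin_minus_fun klin_id klin_compose[OF psi.klin_ext phi.klin_ext])
    from pm.subspace_diff[OF om.subspace_K psi_leibK[OF x(2)] this] show "x \<in> om.K" by simp
  next
    fix y :: "'k tens" assume y: "y \<in> tspace Xgens Dgens"
    have "phi.ext (psi.ext y) - y \<in> leibK"
    proof (rule klin_in_subspace[of "\<lambda>x. phi.ext (psi.ext x) - x", OF _ subspace_leibK])
      fix p assume "p \<in> Poly_Mapping.keys y"
      then show "phi.ext (psi.ext (bs p)) - bs p \<in> (leibK :: 'k tens set)"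
        using y by (intro phi_psi) (simp add: tspace_def)
    qed (intro klin_minus_fun klin_id klin_compose[OF phi.klin_ext psi.klin_ext])
    then show "\<exists>x\<in>tspace Xgens Dgens. phi.ext x - y \<in> leibK"
      using psi.ext_tspace[OF y] by blast
  next
    fix n j :: nat assume "j < n"
    then have "bs (xw n [j], unitw n) = Xp n j (bs (unitw n, unitw n) :: 'k tens)"
      by (simp add: xw_def Xp_bs tv_pair unitw_pair)
    then show "phi.ext (bs (xw n [j], unitw n)) - bs (xw n [j], unitw n) \<in> (leibK :: 'k tens set)"
      by (simp add: phi.ext_Xp phi.ext_unit phi.L_zero)
  next
    fix n j :: nat assume j: "j \<le> n"
    then have "phi.ext (bs (unitw (Suc n), dw n j) :: 'k tens) = rho_face Xp Dz n j (bs (unitw n, unitw n))"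
      using Ep_tsp[OF phi.unit_in_tsp[where 'a = 'k]]
      by (subst phi.ext_bs) (simp_all add: tv_pair unitw_pair dw_def rz.Ep_D)
    then show "phi.ext (bs (unitw (Suc n), dw n j)) - rho n j \<in> (leibK :: 'k tens set)"
      using j by (simp add: rho_eq phi.L_zero)
  qed
qed

end
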